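(* Let $E_1,E_2,E_3$ be spectral measures on measurable spaces $(\mathcal X_1,\mathfrak M_1)$, $(\mathcal X_2,\mathfrak M_2)$, $(\mathcal X_3,\mathfrak M_3)$, acting on a Hilbert space $\mathcal H$. Let $\Psi\in L^\infty(E_1)\otimes_{\rm h}L^\infty(E_2)\otimes_{\rm h}L^\infty(E_3)$ (Haagerup tensor product). For bounded linear operators $T,R$ on $\mathcal H$ let $$W=\int_{\mathcal X_1}\int_{\mathcal X_2}\int_{\mathcal X_3}\Psi(x_1,x_2,x_3)\,dE_1(x_1)\,T\,dE_2(x_2)\,R\,dE_3(x_3)$$ be the triple operator integral. Then the following holds: (i) if $p\ge 2$, $T\in\mathcal B(\mathcal H)$ and $R\in \boldsymbol S_p$, then $W\in\boldsymbol S_p$ and $$\|W\|_{\boldsymbol S_p}\le \|\Psi\|_{L^\infty\otimes_{\rm h}L^\infty\otimes_{\rm h}L^\infty}\,\|T\|\cdot\|R\|_{\boldsymbol S_p};$$ (ii) if $p\ge 2$, $T\in\boldsymbol S_p$ and $R\in\mathcal B(\mathcal H)$, then $W\in\boldsymbol S_p$ and $$\|W\|_{\boldsymbol S_p}\le \|\Psi\|_{L^\infty\otimes_{\rm h}L^\infty\otimes_{\rm h}L^\infty}\,\|T\|_{\boldsymbol S_p}\|R\|;$$ (iii) if $1/p+1/q\le 1/2$, $T\in\boldsymbol S_p$ and $R\in\boldsymbol S_q$, then $W\in\boldsymbol S_r$ with $1/r=1/p+1/q$ and $$\|W\|_{\boldsymbol S_r}\le \|\Psi\|_{L^\infty\otimes_{\rm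 h}L^\infty\otimes_{\rm h}L^\infty}\,\|T\|_{\boldsymbol S_p}\|R\|_{\boldsymbol S_q}.$$
   Context: $\mathcal B(\mathcal H)$ is the space of bounded linear operators on $\mathcal H$ with operator norm $\|\cdot\|$; $\boldsymbol S_p$ is the Schatten--von Neumann class of operators on $\mathcal H$. A spectral measure is a countably additive measure whose values are orthogonal projections on $\mathcal H$ and whose value on the whole space is $I$. $L^\infty(E)$ is the space of $E$-essentially bounded measurable functions. Notation. $\mathcal B$ is the space of infinite matrices $\{b_{jk}\}_{j,k\ge0}$ that induce bounded linear operators on $\ell^2$, with the operator norm. $\{\alpha_j\}_{j\ge0}\in L^\infty(\ell^2)$ means that the $\alpha_j$ are measurable and $\|\{\alpha_j\}\|_{L^\infty(\ell^2)}=\operatorname{ess\,sup}_x\big(\sum_j|\alpha_j(x)|^2\big)^{1/2}<\infty$; $\{\beta_{jk}\}_{j,k\ge0}\in L^\infty(\mathcal B)$ means that the $\beta_{jk}$ are measurable and $\|\{\beta_{jk}\}\|_{L^\infty(\mathcal B)}=\operatorname{ess\,sup}_x\|\{\beta_{jk}(x)\}_{j,k\ge0}\|_{\mathcal B}<\infty$ (essential suprema with respect to the corresponding spectral measure). Haagerup tensor product. $L^\infty(E_1)\otimes_{\rm h}L^\infty(E_2)\otimes_{\rm h}L^\infty(E_3)$ consists of the functions $\Psi$ on $\mathcal X_1\times\mathcal X_2\times\mathcal X_3$ that admit a representation $$\Psi(x_1,x_2,x_3)=\sum_{j,k\ge0}\alpha_j(x_1)\beta_{jk}(x_2)\gamma_k(x_3),\qquad(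 * )$$ with $\{\alpha_j\}_{j\ge0}\in L^\infty(\ell^2)$ (over $E_1$), $\{\gamma_k\}_{k\ge0}\in L^\infty(\ell^2)$ (over $E_3$), $\{\beta_{jk}\}_{j,k\ge0}\in L^\infty(\mathcal B)$ (over $E_2$). Its norm $\|\Psi\|_{L^\infty\otimes_{\rm h}L^\infty\otimes_{\rm h}L^\infty}$ is the infimum of $\|\{\alpha_j\}\|_{L^\infty(\ell^2)}\|\{\beta_{jk}\}\|_{L^\infty(\mathcal B)}\|\{\gamma_k\}\|_{L^\infty(\ell^2)}$ over all representations $( * )$. Triple operator integral. For such $\Psi$ and bounded $T,R$, $$W=\sum_{j,k\ge0}\Big(\int\alpha_j\,dE_1\Big)T\Big(\int\beta_{jk}\,dE_2\Big)R\Big(\int\gamma_k\,dE_3\Big),$$ the limit (in the weak operator topology) of the partial sums over $0\le j\le M$, $0\le k\le N$ as $M,N\to\infty$; it is a bounded operator that does not depend on the choice of the representation $( * )$. Convention: if an exponent equals $\infty$, then $1/\infty=0$ and $\boldsymbol S_\infty$ is understood as $\mathcal B(\mathcal H)$ with the operator norm. *)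

theory Defs
  imports "HOL-Analysis.Analysis"
begin

subsection \<open>Complex Hilbert spaces and their bounded operators\<close>

text \<open>The inner product is linear in the first argument.\<close>

class complex_hilbert_space = banach +
  fixes scaleC :: "complex \<Rightarrow> 'a \<Rightarrow> 'a" (infixr \<open>*\<^sub>C\<close> 75)
    and cinner :: "'a \<Rightarrow> 'a \<Rightarrow> complex"
  assumes scaleC_add_right: "c *\<^sub>C (x + y) = c *\<^sub>C x + c *\<^sub>C y"
    and scaleC_add_left: "(c + d) *\<^sub>C x = c *\<^sub>C x + d *\<^sub>C x"
    and scaleC_scaleC: "c *\<^sub>C d *\<^sub>C x = (c * d) *\<^sub>C x"
    and scaleC_of_real: "complex_of_real r *\<^sub>C x = r *\<^sub>R x"
    and cinner_commute: "cinner x y = cnj (cinner y x)"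
    and cinner_add_left: "cinner (x + y) z = cinner x z + cinner y z"
    and cinner_scaleC_left: "cinner (c *\<^sub>C x) y = c * cinner x y"
    and cinner_self: "cinner x x = complex_of_real ((norm x)\<^sup>2)"

lemma vector_space_scaleC: "vector_space (scaleC :: complex \<Rightarrow> 'h::complex_hilbert_space \<Rightarrow> 'h)"
proof
  show "1 *\<^sub>C x = x" for x :: 'h
    using scaleC_of_real[of 1 x] by simp
qed (simp_all add: scaleC_add_right scaleC_add_left scaleC_scaleC)

instantiation complex :: complex_hilbert_space
begin

definition "scaleC_complex (c :: complex) (x :: complex) = c * x"
definition "cinner_complex (x :: complex) y = x * cnj y"

instance
  by standard
    (simp_all add: scaleC_complex_def cinner_complex_def algebra_simps scaleR_conv_of_real
      complex_norm_square del: of_real_power)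

end

text \<open>
  The type \<open>'h \<Rightarrow>\<^sub>L 'h\<close> consists of the bounded real-linear operators;
  \<open>bounded_operators\<close> is its subspace \<open>\<B>(\<H>)\<close> of complex-linear ones. The norm of
  \<open>'h \<Rightarrow>\<^sub>L 'h\<close> restricts to the operator norm.
\<close>

definition bounded_operators :: "('h::complex_hilbert_space \<Rightarrow>\<^sub>L 'h) set" where
  "bounded_operators = {T. \<forall>c x. blinfun_apply T (c *\<^sub>C x) = c *\<^sub>C blinfun_apply T x}"

definition orthogonal_projection :: "('h::complex_hilbert_space \<Rightarrow>\<^sub>L 'h) \<Rightarrow> bool" where
  "orthogonal_projection P \<longleftrightarrow> P \<in> bounded_operators \<and> P o\<^sub>L P = P \<and>
     (\<forall>u v. cinner (blinfun_apply P u) v = cinner u (blinfun_apply P v))"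


subsection \<open>Schatten--von Neumann classes\<close>

definition rank_le :: "('h::complex_hilbert_space \<Rightarrow>\<^sub>L 'h) \<Rightarrow> nat \<Rightarrow> bool" where
  "rank_le K n \<longleftrightarrow>
     (\<exists>B. finite B \<and> card B \<le> n \<and> range (blinfun_apply K) \<subseteq> module.span scaleC B)"

definition singular_value :: "nat \<Rightarrow> ('h::complex_hilbert_space \<Rightarrow>\<^sub>L 'h) \<Rightarrow> real" where
  "singular_value n T = Inf {norm (T - K) | K. K \<in> bounded_operators \<and> rank_le K n}"

text \<open>The exponent ranges over \<open>(0, \<infinity>]\<close>; the norm is \<open>\<infinity>\<close> outside the class.\<close>

definition schatten_norm :: "ennreal \<Rightarrow> ('h::complex_hilbert_space \<Rightarrow>\<^sub>L 'h) \<Rightarrow> ennreal" where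
  "schatten_norm p T =
     (if p = \<infinity> then ennreal (norm T)
      else if summable (\<lambda>n. singular_value n T powr enn2real p)
      then ennreal ((\<Sum>n. singular_value n T powr enn2real p) powr (1 / enn2real p))
      else \<infinity>)"

definition schatten_class :: "ennreal \<Rightarrow> ('h::complex_hilbert_space \<Rightarrow>\<^sub>L 'h) set" where
  "schatten_class p = {T \<in> bounded_operators. schatten_norm p T < \<infinity>}"


subsection \<open>Spectral measures and spectral integrals\<close>

text \<open>
  Of the argument \<open>M\<close> only the measurable space \<open>(space M, sets M)\<close> is relevant.
  Countable additivity is with respect to the strong operator topology.
\<close>

definition spectral_measure ::
    "'x measure \<Rightarrow> ('x set \<Rightarrow> 'h::complex_hilbert_space \<Rightarrow>\<^sub>L 'h) \<Rightarrow> bool" where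
  "spectral_measure M E \<longleftrightarrow>
     (\<forall>A\<in>sets M. orthogonal_projection (E A)) \<and>
     E (space M) = id_blinfun \<and>
     (\<forall>A. range A \<subseteq> sets M \<longrightarrow> disjoint_family A \<longrightarrow>
        (\<forall>u. (\<lambda>n::nat. blinfun_apply (E (A n)) u) sums blinfun_apply (E (\<Union>n. A n)) u))"

definition scalar_measure ::
    "'x measure \<Rightarrow> ('x set \<Rightarrow> 'h::complex_hilbert_space \<Rightarrow>\<^sub>L 'h) \<Rightarrow> 'h \<Rightarrow> 'x measure" where
  "scalar_measure M E u =
     measure_of (space M) (sets M) (\<lambda>A. ennreal (Re (cinner (blinfun_apply (E A) u) u)))"

text \<open>
  \<open>\<integral>f dE\<close> is the operator \<open>A\<close> with \<open>(A u, u) = \<integral>f d(E u, u)\<close> for all \<open>u\<close>;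
  by polarization this determines all \<open>(A u, v)\<close>.
\<close>

definition spectral_integral ::
    "'x measure \<Rightarrow> ('x set \<Rightarrow> 'h::complex_hilbert_space \<Rightarrow>\<^sub>L 'h) \<Rightarrow> ('x \<Rightarrow> complex) \<Rightarrow> 'h \<Rightarrow>\<^sub>L 'h" where
  "spectral_integral M E f =
     (THE A. A \<in> bounded_operators \<and>
        (\<forall>u. cinner (blinfun_apply A u) u = integral\<^sup>L (scalar_measure M E u) f))"

definition spectral_AE ::
    "'x measure \<Rightarrow> ('x set \<Rightarrow> 'h::complex_hilbert_space \<Rightarrow>\<^sub>L 'h) \<Rightarrow> ('x \<Rightarrow> bool) \<Rightarrow> bool" where
  "spectral_AE M E P \<longleftrightarrow> (\<exists>N\<in>sets M. E N = 0 \<and> (\<forall>x\<in>space M - N. P x))"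

definition spectral_ess_sup ::
    "'x measure \<Rightarrow> ('x set \<Rightarrow> 'h::complex_hilbert_space \<Rightarrow>\<^sub>L 'h) \<Rightarrow> ('x \<Rightarrow> ennreal) \<Rightarrow> ennreal" where
  "spectral_ess_sup M E f = Inf {c. spectral_AE M E (\<lambda>x. f x \<le> c)}"


subsection \<open>The spaces \<open>L\<^sup>\<infinity>(\<ell>\<^sup>2)\<close> and \<open>L\<^sup>\<infinity>(\<B>)\<close>\<close>

definition l2_norm :: "(nat \<Rightarrow> complex) \<Rightarrow> ennreal" where
  "l2_norm a =
     (if summable (\<lambda>j. (cmod (a j))\<^sup>2) then ennreal (sqrt (\<Sum>j. (cmod (a j))\<^sup>2)) else \<infinity>)"

text \<open>The norm is \<open>\<infinity>\<close> if the matrix does not induce a bounded operator on \<open>\<ell>\<^sup>2\<close>.\<close>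

definition matrix_norm :: "(nat \<Rightarrow> nat \<Rightarrow> complex) \<Rightarrow> ennreal" where
  "matrix_norm b =
     Inf {C. \<forall>a. l2_norm a < \<infinity> \<longrightarrow>
       (\<forall>j. summable (\<lambda>k. b j k * a k)) \<and> l2_norm (\<lambda>j. \<Sum>k. b j k * a k) \<le> C * l2_norm a}"

definition Linf_l2_norm ::
    "'x measure \<Rightarrow> ('x set \<Rightarrow> 'h::complex_hilbert_space \<Rightarrow>\<^sub>L 'h) \<Rightarrow> (nat \<Rightarrow> 'x \<Rightarrow> complex) \<Rightarrow> ennreal" where
  "Linf_l2_norm M E \<alpha> = spectral_ess_sup M E (\<lambda>x. l2_norm (\<lambda>j. \<alpha> j x))"

definition Linf_l2 ::
    "'x measure \<Rightarrow> ('x set \<Rightarrow> 'h::complex_hilbert_space \<Rightarrow>\<^sub>L 'h) \<Rightarrow> (nat \<Rightarrow> 'x \<Rightarrow> complex) set" where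
  "Linf_l2 M E = {\<alpha>. (\<forall>j. \<alpha> j \<in> borel_measurable M) \<and> Linf_l2_norm M E \<alpha> < \<infinity>}"

definition Linf_matrix_norm ::
    "'x measure \<Rightarrow> ('x set \<Rightarrow> 'h::complex_hilbert_space \<Rightarrow>\<^sub>L 'h)
      \<Rightarrow> (nat \<Rightarrow> nat \<Rightarrow> 'x \<Rightarrow> complex) \<Rightarrow> ennreal" where
  "Linf_matrix_norm M E \<beta> = spectral_ess_sup M E (\<lambda>x. matrix_norm (\<lambda>j k. \<beta> j k x))"

definition Linf_matrix ::
    "'x measure \<Rightarrow> ('x set \<Rightarrow> 'h::complex_hilbert_space \<Rightarrow>\<^sub>L 'h)
      \<Rightarrow> (nat \<Rightarrow> nat \<Rightarrow> 'x \<Rightarrow> complex) set" where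
  "Linf_matrix M E = {\<beta>. (\<forall>j k. \<beta> j k \<in> borel_measurable M) \<and> Linf_matrix_norm M E \<beta> < \<infinity>}"


subsection \<open>The Haagerup tensor product and triple operator integrals\<close>

text \<open>
  The double series need not converge absolutely; its sum is the limit of the rectangular
  partial sums as both bounds tend to infinity independently.
\<close>

definition haagerup_representation ::
    "'x measure \<Rightarrow> ('x set \<Rightarrow> 'h::complex_hilbert_space \<Rightarrow>\<^sub>L 'h)
      \<Rightarrow> 'y measure \<Rightarrow> ('y set \<Rightarrow> 'h \<Rightarrow>\<^sub>L 'h)
      \<Rightarrow> 'z measure \<Rightarrow> ('z set \<Rightarrow> 'h \<Rightarrow>\<^sub>L 'h)
      \<Rightarrow> ('x \<Rightarrow> 'y \<Rightarrow> 'z \<Rightarrow> complex)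
      \<Rightarrow> (nat \<Rightarrow> 'x \<Rightarrow> complex) \<Rightarrow> (nat \<Rightarrow> nat \<Rightarrow> 'y \<Rightarrow> complex) \<Rightarrow> (nat \<Rightarrow> 'z \<Rightarrow> complex) \<Rightarrow> bool" where
  "haagerup_representation M1 E1 M2 E2 M3 E3 \<Psi> \<alpha> \<beta> \<gamma> \<longleftrightarrow>
     \<alpha> \<in> Linf_l2 M1 E1 \<and> \<beta> \<in> Linf_matrix M2 E2 \<and> \<gamma> \<in> Linf_l2 M3 E3 \<and>
     (\<forall>x1\<in>space M1. \<forall>x2\<in>space M2. \<forall>x3\<in>space M3.
        ((\<lambda>(m, n). \<Sum>j\<le>m. \<Sum>k\<le>n. \<alpha> j x1 * \<beta> j k x2 * \<gamma> k x3) \<longlongrightarrow> \<Psi> x1 x2 x3)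
          (sequentially \<times>\<^sub>F sequentially))"

definition haagerup_tensor ::
    "'x measure \<Rightarrow> ('x set \<Rightarrow> 'h::complex_hilbert_space \<Rightarrow>\<^sub>L 'h)
      \<Rightarrow> 'y measure \<Rightarrow> ('y set \<Rightarrow> 'h \<Rightarrow>\<^sub>L 'h)
      \<Rightarrow> 'z measure \<Rightarrow> ('z set \<Rightarrow> 'h \<Rightarrow>\<^sub>L 'h)
      \<Rightarrow> ('x \<Rightarrow> 'y \<Rightarrow> 'z \<Rightarrow> complex) set" where
  "haagerup_tensor M1 E1 M2 E2 M3 E3 =
     {\<Psi>. \<exists>\<alpha> \<beta> \<gamma>. haagerup_representation M1 E1 M2 E2 M3 E3 \<Psi> \<alpha> \<beta> \<gamma>}"

definition haagerup_norm ::
    "'x measure \<Rightarrow> ('x set \<Rightarrow> 'h::complex_hilbert_space \<Rightarrow>\<^sub>L 'h)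
      \<Rightarrow> 'y measure \<Rightarrow> ('y set \<Rightarrow> 'h \<Rightarrow>\<^sub>L 'h)
      \<Rightarrow> 'z measure \<Rightarrow> ('z set \<Rightarrow> 'h \<Rightarrow>\<^sub>L 'h)
      \<Rightarrow> ('x \<Rightarrow> 'y \<Rightarrow> 'z \<Rightarrow> complex) \<Rightarrow> ennreal" where
  "haagerup_norm M1 E1 M2 E2 M3 E3 \<Psi> =
     Inf {Linf_l2_norm M1 E1 \<alpha> * Linf_matrix_norm M2 E2 \<beta> * Linf_l2_norm M3 E3 \<gamma> | \<alpha> \<beta> \<gamma>.
       haagerup_representation M1 E1 M2 E2 M3 E3 \<Psi> \<alpha> \<beta> \<gamma>}"

definition wot_double_sum ::
    "(nat \<Rightarrow> nat \<Rightarrow> 'h::complex_hilbert_space \<Rightarrow>\<^sub>L 'h) \<Rightarrow> ('h \<Rightarrow>\<^sub>L 'h) \<Rightarrow> bool" where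
  "wot_double_sum S W \<longleftrightarrow>
     (\<forall>u v. ((\<lambda>(m, n). cinner (blinfun_apply (\<Sum>j\<le>m. \<Sum>k\<le>n. S j k) u) v)
        \<longlongrightarrow> cinner (blinfun_apply W u) v) (sequentially \<times>\<^sub>F sequentially))"

text \<open>
  The description is meaningful only because the limit exists for every representation and is
  the same for all of them; neither fact is built into the definition.
\<close>

definition triple_operator_integral ::
    "'x measure \<Rightarrow> ('x set \<Rightarrow> 'h::complex_hilbert_space \<Rightarrow>\<^sub>L 'h)
      \<Rightarrow> 'y measure \<Rightarrow> ('y set \<Rightarrow> 'h \<Rightarrow>\<^sub>L 'h)
      \<Rightarrow> 'z measure \<Rightarrow> ('z set \<Rightarrow> 'h \<Rightarrow>\<^sub>L 'h)
      \<Rightarrow> ('x \<Rightarrow> 'y \<Rightarrow> 'z \<Rightarrow> complex) \<Rightarrow> ('h \<Rightarrow>\<^sub>L 'h) \<Rightarrow> ('h \<Rightarrow>\<^sub>L 'h) \<Rightarrow> 'h \<Rightarrow>\<^sub>L 'h" where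
  "triple_operator_integral M1 E1 M2 E2 M3 E3 \<Psi> T R =
     (THE W. W \<in> bounded_operators \<and>
        (\<exists>\<alpha> \<beta> \<gamma>. haagerup_representation M1 E1 M2 E2 M3 E3 \<Psi> \<alpha> \<beta> \<gamma> \<and>
           wot_double_sum
             (\<lambda>j k. spectral_integral M1 E1 (\<alpha> j) o\<^sub>L T o\<^sub>L spectral_integral M2 E2 (\<beta> j k)
                o\<^sub>L R o\<^sub>L spectral_integral M3 E3 (\<gamma> k)) W))"

end

theory Submission
  imports Defs
begin

text \<open>
  Let \<open>A\<^sub>j\<close>, \<open>B\<^sub>j\<^sub>k\<close>, \<open>C\<^sub>k\<close> be the spectral integrals of \<open>\<alpha>\<^sub>j\<close>, \<open>\<beta>\<^sub>j\<^sub>k\<close>, \<open>\<gamma>\<^sub>k\<close>. For orthonormal systems \<open>(e\<^sub>i)\<close> and \<open>(f\<^sub>i)\<close>, the bound on the operator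
  matrix \<open>(B\<^sub>j\<^sub>k)\<close> gives \<open>\<bar>\<langle>W e\<^sub>i, f\<^sub>i\<rangle>\<bar> \<le> \<parallel>\<beta>\<parallel> x\<^sub>i y\<^sub>i\<close> with \<open>x\<^sub>i\<^sup>2 = \<Sum>\<^sub>k \<parallel>R C\<^sub>k e\<^sub>i\<parallel>\<^sup>2\<close> and
  \<open>y\<^sub>i\<^sup>2 = \<Sum>\<^sub>j \<parallel>T\<^sup>* A\<^sub>j\<^sup>* f\<^sub>i\<parallel>\<^sup>2\<close>. Expanding \<open>C\<^sub>k e\<^sub>i\<close> in singular vectors \<open>g\<^sub>m\<close> of \<open>R\<close>, the matrix
  \<open>\<Sum>\<^sub>k \<bar>\<langle>C\<^sub>k e\<^sub>i, g\<^sub>m\<rangle>\<bar>\<^sup>2\<close> is doubly substochastic up to the factor \<open>\<parallel>\<gamma>\<parallel>\<^sup>2\<close>, so for \<open>q \<ge> 2\<close> Jensen's inequality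
  yields \<open>\<Sum>\<^sub>i x\<^sub>i\<^sup>q \<le> (\<parallel>\<gamma>\<parallel> \<parallel>R\<parallel>\<^sub>q)\<^sup>q\<close>, and similarly for \<open>y\<^sub>i\<close>; Hoelder's inequality combines the two.
  Since only finitely many vectors occur at a time, singular value decompositions on finite-dimensional
  subspaces suffice and compactness of the operators is never used. Parts (i) and (ii) are the cases
  \<open>p = \<infinity>\<close> and \<open>q = \<infinity>\<close> of (iii).

  That \<open>W\<close> does not depend on the representation is reduced to finite rank \<open>T\<close> and \<open>R\<close>, where it
  follows from polarization and dominated convergence for the scalar measures.
\<close>

subsection \<open>Complex Hilbert spaces\<close>

text \<open>The operator matrices control only square sums, and the passage to q-th powers is
  Jensen's inequality for t^(q/2), which is convex only if q \<ge> 2. The condition 1/p + 1/q \<le>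
  1/2 puts r into the same range, which the way back from diagonal values to singular values uses as
  well. Singular values are approximation numbers and need not be attained. Vectors that reach them
  up to a factor \<delta> < 1 take the place of singular vectors, and are then corrected on their
  finite-dimensional span. For independence of the representation the obstacle is that the double
  series need not converge absolutely. For fixed u and v, however, the vectors R C_k u, and likewise
  the adjoint images of v under A_j T, are square summable. A projection that fixes the first N of
  them changes all square partial sums by little, uniformly in their size, so one projection serves
  both representations before the limit is taken. A spectral integral is described by its quadratic
  form only; hence the repeated polarization, and the factor 2 whenever an estimate of forms becomes
  one of norms.\<close>

interpretation cvec: vector_space "scaleC :: complex \<Rightarrow> 'h::complex_hilbert_space \<Rightarrow> 'h"
  by (rule vector_space_scaleC)

lemma scaleR_scaleC: "r *\<^sub>R x = complex_of_real r *\<^sub>C x"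
  by (simp add: scaleC_of_real)

lemma cinner_add_right: "cinner x (y + z) = cinner x y + cinner x z"
  by (subst (1 2 3) cinner_commute) (simp add: cinner_add_left)

lemma cinner_scaleC_right: "cinner x (c *\<^sub>C y) = cnj c * cinner x y"
  by (subst (1 2) cinner_commute) (simp add: cinner_scaleC_left)

lemma cinner_zero_left [simp]: "cinner 0 x = 0"
  using cinner_add_left[of 0 0 x] by simp

lemma cinner_zero_right [simp]: "cinner x 0 = 0"
  using cinner_add_right[of x 0 0] by simp

lemma cinner_minus_left: "cinner (- x) y = - cinner x y"
  using cinner_add_left[of x "- x" y] by (simp add: eq_neg_iff_add_eq_0 add.commute)

lemma cinner_minus_right: "cinner x (- y) = - cinner x y"
  using cinner_add_right[of x y "- y"] by (simp add: eq_neg_iff_add_eq_0 add.commute)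

lemma cinner_diff_left: "cinner (x - y) z = cinner x z - cinner y z"
  using cinner_add_left[of x "- y" z] by (simp add: cinner_minus_left)

lemma cinner_diff_right: "cinner x (y - z) = cinner x y - cinner x z"
  using cinner_add_right[of x y "- z"] by (simp add: cinner_minus_right)

lemma cinner_scaleR_left: "cinner (r *\<^sub>R x) y = of_real r * cinner x y"
  by (simp add: scaleR_scaleC cinner_scaleC_left)

lemma cinner_scaleR_right: "cinner x (r *\<^sub>R y) = of_real r * cinner x y"
  by (simp add: scaleR_scaleC cinner_scaleC_right)

lemma cinner_sum_left: "cinner (sum f A) y = (\<Sum>i\<in>A. cinner (f i) y)"
  by (induction A rule: infinite_finite_induct) (simp_all add: cinner_add_left)

lemma cinner_sum_right: "cinner x (sum f A) = (\<Sum>i\<in>A. cinner x (f i))"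
  by (induction A rule: infinite_finite_induct) (simp_all add: cinner_add_right)

lemmas cinner_simps = cinner_add_left cinner_add_right cinner_diff_left cinner_diff_right
  cinner_scaleC_left cinner_scaleC_right cinner_minus_left cinner_minus_right

lemma norm_power2_eq_cinner: "(norm x)\<^sup>2 = Re (cinner x x)"
  by (simp add: cinner_self)

lemma cinner_self_eq_0: "cinner x x = 0 \<longleftrightarrow> x = 0"
  by (simp add: cinner_self)

lemma cmod_cinner_commute: "cmod (cinner x y) = cmod (cinner y x)"
  by (subst cinner_commute) simp

lemma norm_add_power2:
  "(norm (x + y))\<^sup>2 = (norm x)\<^sup>2 + (norm y)\<^sup>2 + 2 * Re (cinner x y)"
proof -
  have "Re (cinner y x) = Re (cinner x y)"
    by (subst cinner_commute) simp
  then show ?thesis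
    by (simp add: norm_power2_eq_cinner cinner_simps)
qed

lemma norm_diff_power2:
  "(norm (x - y))\<^sup>2 = (norm x)\<^sup>2 + (norm y)\<^sup>2 - 2 * Re (cinner x y)"
  using norm_add_power2[of x "- y"] by (simp add: cinner_minus_right)

lemma norm_scaleC: "norm (c *\<^sub>C x) = cmod c * norm x"
proof -
  have "(norm (c *\<^sub>C x))\<^sup>2 = (cmod c * norm x)\<^sup>2"
  proof -
    have "cinner (c *\<^sub>C x) (c *\<^sub>C x) = (c * cnj c) * cinner x x"
      by (simp add: cinner_simps)
    also have "\<dots> = of_real ((cmod c)\<^sup>2 * (norm x)\<^sup>2)"
      by (simp only: cinner_self of_real_mult complex_norm_square)
    finally show ?thesis
      by (simp only: norm_power2_eq_cinner[of "c *\<^sub>C x"] Re_complex_of_real power_mult_distrib)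
  qed
  then show ?thesis
    by (simp add: power2_eq_iff_nonneg)
qed

lemma cinner_Cauchy_Schwarz: "cmod (cinner x y) \<le> norm x * norm y"
proof (cases "y = 0")
  case False
  then have y: "norm y > 0" by simp
  define c where "c = cinner x y / of_real ((norm y)\<^sup>2)"
  have "Re (cinner x (c *\<^sub>C y)) = (cmod (cinner x y))\<^sup>2 / (norm y)\<^sup>2"
  proof -
    have "cinner x (c *\<^sub>C y) = cnj (cinner x y) * cinner x y / of_real ((norm y)\<^sup>2)"
      by (simp add: c_def cinner_simps)
    also have "\<dots> = of_real ((cmod (cinner x y))\<^sup>2 / (norm y)\<^sup>2)"
      by (metis complex_norm_square mult.commute of_real_divide)
    finally show ?thesis by simp
  qed
  moreover have "(norm (c *\<^sub>C y))\<^sup>2 = (cmod (cinner x y))\<^sup>2 / (norm y)\<^sup>2"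
  proof -
    have "cmod c = cmod (cinner x y) / (norm y)\<^sup>2"
      by (simp add: c_def norm_divide norm_power)
    then show ?thesis
      using y by (simp add: norm_scaleC power_mult_distrib power_divide field_simps power2_eq_square)
  qed
  ultimately have "0 \<le> (norm x)\<^sup>2 - (cmod (cinner x y))\<^sup>2 / (norm y)\<^sup>2"
    using norm_diff_power2[of x "c *\<^sub>C y"] zero_le_power2[of "norm (x - c *\<^sub>C y)"] by linarith
  then have "(cmod (cinner x y))\<^sup>2 \<le> (norm x * norm y)\<^sup>2"
    using y by (simp add: field_simps power_mult_distrib)
  then show ?thesis
    by (simp add: power2_le_iff_abs_le)
qed simp

lemma bounded_linear_cinner_left: "bounded_linear (\<lambda>x. cinner x y)"
  by (rule bounded_linear_intro[of _ "norm y"])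
    (simp_all add: cinner_add_left cinner_scaleR_left cinner_Cauchy_Schwarz scaleR_conv_of_real)

lemma bounded_linear_cinner_right: "bounded_linear (\<lambda>y. cinner x y)"
proof (rule bounded_linear_intro[of _ "norm x"])
  show "norm (cinner x y) \<le> norm y * norm x" for y
    using cinner_Cauchy_Schwarz[of x y] by (simp add: mult.commute)
qed (simp_all add: cinner_add_right cinner_scaleR_right scaleR_conv_of_real)

lemma bounded_linear_scaleC_left: "bounded_linear (\<lambda>c. c *\<^sub>C x)"
  by (rule bounded_linear_intro[of _ "norm x"])
    (simp_all add: cvec.scale_left_distrib norm_scaleC scaleR_scaleC cvec.scale_scale
      scaleC_complex_def)

lemma bounded_linear_scaleC_right: "bounded_linear (\<lambda>x. c *\<^sub>C x)"
  by (rule bounded_linear_intro[of _ "cmod c"])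
    (simp_all add: cvec.scale_right_distrib norm_scaleC scaleR_scaleC mult.commute)

lemmas tendsto_cinner_left = bounded_linear.tendsto[OF bounded_linear_cinner_left]
lemmas tendsto_cinner_right = bounded_linear.tendsto[OF bounded_linear_cinner_right]

text \<open>Two uses fix the shape: k = 2 for the minimizing sequence in
  \<open>Riesz_representation\<close>, where the parallelogram law bounds squared distances, and k =
  1 for the operators that approximate a spectral integral.\<close>

lemma convergent_of_norm_diff_le:
  fixes X :: "nat \<Rightarrow> 'a::banach"
  assumes bound: "\<And>m n. (norm (X m - X n)) ^ k \<le> 2 * (1 / real (Suc m) + 1 / real (Suc n))"
    and "0 < k"
  shows "convergent X"
proof -
  have "Cauchy X"
  proof (rule metric_CauchyI)
    fix e :: real assume "e > 0"
    then obtain N where N: "1 / real (Suc N) < e ^ k / 4"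
      using nat_approx_posE[of "e ^ k / 4"] by auto
    have le: "1 / real (Suc n) < e ^ k / 4" if "n \<ge> N" for n
      using that by (intro le_less_trans[OF _ N] frac_le) auto
    have "dist (X m) (X n) < e" if "m \<ge> N" "n \<ge> N" for m n
    proof -
      have "(norm (X m - X n)) ^ k < e ^ k"
        using bound[of m n] le[OF that(1)] le[OF that(2)] by argo
      then show ?thesis
        unfolding dist_norm by (rule power_less_imp_less_base) (use \<open>e > 0\<close> in simp)
    qed
    then show "\<exists>N. \<forall>m\<ge>N. \<forall>n\<ge>N. dist (X m) (X n) < e" by blast
  qed
  then show ?thesis by (simp add: Cauchy_convergent_iff)
qed

lemma cinner_eqI: "(\<And>v. cinner x v = cinner y v) \<Longrightarrow> x = y"
  using cinner_self_eq_0[of "x - y"] by (simp add: cinner_simps)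


subsection \<open>Bounded operators, sesquilinear forms and adjoints\<close>

lemma bounded_operatorsD:
  "T \<in> bounded_operators \<Longrightarrow> T (c *\<^sub>C x) = c *\<^sub>C T x"
  by (simp add: bounded_operators_def)

lemma bounded_operators_0: "0 \<in> bounded_operators"
  by (simp add: bounded_operators_def)

lemma bounded_operators_add: "S \<in> bounded_operators \<Longrightarrow> T \<in> bounded_operators \<Longrightarrow> S + T \<in> bounded_operators"
  by (simp add: bounded_operators_def plus_blinfun.rep_eq cvec.scale_right_distrib)

lemma bounded_operators_diff: "S \<in> bounded_operators \<Longrightarrow> T \<in> bounded_operators \<Longrightarrow> S - T \<in> bounded_operators"
  by (simp add: bounded_operators_def minus_blinfun.rep_eq cvec.scale_right_diff_distrib)

lemma bounded_operators_compose: "S \<in> bounded_operators \<Longrightarrow> T \<in> bounded_operators \<Longrightarrow> S o\<^sub>L T \<in> bounded_operators"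
  by (simp add: bounded_operators_def)

lemma bounded_operators_sum: "(\<And>i. i \<in> I \<Longrightarrow> T i \<in> bounded_operators) \<Longrightarrow> sum T I \<in> bounded_operators"
  by (induction I rule: infinite_finite_induct) (auto intro: bounded_operators_0 bounded_operators_add)

section \<open>Sesquilinear forms and polarization\<close>

definition sesquilinear :: "('h::complex_hilbert_space \<Rightarrow> 'h \<Rightarrow> complex) \<Rightarrow> bool" where
  "sesquilinear F \<longleftrightarrow>
     (\<forall>x y z. F (x + y) z = F x z + F y z) \<and> (\<forall>x y z. F x (y + z) = F x y + F x z) \<and>
     (\<forall>c x y. F (c *\<^sub>C x) y = c * F x y) \<and> (\<forall>c x y. F x (c *\<^sub>C y) = cnj c * F x y)"

lemma sesquilinear_cinner: "T \<in> bounded_operators \<Longrightarrow> sesquilinear (\<lambda>x y. cinner (T x) y)"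
  by (simp add: sesquilinear_def blinfun.add_right bounded_operatorsD cinner_simps)

lemma sesquilinear_diff: "sesquilinear F \<Longrightarrow> sesquilinear G \<Longrightarrow> sesquilinear (\<lambda>x y. F x y - G x y)"
  by (simp add: sesquilinear_def algebra_simps)

lemma sesquilinear_cmult: "sesquilinear F \<Longrightarrow> sesquilinear (\<lambda>x y. c * F x y)"
  by (simp add: sesquilinear_def algebra_simps)

lemma sesquilinear_mult_right: "sesquilinear F \<Longrightarrow> sesquilinear (\<lambda>x y. F x y * c)"
  by (simp add: sesquilinear_def algebra_simps)

lemma sesquilinear_sum: "(\<And>i. i \<in> I \<Longrightarrow> sesquilinear (F i)) \<Longrightarrow> sesquilinear (\<lambda>x y. \<Sum>i\<in>I. F i x y)"
  by (simp add: sesquilinear_def sum.distrib sum_distrib_left)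

lemma sesquilinear_tendsto:
  assumes "\<And>i. sesquilinear (F i)" and "\<And>x y. ((\<lambda>i. F i x y) \<longlongrightarrow> G x y) l" and "l \<noteq> bot"
  shows "sesquilinear G"
  unfolding sesquilinear_def
proof (intro conjI allI)
  fix x y z c
  show "G (x + y) z = G x z + G y z"
    using tendsto_add[OF assms(2)[of x z] assms(2)[of y z]] assms(2)[of "x + y" z] assms(1)
    by (auto simp: sesquilinear_def intro: tendsto_unique[OF assms(3)])
  show "G x (y + z) = G x y + G x z"
    using tendsto_add[OF assms(2)[of x y] assms(2)[of x z]] assms(2)[of x "y + z"] assms(1)
    by (auto simp: sesquilinear_def intro: tendsto_unique[OF assms(3)])
  show "G (c *\<^sub>C x) y = c * G x y"
    using tendsto_mult_left[OF assms(2)[of x y], of c] assms(2)[of "c *\<^sub>C x" y] assms(1)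
    by (auto simp: sesquilinear_def intro: tendsto_unique[OF assms(3)])
  show "G x (c *\<^sub>C y) = cnj c * G x y"
    using tendsto_mult_left[OF assms(2)[of x y], of "cnj c"] assms(2)[of x "c *\<^sub>C y"] assms(1)
    by (auto simp: sesquilinear_def intro: tendsto_unique[OF assms(3)])
qed

lemma sesquilinear_polarization:
  assumes "sesquilinear F"
  shows "F x y = (F (x + y) (x + y) - F (x + (-1) *\<^sub>C y) (x + (-1) *\<^sub>C y)
    + \<i> * F (x + \<i> *\<^sub>C y) (x + \<i> *\<^sub>C y) - \<i> * F (x + (- \<i>) *\<^sub>C y) (x + (- \<i>) *\<^sub>C y)) / 4"
proof -
  have F: "F (x + y) z = F x z + F y z" "F x (y + z) = F x y + F x z"
    "F (c *\<^sub>C x) y = c * F x y" "F x (c *\<^sub>C y) = cnj c * F x y" for x y z c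
    using assms by (auto simp: sesquilinear_def)
  show ?thesis
    by (simp only: F) (simp add: algebra_simps)
qed

text \<open>By polarization an off-diagonal value is a combination of four diagonal ones. This is
  applied to differences of \<open>trilinear_form\<close> in one pair of arguments at a
  time.\<close>

lemma sesquilinear_tendsto_0I:
  assumes "\<And>i. sesquilinear (F i)" and "\<And>x. ((\<lambda>i. F i x x) \<longlongrightarrow> 0) l"
  shows "((\<lambda>i. F i x y) \<longlongrightarrow> 0) l"
proof -
  have "((\<lambda>i. (F i (x + y) (x + y) - F i (x + (-1) *\<^sub>C y) (x + (-1) *\<^sub>C y)
    + \<i> * F i (x + \<i> *\<^sub>C y) (x + \<i> *\<^sub>C y) - \<i> * F i (x + (- \<i>) *\<^sub>C y) (x + (- \<i>) *\<^sub>C y)) / 4)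
      \<longlongrightarrow> (0 - 0 + \<i> * 0 - \<i> * 0) / 4) l"
    by (intro tendsto_intros assms(2)) simp
  then show ?thesis
    by (subst (asm) sesquilinear_polarization[OF assms(1), symmetric]) simp
qed

lemma norm_blinfun_le_cinner:
  fixes A :: "'h::complex_hilbert_space \<Rightarrow>\<^sub>L 'h"
  assumes "0 \<le> C" and "\<And>u v. cmod (cinner (A u) v) \<le> C * norm u * norm v"
  shows "norm A \<le> C"
proof (rule norm_blinfun_bound[OF assms(1)])
  fix u
  let ?v = "A u"
  have "norm ?v * norm ?v \<le> (C * norm u) * norm ?v"
    using assms(2)[of u ?v] by (simp add: cinner_self norm_mult power2_eq_square)
  then show "norm ?v \<le> C * norm u"
    by (cases "?v = 0") (use assms(1) in auto)
qed

text \<open>Polarization: for unit vectors x and y, the squared norms of x + y, x - y, x + \<i> y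
  and x - \<i> y add up to 8, and the division by 4 leaves the factor 2. Estimates of quadratic
  forms, which is what the definition of \<open>spectral_integral\<close> provides, thus become norm
  estimates; c = 0 gives uniqueness.\<close>

lemma norm_le_numerical_radius:
  assumes A: "A \<in> bounded_operators" and "0 \<le> c"
    and c: "\<And>u. cmod (cinner (A u) u) \<le> c * (norm u)\<^sup>2"
  shows "norm A \<le> 2 * c"
proof -
  define F where "F = (\<lambda>x y. cinner (A x) y)"
  have F: "sesquilinear F"
    unfolding F_def by (rule sesquilinear_cinner[OF A])
  have unit: "cmod (F x y) \<le> 2 * c" if "norm x = 1" "norm y = 1" for x y
  proof -
    have q: "cmod (F z z) \<le> c * (norm z)\<^sup>2" for z
      using c by (simp add: F_def)
    have "cmod (F x y) = cmod (F (x + y) (x + y) - F (x + (-1) *\<^sub>C y) (x + (-1) *\<^sub>C y)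
      + \<i> * F (x + \<i> *\<^sub>C y) (x + \<i> *\<^sub>C y) - \<i> * F (x + (- \<i>) *\<^sub>C y) (x + (- \<i>) *\<^sub>C y)) / 4"
      by (subst sesquilinear_polarization[OF F]) (simp add: norm_divide)
    also have "\<dots> \<le> (cmod (F (x + y) (x + y)) + cmod (F (x + (-1) *\<^sub>C y) (x + (-1) *\<^sub>C y))
      + cmod (F (x + \<i> *\<^sub>C y) (x + \<i> *\<^sub>C y)) + cmod (F (x + (- \<i>) *\<^sub>C y) (x + (- \<i>) *\<^sub>C y))) / 4"
      by (intro divide_right_mono order_trans[OF norm_triangle_ineq4] add_mono
          order_trans[OF norm_triangle_ineq]) (simp_all add: norm_mult)
    also have "\<dots> \<le> (c * (norm (x + y))\<^sup>2 + c * (norm (x + (-1) *\<^sub>C y))\<^sup>2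
      + c * (norm (x + \<i> *\<^sub>C y))\<^sup>2 + c * (norm (x + (- \<i>) *\<^sub>C y))\<^sup>2) / 4"
      by (intro divide_right_mono add_mono q) simp
    also have "\<dots> = 2 * c"
      by (simp add: that norm_add_power2 norm_scaleC cinner_simps algebra_simps del: cvec.scale_minus_left)
    finally show ?thesis .
  qed
  show ?thesis
  proof (rule norm_blinfun_le_cinner)
    fix u v
    show "cmod (cinner (A u) v) \<le> 2 * c * norm u * norm v"
    proof (cases "u = 0 \<or> v = 0")
      case False
      have "cmod (F ((1 / norm u) *\<^sub>R u) ((1 / norm v) *\<^sub>R v)) \<le> 2 * c"
        using False by (intro unit) auto
      moreover have "F ((1 / norm u) *\<^sub>R u) ((1 / norm v) *\<^sub>R v) = F u v / of_real (norm u * norm v)"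
        by (simp add: F_def blinfun.scaleR_right cinner_scaleR_left cinner_scaleR_right)
      ultimately have "cmod (F u v) / (norm u * norm v) \<le> 2 * c"
        by (simp add: norm_divide norm_mult)
      then show ?thesis
        using False by (simp add: F_def pos_divide_le_eq mult_ac)
    qed (auto simp: blinfun.zero_right)
  qed (use \<open>0 \<le> c\<close> in simp)
qed

lemma bounded_operators_eqI:
  assumes "A \<in> bounded_operators" "B \<in> bounded_operators"
    and "\<And>u. cinner (A u) u = cinner (B u) u"
  shows "A = B"
  using norm_le_numerical_radius[OF bounded_operators_diff[OF assms(1,2)], of 0] assms(3)
  by (simp add: blinfun.diff_left cinner_simps)

text \<open>The representing vector minimizes \<open>\<parallel>x\<parallel>\<^sup>2 - 2 Re \<phi>(x)\<close>.\<close>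

lemma Riesz_representation:
  fixes \<phi> :: "'h::complex_hilbert_space \<Rightarrow> complex"
  assumes add: "\<And>x y. \<phi> (x + y) = \<phi> x + \<phi> y" and scale: "\<And>c x. \<phi> (c *\<^sub>C x) = c * \<phi> x"
    and bound: "\<And>x. cmod (\<phi> x) \<le> C * norm x"
  shows "\<exists>y. \<forall>x. \<phi> x = cinner x y"
proof -
  have bl: "bounded_linear \<phi>"
    by (rule bounded_linear_intro[of _ C])
      (use bound in \<open>simp_all add: add scale scaleR_scaleC scaleC_complex_def mult.commute\<close>)
  define J where "J = (\<lambda>x. (norm x)\<^sup>2 - 2 * Re (\<phi> x))"
  have lower: "- (C\<^sup>2) \<le> J x" for x
  proof -
    have "Re (\<phi> x) \<le> C * norm x"
      using bound[of x] complex_Re_le_cmod[of "\<phi> x"] by linarith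
    moreover have "0 \<le> (norm x - C)\<^sup>2" by simp
    ultimately show ?thesis
      by (simp add: J_def power2_eq_square algebra_simps)
  qed
  then have bdd: "bdd_below (range J)"
    by (auto simp: bdd_below_def)
  define m where "m = Inf (range J)"
  have m_le: "m \<le> J x" for x
    unfolding m_def by (rule cInf_lower[OF _ bdd]) simp
  have "\<exists>x. J x < m + 1 / real (Suc n)" for n
  proof -
    have "m < m + 1 / real (Suc n)" by simp
    then obtain z where "z \<in> range J" "z < m + 1 / real (Suc n)"
      unfolding m_def by (subst (asm) cInf_less_iff[OF _ bdd]) auto
    then show ?thesis by blast
  qed
  then obtain X where X: "\<And>n. J (X n) < m + 1 / real (Suc n)"
    by metis
  \<comment> \<open>Parallelogram law: J at the midpoint of x and y is at least m, so
    near-minimizers lie close together.\<close>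
  have par: "(norm (x - y))\<^sup>2 \<le> 2 * (J x - m) + 2 * (J y - m)" for x y
  proof -
    have "J ((1/2) *\<^sub>R (x + y)) = (norm (x + y))\<^sup>2 / 4 - Re (\<phi> x) - Re (\<phi> y)"
    proof -
      have "\<phi> ((1/2) *\<^sub>R (x + y)) = of_real (1/2) * (\<phi> x + \<phi> y)"
        unfolding scaleR_scaleC scale add by simp
      then have "Re (\<phi> ((1/2) *\<^sub>R (x + y))) = (Re (\<phi> x) + Re (\<phi> y)) / 2"
        by (simp del: of_real_divide)
      then show ?thesis
        by (simp add: J_def power_divide)
    qed
    with m_le[of "(1/2) *\<^sub>R (x + y)"]
    have "m \<le> (norm (x + y))\<^sup>2 / 4 - Re (\<phi> x) - Re (\<phi> y)" by simp
    then show ?thesis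
      by (simp add: J_def norm_add_power2 norm_diff_power2 field_simps)
  qed
  have "(norm (X i - X j))\<^sup>2 \<le> 2 * (1 / real (Suc i) + 1 / real (Suc j))" for i j
    using par[of "X i" "X j"] X[of i] X[of j] by argo
  then have "convergent X"
    by (rule convergent_of_norm_diff_le) simp
  then obtain y where y: "X \<longlonglongrightarrow> y"
    by (auto simp: convergent_def)
  have "(\<lambda>n. J (X n)) \<longlonglongrightarrow> J y"
    unfolding J_def by (intro tendsto_intros bounded_linear.tendsto[OF bl] y)
  moreover have "(\<lambda>n. m + 1 / real (Suc n)) \<longlonglongrightarrow> m + 0"
    by (intro tendsto_intros LIMSEQ_Suc lim_1_over_n)
  ultimately have "J y \<le> m + 0"
    by (rule LIMSEQ_le) (use X in \<open>auto intro: less_imp_le\<close>)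
  then have min: "J y \<le> J x" for x
    using m_le[of x] by simp
  have Re_eq: "Re (\<phi> x) = Re (cinner x y)" for x
  proof -
    have quad: "0 \<le> t\<^sup>2 * (norm x)\<^sup>2 + 2 * t * (Re (cinner x y) - Re (\<phi> x))" for t :: real
    proof -
      have "Re (cinner y x) = Re (cinner x y)"
        by (subst cinner_commute) simp
      moreover have "\<phi> (t *\<^sub>R x) = of_real t * \<phi> x"
        by (simp add: scaleR_scaleC scale)
      ultimately show ?thesis
        using min[of "y + t *\<^sub>R x"]
        by (simp add: J_def norm_add_power2 add cinner_scaleR_right power_mult_distrib algebra_simps)
    qed
    \<comment> \<open>\<open>quad\<close> holds for every real t, which forces d = 0. The test value
      t = - d / s makes its right-hand side a negative multiple of \<open>d\<^sup>2\<close>; the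
      summand 1 in s covers x = 0.\<close>
    define d where "d = Re (cinner x y) - Re (\<phi> x)"
    define s where "s = 1 + (norm x)\<^sup>2"
    have s: "s > 0" unfolding s_def by (simp add: add_pos_nonneg)
    have "0 \<le> (- d / s)\<^sup>2 * (norm x)\<^sup>2 + 2 * (- d / s) * d"
      using quad[of "- d / s"] by (simp add: d_def)
    also have "\<dots> = d\<^sup>2 * ((norm x)\<^sup>2 - 2 * s) / s\<^sup>2"
      using s by (simp add: field_simps power2_eq_square)
    finally have "d\<^sup>2 * ((norm x)\<^sup>2 - 2 * s) \<ge> 0"
      using s by (simp add: zero_le_divide_iff)
    moreover have "(norm x)\<^sup>2 - 2 * s < 0"
      by (simp add: s_def) (smt (verit) zero_le_power2)
    ultimately have "d = 0"
      by (auto simp: zero_le_mult_iff)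
    then show ?thesis by (simp add: d_def)
  qed
  have "\<phi> x = cinner x y" for x
  proof (rule complex_eqI[OF Re_eq])
    show "Im (\<phi> x) = Im (cinner x y)"
      using Re_eq[of "\<i> *\<^sub>C x"] by (simp add: scale cinner_simps)
  qed
  then show ?thesis by blast
qed

lemma bounded_sesquilinear_operator:
  fixes F :: "'h::complex_hilbert_space \<Rightarrow> 'h \<Rightarrow> complex"
  assumes F: "sesquilinear F" and "0 \<le> C" and bound: "\<And>u v. cmod (F u v) \<le> C * norm u * norm v"
  obtains A where "A \<in> bounded_operators" and "\<And>u v. cinner (A u) v = F u v"
proof -
  \<comment> \<open>\<open>F u\<close> is conjugate linear, so its conjugate is the functional to be
    represented.\<close>
  have "\<exists>y. \<forall>v. cnj (F u v) = cinner v y" for u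
    by (rule Riesz_representation[of _ "C * norm u"])
      (use F bound in \<open>auto simp: sesquilinear_def\<close>)
  then obtain f where f: "\<And>u v. cnj (F u v) = cinner v (f u)"
    by metis
  have cf: "cinner (f u) v = F u v" for u v
    by (subst cinner_commute) (simp flip: f)
  have f_add: "f (x + y) = f x + f y" for x y
    by (rule cinner_eqI) (use F in \<open>simp add: cf cinner_simps sesquilinear_def\<close>)
  have f_scale: "f (c *\<^sub>C x) = c *\<^sub>C f x" for c x
    by (rule cinner_eqI) (use F in \<open>simp add: cf cinner_simps sesquilinear_def\<close>)
  have f_norm: "norm (f u) \<le> norm u * C" for u
  proof -
    have "norm (f u) * norm (f u) \<le> (norm u * C) * norm (f u)"
      using bound[of u "f u"]
      by (simp add: cinner_self norm_mult power2_eq_square mult.commute flip: cf)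
    then show ?thesis
      by (cases "f u = 0") (use \<open>0 \<le> C\<close> in auto)
  qed
  have "bounded_linear f"
    by (rule bounded_linear_intro[of _ C]) (simp_all add: f_add scaleR_scaleC f_scale f_norm)
  then have app: "blinfun_apply (Blinfun f) = f"
    by (rule bounded_linear_Blinfun_apply)
  show thesis
    by (rule that[of "Blinfun f"]) (simp_all add: bounded_operators_def app f_scale cf)
qed

section \<open>Adjoint operators\<close>

definition adjoint_operator :: "('h::complex_hilbert_space \<Rightarrow>\<^sub>L 'h) \<Rightarrow> 'h \<Rightarrow>\<^sub>L 'h" where
  "adjoint_operator T = (SOME S. S \<in> bounded_operators \<and>
     (\<forall>u v. cinner (S u) v = cinner u (T v)))"

lemma
  assumes T: "T \<in> bounded_operators"
  shows adjoint_bounded_operators: "adjoint_operator T \<in> bounded_operators"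
    and cinner_adjoint_left:
      "cinner (adjoint_operator T u) v = cinner u (T v)"
    and cinner_adjoint_right:
      "cinner u (adjoint_operator T v) = cinner (T u) v"
proof -
  have s: "sesquilinear (\<lambda>u v. cinner u (T v))"
    using T by (simp add: sesquilinear_def blinfun.add_right bounded_operatorsD cinner_simps)
  have b: "cmod (cinner u (T v)) \<le> norm T * norm u * norm v" for u v
  proof -
    have "cmod (cinner u (T v)) \<le> norm u * norm (T v)"
      by (rule cinner_Cauchy_Schwarz)
    also have "\<dots> \<le> norm u * (norm T * norm v)"
      by (intro mult_left_mono norm_blinfun) simp
    finally show ?thesis by (simp add: mult_ac)
  qed
  obtain S where S: "S \<in> bounded_operators" "\<And>u v. cinner (S u) v = cinner u (T v)"
    using bounded_sesquilinear_operator[OF s norm_ge_zero b] by metis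
  have *: "adjoint_operator T \<in> bounded_operators \<and>
     (\<forall>u v. cinner (adjoint_operator T u) v = cinner u (T v))"
    unfolding adjoint_operator_def by (rule someI[of _ S]) (use S in blast)
  then show "adjoint_operator T \<in> bounded_operators"
    and **: "cinner (adjoint_operator T u) v = cinner u (T v)" for u v
    by auto
  show "cinner u (adjoint_operator T v) = cinner (T u) v"
    by (subst (1 2) cinner_commute) (simp add: **)
qed

text \<open>Stated for differences because approximation numbers compare an operator with operators
  of small rank; the zero operator as one argument gives the plain norm bound.\<close>

lemma norm_adjoint_diff_le:
  assumes "S \<in> bounded_operators" "T \<in> bounded_operators"
  shows "norm (adjoint_operator S - adjoint_operator T) \<le> norm (S - T)"
proof (rule norm_blinfun_le_cinner[OF norm_ge_zero])
  fix u v
  have "cinner ((adjoint_operator S - adjoint_operator T) u) v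
    = cinner u ((S - T) v)"
    using assms by (simp add: blinfun.diff_left cinner_simps cinner_adjoint_left)
  then have "cmod (cinner ((adjoint_operator S - adjoint_operator T) u) v)
    \<le> norm u * norm ((S - T) v)"
    by (simp add: cinner_Cauchy_Schwarz)
  also have "\<dots> \<le> norm u * (norm (S - T) * norm v)"
    by (intro mult_left_mono norm_blinfun) simp
  finally show "cmod (cinner ((adjoint_operator S - adjoint_operator T) u) v)
    \<le> norm (S - T) * norm u * norm v"
    by (simp add: mult_ac)
qed

subsection \<open>Orthonormal systems\<close>

definition orthonormal_on :: "'i set \<Rightarrow> ('i \<Rightarrow> 'h::complex_hilbert_space) \<Rightarrow> bool" where
  "orthonormal_on I e \<longleftrightarrow> (\<forall>i\<in>I. \<forall>j\<in>I. cinner (e i) (e j) = (if i = j then 1 else 0))"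

lemma orthonormal_onD:
  "orthonormal_on I e \<Longrightarrow> i \<in> I \<Longrightarrow> j \<in> I \<Longrightarrow> cinner (e i) (e j) = (if i = j then 1 else 0)"
  by (auto simp: orthonormal_on_def)

lemma orthonormal_on_norm:
  assumes "orthonormal_on I e" "i \<in> I"
  shows "norm (e i) = 1"
proof -
  have "(norm (e i))\<^sup>2 = 1\<^sup>2"
    using orthonormal_onD[OF assms assms(2)] by (simp add: norm_power2_eq_cinner)
  then show ?thesis
    by (rule power2_eq_imp_eq) simp_all
qed

lemma orthonormal_on_subset: "orthonormal_on I e \<Longrightarrow> J \<subseteq> I \<Longrightarrow> orthonormal_on J e"
  unfolding orthonormal_on_def by blast

lemma orthonormal_on_Suc:
  assumes "orthonormal_on {..<n} e" and "norm x = 1" and "\<And>i. i < n \<Longrightarrow> cinner x (e i) = 0"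
  shows "orthonormal_on {..<Suc n} (e(n := x))"
proof -
  have "cinner (e i) x = 0" if "i < n" for i
    using assms(3)[OF that] by (subst cinner_commute) simp
  moreover have "cinner x x = 1"
    using assms(2) by (simp add: cinner_self)
  ultimately show ?thesis
    using assms by (auto simp: orthonormal_on_def less_Suc_eq)
qed

lemma cinner_orthonormal_sum:
  assumes "orthonormal_on I e" "finite I" "j \<in> I"
  shows "cinner (\<Sum>i\<in>I. c i *\<^sub>C e i) (e j) = c j"
proof -
  have "cinner (\<Sum>i\<in>I. c i *\<^sub>C e i) (e j) = (\<Sum>i\<in>I. if i = j then c i else 0)"
    unfolding cinner_sum_left
    by (intro sum.cong refl) (use assms in \<open>auto simp: cinner_scaleC_left orthonormal_onD\<close>)
  then show ?thesis using assms by simp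
qed

lemma norm_orthonormal_sum:
  assumes "orthonormal_on I e" "finite I"
  shows "(norm (\<Sum>i\<in>I. c i *\<^sub>C e i))\<^sup>2 = (\<Sum>i\<in>I. (cmod (c i))\<^sup>2)"
proof -
  have "cinner (\<Sum>i\<in>I. c i *\<^sub>C e i) (\<Sum>i\<in>I. c i *\<^sub>C e i) = (\<Sum>i\<in>I. cnj (c i) * c i)"
    using assms by (subst cinner_sum_right) (simp add: cinner_scaleC_right cinner_orthonormal_sum)
  moreover have "Re (cnj z * z) = (cmod z)\<^sup>2" for z
    unfolding cmod_power2 by (simp add: power2_eq_square)
  ultimately show ?thesis
    by (simp only: norm_power2_eq_cinner Re_sum)
qed

lemma orthonormal_projection_residual:
  assumes "orthonormal_on I e" "finite I" "j \<in> I"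
  shows "cinner (x - (\<Sum>i\<in>I. cinner x (e i) *\<^sub>C e i)) (e j) = 0"
  using cinner_orthonormal_sum[OF assms] by (simp add: cinner_diff_left)

lemma orthonormal_projection_norm:
  assumes "orthonormal_on I e" "finite I"
  shows "(norm x)\<^sup>2 = (\<Sum>i\<in>I. (cmod (cinner x (e i)))\<^sup>2)
    + (norm (x - (\<Sum>i\<in>I. cinner x (e i) *\<^sub>C e i)))\<^sup>2"
proof -
  let ?p = "\<Sum>i\<in>I. cinner x (e i) *\<^sub>C e i"
  have "cinner (x - ?p) ?p = 0"
    using orthonormal_projection_residual[OF assms]
    by (simp add: cinner_sum_right[of _ "\<lambda>i. cinner x (e i) *\<^sub>C e i"] cinner_scaleC_right)
  then have "(norm ((x - ?p) + ?p))\<^sup>2 = (norm (x - ?p))\<^sup>2 + (norm ?p)\<^sup>2"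
    unfolding norm_add_power2 by simp
  then show ?thesis
    by (simp add: norm_orthonormal_sum[OF assms])
qed

lemma Bessel_inequality:
  assumes "orthonormal_on I e" "finite I"
  shows "(\<Sum>i\<in>I. (cmod (cinner x (e i)))\<^sup>2) \<le> (norm x)\<^sup>2"
  using orthonormal_projection_norm[OF assms, of x] by simp

text \<open>In an indexed family a repeated vector is already a dependence, with coefficients 1 and
  -1; the injective case is the dimension bound. Besides \<open>orthonormal_card_le\<close>, this
  supplies the vector annihilated by a low-rank operator in the lower bound for singular
  values.\<close>

lemma linear_dependence:
  fixes f :: "'i \<Rightarrow> 'h::complex_hilbert_space"
  assumes "finite I" "finite B" "card B < card I" and span: "\<And>i. i \<in> I \<Longrightarrow> f i \<in> cvec.span B"
  obtains c where "(\<Sum>i\<in>I. c i *\<^sub>C f i) = 0" and "\<exists>i\<in>I. c i \<noteq> 0"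
proof (cases "inj_on f I")
  case True
  have "\<not> cvec.independent (f ` I)"
  proof
    assume "cvec.independent (f ` I)"
    then have "card (f ` I) \<le> card B"
      using cvec.independent_span_bound[OF assms(2)] span by blast
    then show False
      using assms(3) True by (simp add: card_image)
  qed
  then obtain u v where uv: "v \<in> f ` I" "u v \<noteq> 0" "(\<Sum>v\<in>f ` I. u v *\<^sub>C v) = 0"
    using cvec.dependent_finite[of "f ` I"] assms(1) by auto
  show thesis
  proof (rule that[of "u \<circ> f"])
    show "(\<Sum>i\<in>I. (u \<circ> f) i *\<^sub>C f i) = 0"
      using uv(3) True by (simp add: sum.reindex)
  qed (use uv in auto)
next
  case False
  then obtain i j where ij: "i \<in> I" "j \<in> I" "i \<noteq> j" "f i = f j"
    by (auto simp: inj_on_def)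
  define c :: "'i \<Rightarrow> complex" where "c = (\<lambda>k. if k = i then 1 else if k = j then -1 else 0)"
  have "(\<Sum>k\<in>I. c k *\<^sub>C f k) = (\<Sum>k\<in>{i, j}. c k *\<^sub>C f k)"
    by (rule sum.mono_neutral_right) (use ij assms(1) in \<open>auto simp: c_def\<close>)
  also have "\<dots> = 0"
    using ij by (simp add: c_def)
  finally show thesis
    using ij(1) by (intro that[of c]) (auto simp: c_def)
qed

lemma orthonormal_card_le:
  assumes "orthonormal_on I e" "finite I" "finite B" "\<And>i. i \<in> I \<Longrightarrow> e i \<in> cvec.span B"
  shows "card I \<le> card B"
proof (rule ccontr)
  assume "\<not> ?thesis"
  then obtain c where c: "(\<Sum>i\<in>I. c i *\<^sub>C e i) = 0" "\<exists>i\<in>I. c i \<noteq> 0"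
    using linear_dependence[of I B e] assms by (metis not_le)
  then show False
    using cinner_orthonormal_sum[OF assms(1,2), of _ c] by auto
qed

text \<open>A greedy orthonormal system in a finite-dimensional space cannot be extended, so it is a basis.\<close>

lemma greedy_orthonormal_basis:
  fixes B :: "'h::complex_hilbert_space set" and G :: "'h set \<Rightarrow> 'h \<Rightarrow> bool"
  assumes "finite B"
    and ext: "\<And>(n::nat) e. orthonormal_on {..<n} e \<Longrightarrow> e ` {..<n} \<subseteq> cvec.span B \<Longrightarrow>
      \<exists>x\<in>cvec.span B. x \<noteq> 0 \<and> (\<forall>i<n. cinner x (e i) = 0) \<Longrightarrow>
      \<exists>x\<in>cvec.span B. norm x = 1 \<and> (\<forall>i<n. cinner x (e i) = 0) \<and> G (e ` {..<n}) x"
  obtains n and e :: "nat \<Rightarrow> 'h" where "n \<le> card B" "orthonormal_on {..<n} e"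
    "\<And>i. i < n \<Longrightarrow> e i \<in> cvec.span B"
    "\<And>x. x \<in> cvec.span B \<Longrightarrow> x = (\<Sum>i<n. cinner x (e i) *\<^sub>C e i)"
    "\<And>i. i < n \<Longrightarrow> G (e ` {..<i}) (e i)"
proof -
  \<comment> \<open>\<open>G\<close> relates each new vector to the set of the earlier ones. It is
    trivial for a mere basis and expresses maximality for singular vectors.\<close>
  define P where "P = (\<lambda>n (e :: nat \<Rightarrow> 'h). orthonormal_on {..<n} e \<and> e ` {..<n} \<subseteq> cvec.span B \<and>
    (\<forall>i<n. G (e ` {..<i}) (e i)))"
  have le: "n \<le> card B" if "P n e" for n e
    using orthonormal_card_le[of "{..<n}" e B] that assms(1) by (auto simp: P_def)
  have "P 0 e" for e
    by (simp add: P_def orthonormal_on_def)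
  then obtain n where n: "\<exists>e. P n e" "\<And>m. \<exists>e. P m e \<Longrightarrow> m \<le> n"
    using Nat.ex_has_greatest_nat[of "\<lambda>n. \<exists>e. P n e" 0 "card B"] le by metis
  then obtain e where e: "P n e" by blast
  then have orth: "orthonormal_on {..<n} e" and span: "e ` {..<n} \<subseteq> cvec.span B"
    by (auto simp: P_def)
  have zero: "x = 0" if x: "x \<in> cvec.span B" "\<forall>i<n. cinner x (e i) = 0" for x
  proof (rule ccontr)
    assume "x \<noteq> 0"
    then obtain y where y: "y \<in> cvec.span B" "norm y = 1" "\<forall>i<n. cinner y (e i) = 0" "G (e ` {..<n}) y"
      using ext[OF orth span] x by blast
    have "P (Suc n) (e(n := y))"
      unfolding P_def
    proof (intro conjI allI impI)
      show "orthonormal_on {..<Suc n} (e(n := y))"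
        using orthonormal_on_Suc[OF orth] y by blast
      show "(e(n := y)) ` {..<Suc n} \<subseteq> cvec.span B"
        using span y by (auto simp: less_Suc_eq)
      fix i assume i: "i < Suc n"
      have "(e(n := y)) ` {..<i} = e ` {..<i}"
        using i by (intro image_cong) auto
      moreover have "G (e ` {..<i}) ((e(n := y)) i)"
        using i y e by (auto simp: P_def less_Suc_eq)
      ultimately show "G ((e(n := y)) ` {..<i}) ((e(n := y)) i)"
        by simp
    qed
    then show False
      using n(2)[of "Suc n"] by auto
  qed
  show thesis
  proof (rule that[OF le[OF e] orth])
    fix x assume x: "x \<in> cvec.span B"
    have "x - (\<Sum>i<n. cinner x (e i) *\<^sub>C e i) = 0"
    proof (rule zero)
      show "x - (\<Sum>i<n. cinner x (e i) *\<^sub>C e i) \<in> cvec.span B"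
        using x span by (intro cvec.span_diff cvec.span_sum cvec.span_scale) auto
      show "\<forall>i<n. cinner (x - (\<Sum>i<n. cinner x (e i) *\<^sub>C e i)) (e i) = 0"
        using orthonormal_projection_residual[OF orth] by simp
    qed
    then show "x = (\<Sum>i<n. cinner x (e i) *\<^sub>C e i)" by simp
  qed (use e in \<open>auto simp: P_def\<close>)
qed

lemma norm_normalize: "x \<noteq> 0 \<Longrightarrow> norm ((1 / norm x) *\<^sub>R (x::'a::real_normed_vector)) = 1"
  by simp

lemma span_scaleR: "x \<in> cvec.span B \<Longrightarrow> r *\<^sub>R x \<in> cvec.span B"
  unfolding scaleR_scaleC by (rule cvec.span_scale)

lemma orthonormal_basis:
  fixes B :: "'h::complex_hilbert_space set"
  assumes "finite B"
  obtains n and e :: "nat \<Rightarrow> 'h" where "n \<le> card B" "orthonormal_on {..<n} e"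
    "\<And>i. i < n \<Longrightarrow> e i \<in> cvec.span B"
    "\<And>x. x \<in> cvec.span B \<Longrightarrow> x = (\<Sum>i<n. cinner x (e i) *\<^sub>C e i)"
proof (rule greedy_orthonormal_basis[OF assms, of "\<lambda>_ _. True"])
  fix n and e :: "nat \<Rightarrow> 'h"
  assume "\<exists>x\<in>cvec.span B. x \<noteq> 0 \<and> (\<forall>i<n. cinner x (e i) = 0)"
  then obtain x where x: "x \<in> cvec.span B" "x \<noteq> 0" "\<forall>i<n. cinner x (e i) = 0" by blast
  then show "\<exists>x\<in>cvec.span B. norm x = 1 \<and> (\<forall>i<n. cinner x (e i) = 0) \<and> True"
    by (intro bexI[of _ "(1 / norm x) *\<^sub>R x"] conjI norm_normalize span_scaleR)
      (auto simp: cinner_scaleR_left)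
qed (use that in blast)

text \<open>The unit sphere of the whole space may fail to be compact, so maximizers are sought on
  such spans. The coordinates of a unit vector in an orthonormal basis lie in the unit disc, and the
  set of combinations with such coefficients is built up as a sum of compact sets, one basis vector
  at a time.\<close>

lemma compact_unit_sphere_span:
  fixes B :: "'h::complex_hilbert_space set"
  assumes "finite B"
  shows "compact {x \<in> cvec.span B. norm x = 1}"
proof -
  obtain n and e :: "nat \<Rightarrow> 'h" where e: "orthonormal_on {..<n} e"
    "\<And>i. i < n \<Longrightarrow> e i \<in> cvec.span B"
    "\<And>x. x \<in> cvec.span B \<Longrightarrow> x = (\<Sum>i<n. cinner x (e i) *\<^sub>C e i)"
    using orthonormal_basis[OF assms] by metis
  define S where "S = (\<lambda>m. (\<lambda>c. \<Sum>i<m. c i *\<^sub>C e i) ` {c. \<forall>i<m. cmod (c i) \<le> 1})"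
  have compact_S: "compact (S m)" for m
  proof (induction m)
    case (Suc m)
    have "S (Suc m) = {x + y |x y. x \<in> S m \<and> y \<in> (\<lambda>c. c *\<^sub>C e m) ` cball 0 1}"
    proof (intro equalityI subsetI)
      fix x assume "x \<in> {x + y |x y. x \<in> S m \<and> y \<in> (\<lambda>c. c *\<^sub>C e m) ` cball 0 1}"
      then obtain c d where cd: "\<forall>i<m. cmod (c i) \<le> 1" "cmod d \<le> 1"
        "x = (\<Sum>i<m. c i *\<^sub>C e i) + d *\<^sub>C e m"
        by (auto simp: S_def)
      then show "x \<in> S (Suc m)"
        unfolding S_def by (intro image_eqI[of _ _ "c(m := d)"]) (auto simp: less_Suc_eq)
    next
      fix x assume "x \<in> S (Suc m)"
      then obtain c where c: "\<forall>i<Suc m. cmod (c i) \<le> 1" "x = (\<Sum>i<m. c i *\<^sub>C e i) + c m *\<^sub>C e m"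
        by (auto simp: S_def)
      have "(\<Sum>i<m. c i *\<^sub>C e i) \<in> S m" "c m *\<^sub>C e m \<in> (\<lambda>c. c *\<^sub>C e m) ` cball 0 1"
        using c(1) by (auto simp: S_def)
      with c(2) show "x \<in> {x + y |x y. x \<in> S m \<and> y \<in> (\<lambda>c. c *\<^sub>C e m) ` cball 0 1}"
        by blast
    qed
    moreover have "compact ((\<lambda>c. c *\<^sub>C e m) ` cball 0 1)"
      by (intro compact_continuous_image linear_continuous_on bounded_linear_scaleC_left compact_cball)
    ultimately show ?case
      using compact_sums[OF Suc] by simp
  qed (simp add: S_def)
  have "{x \<in> cvec.span B. norm x = 1} = S n \<inter> {x. norm x = 1}"
  proof (intro equalityI subsetI)
    fix x assume x: "x \<in> {x \<in> cvec.span B. norm x = 1}"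
    have "cmod (cinner x (e i)) \<le> 1" if "i < n" for i
      using cinner_Cauchy_Schwarz[of x "e i"] x orthonormal_on_norm[OF e(1)] that by simp
    then have "(\<Sum>i<n. cinner x (e i) *\<^sub>C e i) \<in> S n"
      by (auto simp: S_def)
    then show "x \<in> S n \<inter> {x. norm x = 1}"
      using x e(3)[of x] by simp
  next
    fix x assume "x \<in> S n \<inter> {x. norm x = 1}"
    then show "x \<in> {x \<in> cvec.span B. norm x = 1}"
      using e(2) by (auto simp: S_def intro!: cvec.span_sum cvec.span_scale)
  qed
  moreover have "closed {x::'h. norm x = 1}"
    by (intro closed_Collect_eq continuous_intros)
  ultimately show ?thesis
    using compact_Int_closed[OF compact_S] by simp
qed


subsection \<open>Singular values\<close>

lemma zero_in_rank_le: "rank_le 0 n"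
  unfolding rank_le_def by (rule exI[of _ "{}"]) (auto simp: zero_blinfun.rep_eq)

lemma singular_value_bdd_below: "bdd_below {norm (T - K) | K. K \<in> bounded_operators \<and> rank_le K n}"
  by (rule bdd_belowI[of _ 0]) auto

lemma singular_value_le:
  "K \<in> bounded_operators \<Longrightarrow> rank_le K n \<Longrightarrow> singular_value n T \<le> norm (T - K)"
  unfolding singular_value_def by (intro cInf_lower singular_value_bdd_below) auto

lemma singular_value_geI:
  assumes "\<And>K. K \<in> bounded_operators \<Longrightarrow> rank_le K n \<Longrightarrow> c \<le> norm (T - K)"
  shows "c \<le> singular_value n T"
  unfolding singular_value_def
  by (rule cInf_greatest) (use assms zero_in_rank_le bounded_operators_0 in blast)+

lemma singular_value_nonneg: "0 \<le> singular_value n T"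
  by (rule singular_value_geI) simp

text \<open>Let e be an orthonormal basis of a space of dimension at most n that contains the range
  of K. Expanding \<open>K v\<close> in e shows that the adjoint maps x to a combination of the
  adjoint images of the \<open>e i\<close>, with coefficients \<open>cinner x (e i)\<close>.\<close>

lemma rank_le_adjoint:
  fixes K :: "'h::complex_hilbert_space \<Rightarrow>\<^sub>L 'h"
  assumes K: "K \<in> bounded_operators" and "rank_le K n"
  shows "rank_le (adjoint_operator K) n"
proof -
  obtain B where B: "finite B" "card B \<le> n" "range (K) \<subseteq> cvec.span B"
    using assms(2) by (auto simp: rank_le_def)
  obtain d and e :: "nat \<Rightarrow> 'h" where e: "d \<le> card B" "orthonormal_on {..<d} e"
    "\<And>i. i < d \<Longrightarrow> e i \<in> cvec.span B"
    "\<And>x. x \<in> cvec.span B \<Longrightarrow> x = (\<Sum>i<d. cinner x (e i) *\<^sub>C e i)"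
    using orthonormal_basis[OF B(1)] by metis
  let ?B = "(\<lambda>i. (adjoint_operator K) (e i)) ` {..<d}"
  have "(adjoint_operator K) x \<in> cvec.span ?B" for x
  proof -
    have "(adjoint_operator K) x
      = (\<Sum>i<d. cinner x (e i) *\<^sub>C (adjoint_operator K) (e i))"
    proof (rule cinner_eqI)
      fix v
      have "cinner (adjoint_operator K x) v
        = cinner x (\<Sum>i<d. cinner (K v) (e i) *\<^sub>C e i)"
      proof -
        have "K v \<in> cvec.span B" using B(3) by blast
        then show ?thesis
          unfolding cinner_adjoint_left[OF K] by (subst e(4)) simp_all
      qed
      also have "\<dots> = (\<Sum>i<d. cinner x (e i) * cinner (e i) (K v))"
        unfolding cinner_sum_right cinner_scaleC_right
        by (intro sum.cong refl) (simp add: mult.commute flip: cinner_commute)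
      finally show "cinner (adjoint_operator K x) v
        = cinner (\<Sum>i<d. cinner x (e i) *\<^sub>C (adjoint_operator K) (e i)) v"
        by (simp add: cinner_sum_left cinner_scaleC_left cinner_adjoint_left[OF K])
    qed
    then show ?thesis
      by (simp only:) (intro cvec.span_sum cvec.span_scale cvec.span_base imageI)
  qed
  moreover have "card ?B \<le> n"
    using card_image_le[of "{..<d}" "\<lambda>i. (adjoint_operator K) (e i)"] e(1) B(2) by simp
  ultimately show ?thesis
    unfolding rank_le_def by (intro exI[of _ ?B]) auto
qed

lemma singular_value_adjoint_le:
  fixes T :: "'h::complex_hilbert_space \<Rightarrow>\<^sub>L 'h"
  assumes "T \<in> bounded_operators"
  shows "singular_value n (adjoint_operator T) \<le> singular_value n T"
proof (rule singular_value_geI)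
  fix K :: "'h \<Rightarrow>\<^sub>L 'h" assume K: "K \<in> bounded_operators" "rank_le K n"
  show "singular_value n (adjoint_operator T) \<le> norm (T - K)"
    by (rule order_trans[OF singular_value_le norm_adjoint_diff_le])
      (use K assms in \<open>auto intro: adjoint_bounded_operators rank_le_adjoint\<close>)
qed

lemma power2_powr_half: "0 \<le> y \<Longrightarrow> (y\<^sup>2) powr (r / 2) = y powr (r::real)"
proof -
  assume "0 \<le> y"
  then have "y\<^sup>2 = y powr 2" by simp
  then show ?thesis by (simp only: powr_powr) simp
qed

lemma norm_sum_orthogonal_images:
  fixes W :: "'h::complex_hilbert_space \<Rightarrow>\<^sub>L 'h" and g :: "nat \<Rightarrow> 'h"
  assumes W: "W \<in> bounded_operators" and "finite I"
    and orth: "\<And>l m. l \<in> I \<Longrightarrow> m \<in> I \<Longrightarrow> l \<noteq> m \<Longrightarrow>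
      cinner (W (g l)) (W (g m)) = 0"
  shows "(norm (W (\<Sum>m\<in>I. c m *\<^sub>C g m)))\<^sup>2 =
    (\<Sum>m\<in>I. (cmod (c m))\<^sup>2 * (norm (W (g m)))\<^sup>2)"
proof -
  let ?x = "\<Sum>m\<in>I. c m *\<^sub>C g m"
  have Wx: "W ?x = (\<Sum>m\<in>I. c m *\<^sub>C W (g m))"
    by (simp add: blinfun.sum_right bounded_operatorsD[OF W])
  have "cinner (c l *\<^sub>C W (g l)) (c m *\<^sub>C W (g m))
    = (if m = l then of_real ((cmod (c l))\<^sup>2 * (norm (W (g l)))\<^sup>2) else 0)"
    if "l \<in> I" "m \<in> I" for l m
  proof (cases "l = m")
    case True
    then show ?thesis
      by (simp add: cinner_self norm_scaleC power_mult_distrib)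
  qed (use that orth in \<open>simp add: cinner_scaleC_left cinner_scaleC_right\<close>)
  then have "cinner (W ?x) (W ?x)
    = (\<Sum>l\<in>I. \<Sum>m\<in>I. if m = l then of_real ((cmod (c l))\<^sup>2 * (norm (W (g l)))\<^sup>2) else 0)"
    unfolding Wx cinner_sum_left cinner_sum_right by (intro sum.cong refl) auto
  also have "\<dots> = of_real (\<Sum>l\<in>I. (cmod (c l))\<^sup>2 * (norm (W (g l)))\<^sup>2)"
    using \<open>finite I\<close> by simp
  finally show ?thesis
    by (simp only: norm_power2_eq_cinner[of "W ?x"] Re_complex_of_real)
qed

text \<open>
  The vectors \<open>g m\<close> successively maximize \<open>\<parallel>W x\<parallel>\<close> over the unit vectors orthogonal to the previous ones;
  the first variation at a maximizer shows that their images are orthogonal.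
\<close>

lemma singular_value_decomposition_on_span:
  fixes W :: "'h::complex_hilbert_space \<Rightarrow>\<^sub>L 'h"
  assumes W: "W \<in> bounded_operators" and B: "finite B"
  obtains d and g :: "nat \<Rightarrow> 'h" where "orthonormal_on {..<d} g"
    "\<And>x. x \<in> cvec.span B \<Longrightarrow> x = (\<Sum>m<d. cinner x (g m) *\<^sub>C g m)"
    "\<And>l m. l < d \<Longrightarrow> m < d \<Longrightarrow> l \<noteq> m \<Longrightarrow> cinner (W (g l)) (W (g m)) = 0"
    "\<And>m. m < d \<Longrightarrow> norm (W (g m)) \<le> singular_value m W"
proof (rule greedy_orthonormal_basis[OF B, of "\<lambda>E g. \<forall>x\<in>cvec.span B.
    (\<forall>y\<in>E. cinner x y = 0) \<longrightarrow> norm (W x) \<le> norm (W g) * norm x"])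
  fix n and e :: "nat \<Rightarrow> 'h"
  assume "\<exists>x\<in>cvec.span B. x \<noteq> 0 \<and> (\<forall>i<n. cinner x (e i) = 0)"
  then obtain x0 where x0: "x0 \<in> cvec.span B" "x0 \<noteq> 0" "\<forall>i<n. cinner x0 (e i) = 0" by blast
  define S where "S = {x \<in> cvec.span B. norm x = 1} \<inter> (\<Inter>i\<in>{..<n}. {x. cinner x (e i) = 0})"
  have normalize: "(1 / norm x) *\<^sub>R x \<in> S" if "x \<in> cvec.span B" "x \<noteq> 0" "\<forall>i<n. cinner x (e i) = 0" for x
    using that norm_normalize[OF that(2)] by (auto simp: S_def cinner_scaleR_left intro: span_scaleR)
  have "compact S"
    unfolding S_def
    by (intro compact_Int_closed compact_unit_sphere_span B closed_INT ballI closed_Collect_eq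
        linear_continuous_on bounded_linear_cinner_left continuous_on_const)
  moreover have "S \<noteq> {}"
    using normalize[OF x0] by auto
  moreover have "continuous_on S (\<lambda>x. norm (W x))"
    by (intro continuous_intros)
  ultimately obtain g where g: "g \<in> S" "\<And>x. x \<in> S \<Longrightarrow> norm (W x) \<le> norm (W g)"
    using continuous_attains_sup[of S "\<lambda>x. norm (W x)"] by metis
  show "\<exists>x\<in>cvec.span B. norm x = 1 \<and> (\<forall>i<n. cinner x (e i) = 0) \<and>
    (\<forall>xa\<in>cvec.span B. (\<forall>y\<in>e ` {..<n}. cinner xa y = 0) \<longrightarrow>
      norm (W xa) \<le> norm (W x) * norm xa)"
  proof (intro bexI[of _ g] conjI ballI impI)
    fix x assume x: "x \<in> cvec.span B" "\<forall>y\<in>e ` {..<n}. cinner x y = 0"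
    show "norm (W x) \<le> norm (W g) * norm x"
    proof (cases "x = 0")
      case False
      then show ?thesis
        using g(2)[OF normalize[OF x(1)]] x(2) by (simp add: blinfun.scaleR_right field_simps)
    qed (simp add: blinfun.zero_right)
  qed (use g(1) in \<open>auto simp: S_def\<close>)
next
  fix d and g :: "nat \<Rightarrow> 'h"
  assume g: "orthonormal_on {..<d} g" "\<And>i. i < d \<Longrightarrow> g i \<in> cvec.span B"
    and basis: "\<And>x. x \<in> cvec.span B \<Longrightarrow> x = (\<Sum>i<d. cinner x (g i) *\<^sub>C g i)"
    and greedy: "\<And>i. i < d \<Longrightarrow> \<forall>x\<in>cvec.span B. (\<forall>y\<in>g ` {..<i}. cinner x y = 0) \<longrightarrow>
      norm (W x) \<le> norm (W (g i)) * norm x"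
  let ?\<sigma> = "\<lambda>i. norm (W (g i))"
  have g0: "cinner (g i) (g j) = 0" if "i < d" "j < d" "i \<noteq> j" for i j
    using orthonormal_onD[OF g(1)] that by simp
  have g1: "norm (g i) = 1" if "i < d" for i
    using orthonormal_on_norm[OF g(1)] that by simp
  have orth_less: "cinner (W (g i)) (W (g j)) = 0" if ij: "i < j" "j < d" for i j
  proof -
    let ?z = "cinner (W (g i)) (W (g j))"
    \<comment> \<open>First variation at the maximizer \<open>g i\<close>. The competitor
      \<open>?x\<close> is orthogonal to the earlier vectors, and the factor \<open>?z\<close> in t
      makes the linear term real, equal to \<open>2 * s * (cmod ?z)\<^sup>2\<close>.\<close>
    have *: "2 * s * (cmod ?z)\<^sup>2 \<le> s\<^sup>2 * (cmod ?z)\<^sup>2 * (?\<sigma> i)\<^sup>2" for s :: real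
    proof -
      define t where "t = of_real s * ?z"
      let ?x = "g i + t *\<^sub>C g j"
      have "\<forall>y\<in>g ` {..<i}. cinner ?x y = 0"
        using ij by (auto simp: cinner_add_left cinner_scaleC_left g0)
      moreover have "?x \<in> cvec.span B"
        using ij g(2) by (intro cvec.span_add cvec.span_scale) auto
      ultimately have "norm (W ?x) \<le> ?\<sigma> i * norm ?x"
        using greedy[of i] ij by (meson less_trans)
      then have "(norm (W ?x))\<^sup>2 \<le> (?\<sigma> i)\<^sup>2 * (norm ?x)\<^sup>2"
        by (metis norm_ge_zero power_mono power_mult_distrib)
      moreover have "(norm ?x)\<^sup>2 = 1 + (cmod t)\<^sup>2"
        using ij by (simp add: norm_add_power2 g1 g0 cinner_scaleC_right norm_scaleC)
      moreover have "(norm (W ?x))\<^sup>2 = (?\<sigma> i)\<^sup>2 + (cmod t)\<^sup>2 * (?\<sigma> j)\<^sup>2 + 2 * (s * (cmod ?z)\<^sup>2)"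
      proof -
        have "Re (cnj t * ?z) = s * (cmod ?z)\<^sup>2"
          unfolding cmod_power2 by (simp add: t_def power2_eq_square algebra_simps)
        then show ?thesis
          by (simp add: blinfun.add_right bounded_operatorsD[OF W] norm_add_power2 norm_scaleC
              cinner_scaleC_right power_mult_distrib)
      qed
      ultimately have "(cmod t)\<^sup>2 * (?\<sigma> j)\<^sup>2 + 2 * (s * (cmod ?z)\<^sup>2) \<le> (cmod t)\<^sup>2 * (?\<sigma> i)\<^sup>2"
        by (simp add: algebra_simps)
      moreover have "0 \<le> (cmod t)\<^sup>2 * (?\<sigma> j)\<^sup>2" by simp
      ultimately have "2 * (s * (cmod ?z)\<^sup>2) \<le> (cmod t)\<^sup>2 * (?\<sigma> i)\<^sup>2" by linarith
      then show ?thesis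
        by (simp add: t_def norm_mult power_mult_distrib)
    qed
    \<comment> \<open>For small s the linear term dominates; s = 1 / S is small enough because S
      exceeds \<open>(?\<sigma> i)\<^sup>2\<close>.\<close>
    define S where "S = 1 + (?\<sigma> i)\<^sup>2"
    have S: "S > 0" by (simp add: S_def add_pos_nonneg)
    have "2 * (1 / S) * (cmod ?z)\<^sup>2 \<le> (1 / S)\<^sup>2 * (cmod ?z)\<^sup>2 * S"
      by (rule order_trans[OF *]) (simp add: S_def mult_left_mono)
    also have "\<dots> = (1 / S) * (cmod ?z)\<^sup>2"
      using S by (simp add: power2_eq_square)
    finally have "(1 / S) * (cmod ?z)\<^sup>2 \<le> 0"
      by simp
    then show ?thesis
      using S by (simp add: divide_le_0_iff)
  qed
  have orth: "cinner (W (g i)) (W (g j)) = 0" if "i < d" "j < d" "i \<noteq> j" for i j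
  proof (cases "i < j")
    case False
    then have "cinner (W (g j)) (W (g i)) = 0"
      using orth_less that by simp
    then show ?thesis by (subst cinner_commute) simp
  qed (use orth_less that in auto)
  have decreasing: "?\<sigma> j \<le> ?\<sigma> i" if "i \<le> j" "j < d" for i j
  proof -
    have "\<forall>y\<in>g ` {..<i}. cinner (g j) y = 0"
      using that g0 by auto
    then have "?\<sigma> j \<le> ?\<sigma> i * norm (g j)"
      using greedy[of i] that g(2)[of j] by auto
    then show ?thesis
      using g1 that by simp
  qed
  have "?\<sigma> m \<le> singular_value m W" if m: "m < d" for m
  proof (rule singular_value_geI)
    fix K :: "'h \<Rightarrow>\<^sub>L 'h" assume K: "K \<in> bounded_operators" "rank_le K m"
    then obtain D where D: "finite D" "card D \<le> m" "range (K) \<subseteq> cvec.span D"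
      by (auto simp: rank_le_def)
    \<comment> \<open>Min-max argument: K annihilates a nontrivial combination u of the m + 1
      vectors \<open>g 0\<close>, ..., \<open>g m\<close>, while W stretches u at least by the
      factor \<open>?\<sigma> m\<close>.\<close>
    obtain c where c: "(\<Sum>i\<le>m. c i *\<^sub>C K (g i)) = 0" "\<exists>i\<in>{..m}. c i \<noteq> 0"
      by (rule linear_dependence[of "{..m}" D "\<lambda>i. K (g i)"]) (use D in auto)
    define u where "u = (\<Sum>i\<le>m. c i *\<^sub>C g i)"
    have "orthonormal_on {..m} g"
      using g(1) by (rule orthonormal_on_subset) (use m in auto)
    then have norm_u: "(norm u)\<^sup>2 = (\<Sum>i\<le>m. (cmod (c i))\<^sup>2)"
      unfolding u_def by (rule norm_orthonormal_sum) simp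
    obtain i0 where i0: "i0 \<le> m" "c i0 \<noteq> 0"
      using c(2) by auto
    have "0 < (norm u)\<^sup>2"
      unfolding norm_u by (rule sum_pos2[of _ i0]) (use i0 in auto)
    then have u: "norm u > 0" by simp
    have Ku: "K u = 0"
      using c(1) by (simp add: u_def blinfun.sum_right bounded_operatorsD[OF K(1)])
    have "(norm (W u))\<^sup>2 = (\<Sum>i\<le>m. (cmod (c i))\<^sup>2 * (?\<sigma> i)\<^sup>2)"
      unfolding u_def by (rule norm_sum_orthogonal_images[OF W]) (use m orth in auto)
    moreover have "(\<Sum>i\<le>m. (cmod (c i))\<^sup>2 * (?\<sigma> m)\<^sup>2) \<le> (\<Sum>i\<le>m. (cmod (c i))\<^sup>2 * (?\<sigma> i)\<^sup>2)"
      by (intro sum_mono mult_left_mono power_mono decreasing) (use m in auto)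
    ultimately have "(?\<sigma> m * norm u)\<^sup>2 \<le> (norm (W u))\<^sup>2"
      by (simp add: norm_u power_mult_distrib sum_distrib_left mult.commute)
    then have "?\<sigma> m * norm u \<le> norm (W u)"
      by (rule power2_le_imp_le) simp
    also have "\<dots> = norm ((W - K) u)"
      by (simp add: blinfun.diff_left Ku)
    also have "\<dots> \<le> norm (W - K) * norm u"
      by (rule norm_blinfun)
    finally show "?\<sigma> m \<le> norm (W - K)"
      using u by simp
  qed
  then show thesis
    using that[OF g(1) basis orth] by blast
qed

text \<open>Jensen's inequality for t^s with the weights w / W, where W is the total mass. Undoing
  the normalization leaves the factor W^(s - 1), which is at most C^(s - 1) because s \<ge> 1.
  Indices with \<open>t i = 0\<close> contribute to neither side, so Jensen is applied to those with
  \<open>0 < t i\<close>.\<close>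

lemma powr_weighted_sum_le:
  fixes w t :: "'i \<Rightarrow> real"
  assumes "finite S" and w: "\<And>i. i \<in> S \<Longrightarrow> 0 \<le> w i" and t: "\<And>i. i \<in> S \<Longrightarrow> 0 \<le> t i"
    and C: "sum w S \<le> C" and "1 \<le> s"
  shows "(\<Sum>i\<in>S. w i * t i) powr s \<le> C powr (s - 1) * (\<Sum>i\<in>S. w i * t i powr s)"
proof -
  define J where "J = {i \<in> S. 0 < t i}"
  have J: "finite J" "J \<subseteq> S" using \<open>finite S\<close> by (auto simp: J_def)
  have eq1: "(\<Sum>i\<in>S. w i * t i) = (\<Sum>i\<in>J. w i * t i)"
    by (rule sum.mono_neutral_right) (use \<open>finite S\<close> t in \<open>force simp: J_def\<close>)+
  have eq2: "(\<Sum>i\<in>S. w i * t i powr s) = (\<Sum>i\<in>J. w i * t i powr s)"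
    by (rule sum.mono_neutral_right) (use \<open>finite S\<close> t in \<open>force simp: J_def\<close>)+
  define W where "W = sum w J"
  have W0: "0 \<le> W"
    unfolding W_def by (rule sum_nonneg) (use w J in auto)
  have WC: "W \<le> C"
  proof -
    have "sum w J \<le> sum w S"
      by (rule sum_mono2) (use \<open>finite S\<close> J w in auto)
    then show ?thesis using C by (simp add: W_def)
  qed
  have nonneg: "0 \<le> (\<Sum>i\<in>J. w i * t i powr s)"
    by (rule sum_nonneg) (use w J in auto)
  show ?thesis
  proof (cases "W = 0")
    case True
    then have "\<forall>i\<in>J. w i = 0"
      unfolding W_def by (subst (asm) sum_nonneg_eq_0_iff) (use J w in auto)
    then show ?thesis
      by (simp add: eq1 eq2)
  next
    case False
    then have W: "W > 0" using W0 by simp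
    then have "J \<noteq> {}" by (auto simp: W_def)
    have "(\<Sum>i\<in>J. (w i / W) *\<^sub>R t i) powr s \<le> (\<Sum>i\<in>J. (w i / W) * t i powr s)"
    proof (rule convex_on_sum[OF J(1) \<open>J \<noteq> {}\<close> powr_convex[OF \<open>1 \<le> s\<close>], of "\<lambda>i. w i / W" t])
      show "(\<Sum>i\<in>J. w i / W) = 1"
        using W by (simp add: W_def flip: sum_divide_distrib)
    qed (use w W J in \<open>auto simp: J_def\<close>)
    then have "(\<Sum>i\<in>J. w i * t i) powr s / W powr s \<le> (\<Sum>i\<in>J. w i * t i powr s) / W"
      using W w J by (simp add: powr_divide sum_nonneg J_def flip: sum_divide_distrib)
    then have "(\<Sum>i\<in>J. w i * t i) powr s \<le> W powr s * ((\<Sum>i\<in>J. w i * t i powr s) / W)"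
      using W by (simp add: pos_divide_le_eq mult.commute)
    also have "\<dots> = W powr (s - 1) * (\<Sum>i\<in>J. w i * t i powr s)"
      using W by (simp add: powr_diff)
    also have "\<dots> \<le> C powr (s - 1) * (\<Sum>i\<in>J. w i * t i powr s)"
      by (intro mult_right_mono powr_mono2 nonneg) (use \<open>1 \<le> s\<close> W WC in auto)
    finally show ?thesis
      by (simp add: eq1 eq2)
  qed
qed

text \<open>
  Expanding in the singular vectors \<open>g m\<close> expresses the square sums on the left through the matrix
  \<open>D i m = \<Sum>k. \<bar>\<langle>x i k, g m\<rangle>\<bar>\<^sup>2\<close>, whose row and column sums are at most \<open>c\<^sup>2\<close>; then Jensen applies.
\<close>

lemma schatten_power_sum_le:
  fixes R :: "'h::complex_hilbert_space \<Rightarrow>\<^sub>L 'h" and x :: "'i \<Rightarrow> 'k \<Rightarrow> 'h"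
  assumes R: "R \<in> bounded_operators" and fin: "finite I" "finite K" and "0 \<le> c" and "2 \<le> q"
    and row: "\<And>i. i \<in> I \<Longrightarrow> (\<Sum>k\<in>K. (norm (x i k))\<^sup>2) \<le> c\<^sup>2"
    and col: "\<And>g. norm g = 1 \<Longrightarrow> (\<Sum>i\<in>I. \<Sum>k\<in>K. (cmod (cinner (x i k) g))\<^sup>2) \<le> c\<^sup>2"
  obtains d and g :: "nat \<Rightarrow> 'h" where "orthonormal_on {..<d} g"
    "\<And>l m. l < d \<Longrightarrow> m < d \<Longrightarrow> l \<noteq> m \<Longrightarrow> cinner (R (g l)) (R (g m)) = 0"
    "\<And>m. m < d \<Longrightarrow> norm (R (g m)) \<le> singular_value m R"
    "(\<Sum>i\<in>I. (\<Sum>k\<in>K. (norm (R (x i k)))\<^sup>2) powr (q / 2))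
      \<le> c powr q * (\<Sum>m<d. norm (R (g m)) powr q)"
proof -
  define B where "B = (\<lambda>(i, k). x i k) ` (I \<times> K)"
  have "finite B" using fin by (simp add: B_def)
  show thesis
  proof (rule singular_value_decomposition_on_span[OF R \<open>finite B\<close>])
    fix d and g :: "nat \<Rightarrow> 'h"
    assume g: "orthonormal_on {..<d} g"
      and basis: "\<And>x. x \<in> cvec.span B \<Longrightarrow> x = (\<Sum>m<d. cinner x (g m) *\<^sub>C g m)"
      and orth: "\<And>l m. l < d \<Longrightarrow> m < d \<Longrightarrow> l \<noteq> m \<Longrightarrow>
        cinner (R (g l)) (R (g m)) = 0"
      and sv: "\<And>m. m < d \<Longrightarrow> norm (R (g m)) \<le> singular_value m R"
    let ?\<sigma> = "\<lambda>m. norm (R (g m))"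
    define D where "D = (\<lambda>i m. \<Sum>k\<in>K. (cmod (cinner (x i k) (g m)))\<^sup>2)"
    have D0: "0 \<le> D i m" for i m
      unfolding D_def by (rule sum_nonneg) simp
    have basis': "x i k = (\<Sum>m<d. cinner (x i k) (g m) *\<^sub>C g m)" if "i \<in> I" "k \<in> K" for i k
    proof (rule basis)
      have "x i k \<in> B" using that by (force simp: B_def)
      then show "x i k \<in> cvec.span B" by (rule cvec.span_base)
    qed
    have expand: "(\<Sum>k\<in>K. (norm (R (x i k)))\<^sup>2) = (\<Sum>m<d. D i m * (?\<sigma> m)\<^sup>2)" if "i \<in> I" for i
    proof -
      have "(\<Sum>k\<in>K. (norm (R (x i k)))\<^sup>2)
        = (\<Sum>k\<in>K. \<Sum>m<d. (cmod (cinner (x i k) (g m)))\<^sup>2 * (?\<sigma> m)\<^sup>2)"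
      proof (rule sum.cong[OF refl])
        fix k assume "k \<in> K"
        show "(norm (R (x i k)))\<^sup>2 = (\<Sum>m<d. (cmod (cinner (x i k) (g m)))\<^sup>2 * (?\<sigma> m)\<^sup>2)"
          using norm_sum_orthogonal_images[OF R finite_lessThan, of d g "\<lambda>m. cinner (x i k) (g m)"] orth
          unfolding basis'[OF that \<open>k \<in> K\<close>, symmetric] by simp
      qed
      also have "\<dots> = (\<Sum>m<d. D i m * (?\<sigma> m)\<^sup>2)"
        by (subst sum.swap) (simp add: D_def sum_distrib_right)
      finally show ?thesis .
    qed
    have Drow: "(\<Sum>m<d. D i m) \<le> c\<^sup>2" if "i \<in> I" for i
    proof -
      have "(\<Sum>m<d. D i m) = (\<Sum>k\<in>K. \<Sum>m<d. (cmod (cinner (x i k) (g m)))\<^sup>2)"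
        unfolding D_def by (rule sum.swap)
      also have "\<dots> \<le> (\<Sum>k\<in>K. (norm (x i k))\<^sup>2)"
        by (intro sum_mono Bessel_inequality[OF g]) simp
      finally show ?thesis using row[OF that] by simp
    qed
    have Dcol: "(\<Sum>i\<in>I. D i m) \<le> c\<^sup>2" if "m < d" for m
      using col[of "g m"] orthonormal_on_norm[OF g, of m] that by (simp add: D_def)
    \<comment> \<open>The row sums of \<open>D\<close> are the total weights in Jensen's inequality
      with exponent q / 2. After the exchange of summations, the column sums bound the coefficient
      of each \<open>?\<sigma> m powr q\<close>.\<close>
    have "(\<Sum>i\<in>I. (\<Sum>k\<in>K. (norm (R (x i k)))\<^sup>2) powr (q / 2))
      \<le> (\<Sum>i\<in>I. (c\<^sup>2) powr (q / 2 - 1) * (\<Sum>m<d. D i m * ?\<sigma> m powr q))"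
    proof (rule sum_mono)
      fix i assume i: "i \<in> I"
      have "(\<Sum>m<d. D i m * (?\<sigma> m)\<^sup>2) powr (q / 2)
        \<le> (c\<^sup>2) powr (q / 2 - 1) * (\<Sum>m<d. D i m * ((?\<sigma> m)\<^sup>2) powr (q / 2))"
        by (rule powr_weighted_sum_le) (use D0 Drow[OF i] \<open>2 \<le> q\<close> in auto)
      then show "(\<Sum>k\<in>K. (norm (R (x i k)))\<^sup>2) powr (q / 2)
        \<le> (c\<^sup>2) powr (q / 2 - 1) * (\<Sum>m<d. D i m * ?\<sigma> m powr q)"
        by (simp add: expand[OF i] power2_powr_half)
    qed
    also have "\<dots> = (c\<^sup>2) powr (q / 2 - 1) * (\<Sum>m<d. (\<Sum>i\<in>I. D i m) * ?\<sigma> m powr q)"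
      unfolding sum_distrib_left[symmetric] sum_distrib_right by (subst sum.swap) simp
    also have "\<dots> \<le> (c\<^sup>2) powr (q / 2 - 1) * (\<Sum>m<d. c\<^sup>2 * ?\<sigma> m powr q)"
      by (intro mult_left_mono sum_mono mult_right_mono Dcol) auto
    also have "\<dots> = c powr q * (\<Sum>m<d. ?\<sigma> m powr q)"
    proof -
      have "(c\<^sup>2) powr (q / 2 - 1) * c\<^sup>2 = c powr q"
      proof (cases "c = 0")
        case False
        then have "c > 0" using \<open>0 \<le> c\<close> by simp
        then have "c\<^sup>2 = c powr 2" by simp
        then have "(c\<^sup>2) powr (q / 2 - 1) * c\<^sup>2 = c powr (2 * (q / 2 - 1)) * c powr 2"
          by (simp only: powr_powr)
        also have "\<dots> = c powr q"
          by (simp flip: powr_add)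
        finally show ?thesis .
      qed simp
      then show ?thesis
        by (simp flip: sum_distrib_left mult.assoc)
    qed
    \<comment> \<open>The estimate stays in terms of \<open>norm (R (g m))\<close>:
      \<open>lp_bound_column\<close> passes on to singular values, whereas
      \<open>singular_value_power_sum_le\<close> needs the vectors with orthogonal images
      themselves.\<close>
    finally show thesis
      by (rule that[OF g, rotated 2]) (fact orth sv)+
  qed
qed

section \<open>Recovering singular values from orthonormal systems\<close>

lemma rank_le_mono: "rank_le K m \<Longrightarrow> m \<le> n \<Longrightarrow> rank_le K n"
  unfolding rank_le_def by (meson order_trans)

lemma singular_value_antimono: "m \<le> n \<Longrightarrow> singular_value n T \<le> singular_value m T"
  by (rule singular_value_geI, rule singular_value_le) (auto intro: rank_le_mono)

text \<open>Let P be the projection onto the span of the \<open>e i\<close>. Then W P has rank at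
  most n, so the norm of W - W P is at least the n-th singular value. The supremum that defines this
  norm need not be attained, hence the factor \<delta> < 1; a near-maximizer u is replaced by the
  multiple of u - P u of norm 1.\<close>

lemma singular_value_almost_attained:
  fixes W :: "'h::complex_hilbert_space \<Rightarrow>\<^sub>L 'h"
  assumes W: "W \<in> bounded_operators" and "\<delta> < 1" and "0 \<le> \<delta>" and "0 < singular_value n W"
    and e: "orthonormal_on {..<n} (e :: nat \<Rightarrow> 'h)"
  obtains v where "norm v = 1" "\<And>i. i < n \<Longrightarrow> cinner v (e i) = 0"
    "\<delta> * singular_value n W \<le> norm (W v)"
proof -
  define f where "f = (\<lambda>x. \<Sum>i<n. cinner x (e i) *\<^sub>C W (e i))"
  have "bounded_linear f"
    unfolding f_def
    by (intro bounded_linear_sum bounded_linear_compose[OF bounded_linear_scaleC_left]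
        bounded_linear_cinner_left)
  then have f: "(Blinfun f) x = (\<Sum>i<n. cinner x (e i) *\<^sub>C W (e i))" for x
    by (simp only: bounded_linear_Blinfun_apply) (simp only: f_def)
  have "Blinfun f \<in> bounded_operators"
    by (simp add: bounded_operators_def f cinner_scaleC_left cvec.scale_sum_right cvec.scale_scale)
  moreover have "rank_le (Blinfun f) n"
    unfolding rank_le_def
  proof (intro exI conjI)
    show "card ((\<lambda>i. W (e i)) ` {..<n}) \<le> n"
      using card_image_le[of "{..<n}"] by auto
    show "range ((Blinfun f)) \<subseteq> cvec.span ((\<lambda>i. W (e i)) ` {..<n})"
      by (rule image_subsetI, unfold f) (intro cvec.span_sum cvec.span_scale cvec.span_base imageI)
  qed simp
  ultimately have "singular_value n W \<le> norm (W - Blinfun f)"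
    by (rule singular_value_le)
  moreover have "\<delta> * singular_value n W < singular_value n W"
    using assms by simp
  ultimately have "\<not> norm (W - Blinfun f) \<le> \<delta> * singular_value n W" by simp
  moreover have "0 \<le> \<delta> * singular_value n W"
    using assms by simp
  ultimately obtain u where u: "\<delta> * singular_value n W * norm u < norm ((W - Blinfun f) u)"
    using norm_blinfun_bound[of "\<delta> * singular_value n W" "W - Blinfun f"] by (meson not_le)
  define v where "v = u - (\<Sum>i<n. cinner u (e i) *\<^sub>C e i)"
  have Wv: "(W - Blinfun f) u = W v"
    by (simp add: v_def blinfun.diff_left blinfun.diff_right blinfun.sum_right bounded_operatorsD[OF W] f)
  have "(norm v)\<^sup>2 \<le> (norm u)\<^sup>2"
    using orthonormal_projection_norm[OF e finite_lessThan, of u]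
    by (simp add: v_def sum_nonneg)
  then have vu: "norm v \<le> norm u"
    by (rule power2_le_imp_le) simp
  have "0 \<le> \<delta> * singular_value n W * norm u"
    using assms by simp
  then have "v \<noteq> 0"
    using u Wv by (auto simp: blinfun.zero_right)
  show thesis
  proof (rule that[of "(1 / norm v) *\<^sub>R v"])
    show "norm ((1 / norm v) *\<^sub>R v) = 1"
      by (rule norm_normalize[OF \<open>v \<noteq> 0\<close>])
    show "cinner ((1 / norm v) *\<^sub>R v) (e i) = 0" if "i < n" for i
      using orthonormal_projection_residual[OF e finite_lessThan, of i u] that
      by (simp add: cinner_scaleR_left v_def)
    have "\<delta> * singular_value n W * norm v \<le> \<delta> * singular_value n W * norm u"
      using vu assms by (intro mult_left_mono) auto
    then have "\<delta> * singular_value n W * norm v \<le> norm (W v)"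
      using u Wv by simp
    then show "\<delta> * singular_value n W \<le> norm (W ((1 / norm v) *\<^sub>R v))"
      using \<open>v \<noteq> 0\<close> by (simp add: blinfun.scaleR_right field_simps)
  qed
qed

text \<open>The vectors are chosen one after another; each choice uses only that the earlier ones
  are orthonormal, not how well they were chosen.\<close>

lemma singular_values_almost_attained:
  fixes W :: "'h::complex_hilbert_space \<Rightarrow>\<^sub>L 'h"
  assumes W: "W \<in> bounded_operators" and \<delta>: "\<delta> < 1" "0 \<le> \<delta>"
    and "\<And>i. i < n \<Longrightarrow> 0 < singular_value i W"
  shows "\<exists>e :: nat \<Rightarrow> 'h. orthonormal_on {..<n} e \<and>
    (\<forall>i<n. \<delta> * singular_value i W \<le> norm (W (e i)))"
  using assms(4)
proof (induction n)
  case (Suc n)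
  then obtain e :: "nat \<Rightarrow> 'h" where e: "orthonormal_on {..<n} e"
    "\<forall>i<n. \<delta> * singular_value i W \<le> norm (W (e i))"
    by auto
  obtain v where v: "norm v = 1" "\<And>i. i < n \<Longrightarrow> cinner v (e i) = 0"
    "\<delta> * singular_value n W \<le> norm (W v)"
    using singular_value_almost_attained[OF W \<delta> Suc.prems[OF lessI] e(1)] by metis
  show ?case
    by (rule exI[of _ "e(n := v)"])
      (use e v orthonormal_on_Suc[OF e(1) v(1,2)] in \<open>auto simp: less_Suc_eq simp del: fun_upd_apply\<close>, simp_all)
qed (simp add: orthonormal_on_def)

text \<open>Near-optimal vectors e need not have orthogonal images, so they are traded for singular
  vectors g of W on their span. The normalized images of the \<open>g m\<close> then serve as f, and
  \<open>cmod (cinner (W (g m)) (f m))\<close> is exactly \<open>norm (W (g m))\<close>. Finally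
  \<delta> tends to 1.\<close>

lemma singular_value_power_sum_le:
  fixes W :: "'h::complex_hilbert_space \<Rightarrow>\<^sub>L 'h"
  assumes W: "W \<in> bounded_operators" and "2 \<le> r"
    and bound: "\<And>(I::nat set) e f. finite I \<Longrightarrow> orthonormal_on I e \<Longrightarrow> orthonormal_on I f \<Longrightarrow>
      (\<Sum>i\<in>I. cmod (cinner (W (e i)) (f i)) powr r) \<le> C"
  shows "(\<Sum>i<n. singular_value i W powr r) \<le> C"
proof (induction n)
  case 0
  show ?case using bound[of "{}" undefined undefined] by (simp add: orthonormal_on_def)
next
  case (Suc n)
  show ?case
  \<comment> \<open>A vanishing last singular value adds nothing to the sum. If it is positive, so
    are all earlier ones by monotonicity, as the choice of near-optimal vectors requires.\<close>
  proof (cases "singular_value n W = 0")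
    case True
    then show ?thesis using Suc by simp
  next
    case False
    then have pos: "0 < singular_value i W" if "i < Suc n" for i
      using singular_value_antimono[of i n W] singular_value_nonneg[of n W] that by simp
    have scaled: "\<delta> powr r * (\<Sum>i<Suc n. singular_value i W powr r) \<le> C" if \<delta>: "0 < \<delta>" "\<delta> < 1" for \<delta>
    proof -
      obtain e :: "nat \<Rightarrow> 'h" where e: "orthonormal_on {..<Suc n} e"
        "\<forall>i<Suc n. \<delta> * singular_value i W \<le> norm (W (e i))"
        using singular_values_almost_attained[OF W \<delta>(2), of "Suc n"] \<delta> pos by auto
      obtain d and g :: "nat \<Rightarrow> 'h" where g: "orthonormal_on {..<d} g"
        and orth: "\<And>l m. l < d \<Longrightarrow> m < d \<Longrightarrow> l \<noteq> m \<Longrightarrow>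
          cinner (W (g l)) (W (g m)) = 0"
        and le: "(\<Sum>i<Suc n. (\<Sum>k\<in>{()}. (norm (W (e i)))\<^sup>2) powr (r / 2))
          \<le> 1 powr r * (\<Sum>m<d. norm (W (g m)) powr r)"
      \<comment> \<open>There is one vector \<open>e i\<close> per index, hence the singleton
        \<open>{()}\<close> and the constant 1: the row sums are
        \<open>(norm (e i))\<^sup>2\<close>, and Bessel's inequality bounds the column sums.\<close>
      proof (rule schatten_power_sum_le[OF W finite_lessThan, of "{()}" 1 r "Suc n" "\<lambda>i _. e i"])
        fix g :: 'h assume "norm g = 1"
        then show "(\<Sum>i<Suc n. \<Sum>k\<in>{()}. (cmod (cinner (e i) g))\<^sup>2) \<le> 1\<^sup>2"
          using Bessel_inequality[OF e(1) finite_lessThan, of g]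
          by (simp add: cmod_cinner_commute[of g] del: sum.lessThan_Suc)
      qed (use \<open>2 \<le> r\<close> orthonormal_on_norm[OF e(1)] in auto)
      define I where "I = {m. m < d \<and> W (g m) \<noteq> 0}"
      define f where "f = (\<lambda>m. (1 / norm (W (g m))) *\<^sub>R W (g m))"
      have f: "orthonormal_on I f"
        unfolding orthonormal_on_def
      proof (intro ballI)
        fix l m assume "l \<in> I" "m \<in> I"
        then show "cinner (f l) (f m) = (if l = m then 1 else 0)"
          using orth[of l m]
          by (auto simp: I_def f_def cinner_scaleR_left cinner_scaleR_right cinner_self power2_eq_square)
      qed
      have Wf: "cmod (cinner (W (g m)) (f m)) = norm (W (g m))" for m
        by (simp add: f_def cinner_scaleR_right cinner_self power2_eq_square norm_mult)
      have "\<delta> powr r * (\<Sum>i<Suc n. singular_value i W powr r)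
        = (\<Sum>i<Suc n. (\<delta> * singular_value i W) powr r)"
        using \<delta> by (simp add: powr_mult singular_value_nonneg sum_distrib_left del: sum.lessThan_Suc)
      also have "\<dots> \<le> (\<Sum>i<Suc n. norm (W (e i)) powr r)"
        by (intro sum_mono powr_mono2) (use e(2) \<open>2 \<le> r\<close> \<delta> in \<open>auto simp: singular_value_nonneg\<close>)
      also have "\<dots> \<le> (\<Sum>m<d. norm (W (g m)) powr r)"
        using le by (simp add: power2_powr_half del: sum.lessThan_Suc)
      also have "\<dots> = (\<Sum>m\<in>I. cmod (cinner (W (g m)) (f m)) powr r)"
        unfolding Wf by (rule sum.mono_neutral_right) (auto simp: I_def)
      also have "\<dots> \<le> C"
        by (rule bound[OF _ orthonormal_on_subset[OF g] f]) (auto simp: I_def)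
      finally show ?thesis .
    qed
    show ?thesis
    \<comment> \<open>Every z strictly between 0 and 1 has the form \<open>\<delta> powr r\<close>,
      with \<delta> the value \<open>z powr (1 / r)\<close> in the same interval.\<close>
    proof (rule field_le_mult_one_interval)
      fix z :: real assume z: "0 < z" "z < 1"
      have "(z powr (1 / r)) powr r = z"
        using z \<open>2 \<le> r\<close> by (simp add: powr_powr)
      moreover have "z powr (1 / r) < 1"
        using z \<open>2 \<le> r\<close> powr_less_mono2[of "1 / r" z 1] by simp
      ultimately show "z * (\<Sum>i<Suc n. singular_value i W powr r) \<le> C"
        using scaled[of "z powr (1 / r)"] z by simp
    qed
  qed
qed

subsection \<open>Spectral measures\<close>

lemma spectral_measure_sums:
  assumes "spectral_measure M E" "range A \<subseteq> sets M" "disjoint_family A"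
  shows "(\<lambda>n. (E (A n)) u) sums (E (\<Union>n. A n)) u"
  using assms unfolding spectral_measure_def by blast

lemma spectral_measure_projection:
  "spectral_measure M E \<Longrightarrow> A \<in> sets M \<Longrightarrow> orthogonal_projection (E A)"
  unfolding spectral_measure_def by blast

lemma
  assumes "spectral_measure M E" "A \<in> sets M"
  shows spectral_measure_bounded_operators: "E A \<in> bounded_operators"
    and cinner_spectral_measure:
      "cinner (E A u) v = cinner (E A u) (E A v)"
proof -
  have P: "E A \<in> bounded_operators" "E A o\<^sub>L E A = E A"
    "\<And>u v. cinner (E A u) v = cinner u (E A v)"
    using spectral_measure_projection[OF assms] by (auto simp: orthogonal_projection_def)
  show "E A \<in> bounded_operators" by (rule P)
  have "(E A) (E A u) = (E A) u"
    by (metis P(2) blinfun_apply_blinfun_compose)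
  then show "cinner (E A u) v = cinner (E A u) (E A v)"
    by (metis P(3))
qed

lemma cinner_spectral_measure_self:
  assumes "spectral_measure M E" "A \<in> sets M"
  shows "cinner (E A u) u = of_real ((norm (E A u))\<^sup>2)"
  by (subst cinner_spectral_measure[OF assms]) (rule cinner_self)

text \<open>A series with constant terms converges only if they vanish.\<close>

lemma spectral_measure_empty:
  assumes "spectral_measure M E"
  shows "E {} = 0"
proof (rule blinfun_eqI)
  fix u
  have "(\<lambda>n. (E {}) u) sums (E (\<Union>n::nat. {})) u"
    by (rule spectral_measure_sums[OF assms]) (auto simp: disjoint_family_on_def)
  then have "(\<lambda>n::nat. (E {}) u) \<longlonglongrightarrow> 0"
    by (auto dest: sums_summable summable_LIMSEQ_zero)
  then show "E {} u = blinfun_apply 0 u"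
    by (simp add: LIMSEQ_const_iff)
qed

lemma space_scalar_measure [simp]: "space (scalar_measure M E u) = space M"
  and sets_scalar_measure [simp, measurable_cong]: "sets (scalar_measure M E u) = sets M"
  by (simp_all add: scalar_measure_def)

lemma borel_measurable_scalar_measure:
  "f \<in> borel_measurable (scalar_measure M E u) \<longleftrightarrow> f \<in> borel_measurable M"
  by (rule measurable_cong_sets[THEN arg_cong]) simp_all

lemma emeasure_scalar_measure:
  assumes E: "spectral_measure M E" and A: "A \<in> sets M"
  shows "emeasure (scalar_measure M E u) A = ennreal ((norm (E A u))\<^sup>2)"
proof -
  let ?\<mu> = "\<lambda>A. ennreal (Re (cinner (E A u) u))"
  have re: "Re (cinner (E A u) u) = (norm (E A u))\<^sup>2" if "A \<in> sets M" for A
    by (simp only: cinner_spectral_measure_self[OF E that] Re_complex_of_real)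
  have "emeasure (scalar_measure M E u) A = ?\<mu> A"
    unfolding scalar_measure_def
  proof (rule emeasure_measure_of_sigma)
    show "sigma_algebra (space M) (sets M)" by (rule sets.sigma_algebra_axioms)
    show "positive (sets M) ?\<mu>"
      by (simp add: positive_def spectral_measure_empty[OF E])
    show "countably_additive (sets M) ?\<mu>"
      unfolding countably_additive_def
    proof (intro allI impI)
      fix A :: "nat \<Rightarrow> 'a set"
      assume A: "range A \<subseteq> sets M" "disjoint_family A" "\<Union> (range A) \<in> sets M"
      have "(\<lambda>n. Re (cinner ((E (A n)) u) u)) sums Re (cinner ((E (\<Union>n. A n)) u) u)"
        by (intro bounded_linear.sums[OF bounded_linear_Re]
            bounded_linear.sums[OF bounded_linear_cinner_left] spectral_measure_sums[OF E A(1,2)])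
      then have "(\<lambda>n. ?\<mu> (A n)) sums ?\<mu> (\<Union>n. A n)"
        using A by (subst sums_ennreal) (auto simp: re)
      then show "(\<Sum>n. ?\<mu> (A n)) = ?\<mu> (\<Union> (range A))"
        by (rule sums_unique[symmetric])
    qed
  qed (rule A)
  then show ?thesis by (simp only: re[OF A])
qed

lemma emeasure_scalar_measure_space:
  assumes "spectral_measure M E"
  shows "emeasure (scalar_measure M E u) (space M) = ennreal ((norm u)\<^sup>2)"
  using emeasure_scalar_measure[OF assms sets.top, of u] assms by (simp add: spectral_measure_def)

lemma finite_measure_scalar_measure:
  "spectral_measure M E \<Longrightarrow> finite_measure (scalar_measure M E u)"
  by (intro finite_measureI) (simp add: emeasure_scalar_measure_space)

lemma measure_scalar_measure:
  "spectral_measure M E \<Longrightarrow> A \<in> sets M \<Longrightarrow>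
    measure (scalar_measure M E u) A = (norm (E A u))\<^sup>2"
  by (simp add: measure_def emeasure_scalar_measure)

lemma measure_scalar_measure_space:
  "spectral_measure M E \<Longrightarrow> measure (scalar_measure M E u) (space M) = (norm u)\<^sup>2"
  by (simp add: measure_def emeasure_scalar_measure_space)

text \<open>Additivity of the scalar measure of u. This is the counterpart of
  \<open>Bessel_inequality\<close> with the projections of disjoint cells in place of orthonormal
  vectors; both are inputs of \<open>matrix_bound_sum_le\<close>.\<close>

lemma sum_norm_spectral_measure_le:
  assumes E: "spectral_measure M E" and P: "finite P" "P \<subseteq> sets M" "disjoint P"
  shows "(\<Sum>D\<in>P. (norm (E D u))\<^sup>2) \<le> (norm u)\<^sup>2"
proof -
  interpret finite_measure "scalar_measure M E u"
    by (rule finite_measure_scalar_measure[OF E])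
  have "(\<Sum>D\<in>P. (norm (E D u))\<^sup>2) = (\<Sum>D\<in>P. measure (scalar_measure M E u) D)"
    using P by (intro sum.cong refl measure_scalar_measure[OF E, symmetric]) auto
  also have "\<dots> = measure (scalar_measure M E u) (\<Union>D\<in>P. D)"
    using P by (intro finite_measure_finite_Union[symmetric]) (auto simp: disjoint_def disjoint_family_on_def)
  also have "\<dots> \<le> measure (scalar_measure M E u) (space M)"
    using bounded_measure by simp
  finally show ?thesis
    by (simp add: measure_scalar_measure_space[OF E])
qed

lemma spectral_AE_imp_AE:
  assumes "spectral_measure M E" "spectral_AE M E P"
  shows "AE x in scalar_measure M E u. P x"
proof -
  obtain N where N: "N \<in> sets M" "E N = 0" "\<forall>x\<in>space M - N. P x"
    using assms(2) by (auto simp: spectral_AE_def)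
  then have "N \<in> null_sets (scalar_measure M E u)"
    by (simp add: null_sets_def emeasure_scalar_measure[OF assms(1)])
  then show ?thesis
    by (rule AE_I') (use N in auto)
qed

lemma spectral_AE_mono: "spectral_AE M E P \<Longrightarrow> (\<And>x. x \<in> space M \<Longrightarrow> P x \<Longrightarrow> Q x) \<Longrightarrow> spectral_AE M E Q"
  unfolding spectral_AE_def by blast

lemma spectral_AE_all_countable:
  assumes E: "spectral_measure M E" and "\<And>n::nat. spectral_AE M E (P n)"
  shows "spectral_AE M E (\<lambda>x. \<forall>n. P n x)"
proof -
  obtain N where N: "\<And>n. N n \<in> sets M" "\<And>n. E (N n) = 0" "\<And>n. \<forall>x\<in>space M - N n. P n x"
    using assms(2) unfolding spectral_AE_def by metis
  have U: "(\<Union>n. N n) \<in> sets M" using N(1) by auto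
  have "E (\<Union>n. N n) = 0"
  proof (rule blinfun_eqI)
    fix u
    have "(\<Union>n. N n) \<in> null_sets (scalar_measure M E u)"
      by (rule null_sets_UN) (simp add: null_sets_def emeasure_scalar_measure[OF E] N)
    then show "E (\<Union>n. N n) u = blinfun_apply 0 u"
      by (simp add: null_sets_def emeasure_scalar_measure[OF E U])
  qed
  then show ?thesis
    using U N(3) unfolding spectral_AE_def by blast
qed

text \<open>The infimum is attained: increasing it by 1 / (n + 1) gives countably many exceptional
  sets, whose union is again null. Finiteness makes the increased bounds strictly larger than the
  infimum.\<close>

lemma spectral_AE_le_ess_sup:
  assumes E: "spectral_measure M E" and fin: "spectral_ess_sup M E f < \<infinity>"
  shows "spectral_AE M E (\<lambda>x. f x \<le> spectral_ess_sup M E f)"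
proof -
  let ?c = "spectral_ess_sup M E f"
  have "spectral_AE M E (\<lambda>x. f x \<le> ?c + ennreal (1 / real (Suc n)))" for n
  proof -
    have "?c < ?c + ennreal (1 / real (Suc n))"
      using fin ennreal_add_left_cancel_less[of ?c 0 "ennreal (1 / real (Suc n))"]
      by (simp add: infinity_ennreal_def del: of_nat_Suc)
    then obtain c where c: "spectral_AE M E (\<lambda>x. f x \<le> c)" "c < ?c + ennreal (1 / real (Suc n))"
      by (subst (asm) spectral_ess_sup_def) (auto simp: Inf_less_iff spectral_ess_sup_def)
    then show ?thesis
      by (elim spectral_AE_mono) auto
  qed
  from spectral_AE_all_countable[OF E this] show ?thesis
  proof (rule spectral_AE_mono)
    fix x assume *: "\<forall>n. f x \<le> ?c + ennreal (1 / real (Suc n))"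
    show "f x \<le> ?c"
    proof (rule ennreal_le_epsilon)
      fix e :: real assume "0 < e"
      then obtain n where "1 / real (Suc n) < e"
        using nat_approx_posE by blast
      then have "?c + ennreal (1 / real (Suc n)) \<le> ?c + ennreal e"
        by (intro add_left_mono ennreal_leI) simp
      then show "f x \<le> ?c + ennreal e"
        using * order_trans by blast
    qed
  qed
qed


subsection \<open>Spectral integrals\<close>

lemma (in finite_measure) integrable_AE_bounded:
  fixes g :: "'a \<Rightarrow> complex"
  assumes "g \<in> borel_measurable M" "AE x in M. cmod (g x) \<le> C"
  shows "integrable M g"
  using assms(2,1) by (rule integrable_const_bound)

lemma (in finite_measure) norm_integral_le_AE:
  fixes g :: "'a \<Rightarrow> complex"
  assumes "g \<in> borel_measurable M" "AE x in M. cmod (g x) \<le> C"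
  shows "cmod (integral\<^sup>L M g) \<le> C * measure M (space M)"
proof -
  have "cmod (integral\<^sup>L M g) \<le> (\<integral>x. cmod (g x) \<partial>M)"
    by (rule integral_norm_bound)
  also have "\<dots> \<le> (\<integral>x. C \<partial>M)"
    by (rule integral_mono_AE) (use integrable_AE_bounded[OF assms] assms(2) in auto)
  finally show ?thesis by (simp add: mult.commute)
qed

text \<open>The cells are the joint level sets of the real and imaginary parts of all functions of
  the family, rounded down on a grid of width \<open>\<epsilon> / 2\<close>. Boundedness leaves
  finitely many grid values, and the two parts contribute \<open>\<epsilon> / 2\<close> each. Empty
  cells are excluded so that a sample point can be chosen in every cell.\<close>

lemma finite_partition_almost_constant:
  fixes f :: "'i \<Rightarrow> 'x \<Rightarrow> complex"
  assumes "finite I" and S: "S \<in> sets M" and f: "\<And>i. i \<in> I \<Longrightarrow> f i \<in> borel_measurable M"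
    and bound: "\<And>i x. i \<in> I \<Longrightarrow> x \<in> S \<Longrightarrow> cmod (f i x) \<le> C" and "0 < \<epsilon>"
  obtains P where "finite P" "P \<subseteq> sets M" "disjoint P" "\<Union>P = S" "{} \<notin> P"
    "\<And>D x y i. D \<in> P \<Longrightarrow> x \<in> D \<Longrightarrow> y \<in> D \<Longrightarrow> i \<in> I \<Longrightarrow> cmod (f i x - f i y) \<le> \<epsilon>"
proof -
  define r where "r = (\<lambda>i x. \<lfloor>Re (f i x) / (\<epsilon> / 2)\<rfloor>)"
  define s where "s = (\<lambda>i x. \<lfloor>Im (f i x) / (\<epsilon> / 2)\<rfloor>)"
  \<comment> \<open>Restriction to \<open>I\<close> puts all keys into a finite set of the form
    \<open>PiE I\<close>.\<close>
  define key where "key = (\<lambda>x. \<lambda>i\<in>I. (r i x, s i x))"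
  define cell where "cell = (\<lambda>y. {x \<in> S. key x = key y})"
  define N where "N = \<lceil>C / (\<epsilon> / 2)\<rceil> + 1"
  have floor_bound: "\<lfloor>t / (\<epsilon> / 2)\<rfloor> \<in> {-N..N}" if "\<bar>t\<bar> \<le> C" for t
  proof -
    have "t / (\<epsilon> / 2) \<le> C / (\<epsilon> / 2)" "- (C / (\<epsilon> / 2)) \<le> t / (\<epsilon> / 2)"
      using that \<open>0 < \<epsilon>\<close> by (auto simp: field_simps)
    then show ?thesis
      unfolding N_def by (simp add: le_floor_iff) linarith
  qed
  have "key ` S \<subseteq> PiE I (\<lambda>_. {-N..N} \<times> {-N..N})"
    unfolding key_def r_def s_def
    using bound abs_Re_le_cmod abs_Im_le_cmod
    by (intro image_subsetI restrict_PiE_iff[THEN iffD2] ballI SigmaI floor_bound) (meson order_trans)+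
  then have fin: "finite (key ` S)"
    by (rule finite_subset) (intro finite_PiE \<open>finite I\<close> finite_cartesian_product finite_atLeastAtMost_int)
  have cell_image: "cell ` S = (\<lambda>g. {x \<in> S. key x = g}) ` (key ` S)"
    unfolding cell_def image_image ..
  have sub: "S \<subseteq> space M" using S by (rule sets.sets_into_space)
  have cell_sets: "cell y \<in> sets M" for y
  proof -
    have "cell y = S \<inter> (space M \<inter> (\<Inter>i\<in>I. {x \<in> space M. r i x = r i y \<and> s i x = s i y}))"
      using sub by (auto simp: cell_def key_def fun_eq_iff restrict_def)
    moreover have "{x \<in> space M. r i x = r i y \<and> s i x = s i y} \<in> sets M" if "i \<in> I" for i
      using f[OF that] unfolding r_def s_def floor_eq_iff by measurable
    ultimately show ?thesis
      using S \<open>finite I\<close> by (cases "I = {}") (auto intro!: sets.Int sets.finite_INT)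
  qed
  show thesis
  proof (rule that[of "cell ` S"])
    show "finite (cell ` S)"
      unfolding cell_image by (rule finite_imageI[OF fin])
    show "disjoint (cell ` S)"
      by (auto simp: disjoint_def cell_def)
    show "cmod (f i x - f i y) \<le> \<epsilon>" if "D \<in> cell ` S" "x \<in> D" "y \<in> D" "i \<in> I" for D x y i
    proof -
      have "key x = key y"
        using that by (auto simp: cell_def)
      from fun_cong[OF this, of i] have eq: "r i x = r i y" "s i x = s i y"
        using \<open>i \<in> I\<close> by (auto simp: key_def)
      have close: "\<bar>a - b\<bar> \<le> \<epsilon> / 2" if "\<lfloor>a / (\<epsilon> / 2)\<rfloor> = \<lfloor>b / (\<epsilon> / 2)\<rfloor>" for a b
      proof -
        have "\<bar>a / (\<epsilon> / 2) - b / (\<epsilon> / 2)\<bar> < 1"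
          using that by linarith
        then have "\<bar>(a - b) / (\<epsilon> / 2)\<bar> < 1"
          by (simp add: diff_divide_distrib algebra_simps)
        then show ?thesis
          using \<open>0 < \<epsilon>\<close> unfolding abs_divide by (subst (asm) pos_divide_less_eq) simp_all
      qed
      have "cmod (f i x - f i y) \<le> \<bar>Re (f i x - f i y)\<bar> + \<bar>Im (f i x - f i y)\<bar>"
        by (rule cmod_le)
      also have "\<dots> \<le> \<epsilon> / 2 + \<epsilon> / 2"
        using eq unfolding r_def s_def minus_complex.sel by (intro add_mono close)
      finally show ?thesis by simp
    qed
    show "cell ` S \<subseteq> sets M"
      using cell_sets by blast
    show "\<Union> (cell ` S) = S" "{} \<notin> cell ` S"
      by (auto simp: cell_def)
  qed
qed

text \<open>Complex multiples of an operator are written as compositions with this one.\<close>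

definition scalar_operator :: "complex \<Rightarrow> 'h::complex_hilbert_space \<Rightarrow>\<^sub>L 'h" where
  "scalar_operator c = Blinfun (\<lambda>x. c *\<^sub>C x)"

lemma scalar_operator_apply: "(scalar_operator c) x = c *\<^sub>C x"
  unfolding scalar_operator_def by (subst bounded_linear_Blinfun_apply[OF bounded_linear_scaleC_right]) simp

lemma scalar_operator_bounded_operators: "scalar_operator c \<in> bounded_operators"
  by (simp add: bounded_operators_def scalar_operator_apply cvec.scale_scale mult.commute)

text \<open>For disjoint cells, the spectral integral of the step function with the value
  \<open>c D\<close> on D.\<close>

definition simple_operator ::
    "('x set \<Rightarrow> 'h::complex_hilbert_space \<Rightarrow>\<^sub>L 'h) \<Rightarrow> 'x set set \<Rightarrow> ('x set \<Rightarrow> complex) \<Rightarrow> 'h \<Rightarrow>\<^sub>L 'h" where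
  "simple_operator E P c = (\<Sum>D\<in>P. scalar_operator (c D) o\<^sub>L E D)"

lemma cinner_simple_operator:
  "cinner (simple_operator E P c u) v = (\<Sum>D\<in>P. c D * cinner (E D u) v)"
  by (simp add: simple_operator_def blinfun.sum_left cinner_sum_left scalar_operator_apply cinner_scaleC_left)

lemma simple_operator_bounded_operators:
  "spectral_measure M E \<Longrightarrow> P \<subseteq> sets M \<Longrightarrow> simple_operator E P c \<in> bounded_operators"
  unfolding simple_operator_def
  by (intro bounded_operators_sum bounded_operators_compose scalar_operator_bounded_operators)
    (auto intro: spectral_measure_bounded_operators)

text \<open>The form of the simple operator at u is the integral of a step function against the
  scalar measure of u, whose total mass is \<open>(norm u)\<^sup>2\<close>, and the step function
  differs from f by at most \<epsilon> off a null set. With \<open>norm_le_numerical_radius\<close>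
  this becomes a bound \<open>2 * \<epsilon>\<close> in operator norm.\<close>

lemma simple_operator_close:
  assumes E: "spectral_measure M E" and P: "finite P" "P \<subseteq> sets M" "disjoint P"
    and null: "E (space M - \<Union>P) = 0"
    and f: "f \<in> borel_measurable M" and close: "\<And>D x. D \<in> P \<Longrightarrow> x \<in> D \<Longrightarrow> cmod (c D - f x) \<le> \<epsilon>"
    and bdd: "spectral_AE M E (\<lambda>x. cmod (f x) \<le> C)"
  shows "cmod (cinner (simple_operator E P c u) u - integral\<^sup>L (scalar_measure M E u) f)
    \<le> \<epsilon> * (norm u)\<^sup>2"
proof -
  let ?\<mu> = "scalar_measure M E u"
  interpret finite_measure ?\<mu>
    by (rule finite_measure_scalar_measure[OF E])
  define g where "g = (\<lambda>x. \<Sum>D\<in>P. c D * indicat_real D x)"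
  have int_f: "integrable ?\<mu> f"
    by (rule integrable_AE_bounded[OF _ spectral_AE_imp_AE[OF E bdd]])
      (simp add: borel_measurable_scalar_measure f)
  have int_D: "integrable ?\<mu> (\<lambda>x. c D * indicat_real D x)" if "D \<in> P" for D
    using that P(2) by (intro integrable_mult_right integrable_of_real) (auto intro: integrable_real_indicator simp: emeasure_eq_measure)
  have "cinner (simple_operator E P c u) u = (\<Sum>D\<in>P. c D * of_real (measure ?\<mu> D))"
    unfolding cinner_simple_operator
    using P(2) by (intro sum.cong refl) (auto simp: cinner_spectral_measure_self[OF E] measure_scalar_measure[OF E] subset_iff)
  also have "\<dots> = integral\<^sup>L ?\<mu> g"
    unfolding g_def
    using int_D P(2) by (subst Bochner_Integration.integral_sum) (auto intro!: sum.cong simp: subset_iff)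
  finally have "cinner (simple_operator E P c u) u - integral\<^sup>L ?\<mu> f
    = integral\<^sup>L ?\<mu> (\<lambda>x. g x - f x)"
    unfolding g_def
    using int_f int_D by (subst Bochner_Integration.integral_diff) auto
  moreover have "cmod (integral\<^sup>L ?\<mu> (\<lambda>x. g x - f x)) \<le> \<epsilon> * measure ?\<mu> (space ?\<mu>)"
  proof (rule norm_integral_le_AE)
    have "integrable ?\<mu> (\<lambda>x. g x - f x)"
      unfolding g_def using int_f int_D by auto
    then show "(\<lambda>x. g x - f x) \<in> borel_measurable ?\<mu>"
      by (rule borel_measurable_integrable)
    have "spectral_AE M E (\<lambda>x. cmod (g x - f x) \<le> \<epsilon>)"
      unfolding spectral_AE_def
    proof (intro bexI[of _ "space M - \<Union>P"] conjI ballI null)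
      fix x assume "x \<in> space M - (space M - \<Union>P)"
      then obtain D where D: "D \<in> P" "x \<in> D" by auto
      have "g x = (\<Sum>D'\<in>{D}. c D' * indicat_real D' x)"
        unfolding g_def
      proof (rule sum.mono_neutral_right)
        show "\<forall>D'\<in>P - {D}. c D' * indicat_real D' x = 0"
          using D P(3) by (auto simp: disjoint_def indicator_def)
      qed (use D P(1) in auto)
      then show "cmod (g x - f x) \<le> \<epsilon>"
        using close[OF D] D by simp
    qed (use P in auto)
    then show "AE x in ?\<mu>. cmod (g x - f x) \<le> \<epsilon>"
      by (rule spectral_AE_imp_AE[OF E])
  qed
  ultimately show ?thesis
    by (simp add: measure_scalar_measure_space[OF E])
qed

section \<open>Existence of the spectral integral of an essentially bounded function\<close>

lemma spectral_AE_measurable_set: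
  assumes E: "spectral_measure M E" and "spectral_AE M E P"
  obtains S where "S \<in> sets M" "E (space M - S) = 0" "\<And>x. x \<in> S \<Longrightarrow> P x"
proof -
  obtain N where N: "N \<in> sets M" "E N = 0" "\<forall>x\<in>space M - N. P x"
    using assms(2) by (auto simp: spectral_AE_def)
  have "space M - (space M - N) = N"
    using sets.sets_into_space[OF N(1)] by auto
  then show thesis
    using N by (intro that[of "space M - N"]) auto
qed

lemma spectral_integral_eqI:
  assumes "A \<in> bounded_operators"
    and "\<And>u. cinner (A u) u = integral\<^sup>L (scalar_measure M E u) f"
  shows "spectral_integral M E f = A"
  unfolding spectral_integral_def
  by (rule the_equality) (use assms in \<open>auto intro: bounded_operators_eqI\<close>)

text \<open>The description by \<open>THE\<close> says nothing until an operator with the required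
  form exists. Simple operators for step functions within 1 / (n + 1) of f have close quadratic
  forms, hence form a Cauchy sequence in norm, and their limit has the right form.\<close>

lemma
  assumes E: "spectral_measure M E" and f: "f \<in> borel_measurable M"
    and bdd: "spectral_AE M E (\<lambda>x. cmod (f x) \<le> C)"
  shows spectral_integral_bounded_operators: "spectral_integral M E f \<in> bounded_operators"
    and cinner_spectral_integral:
      "cinner (spectral_integral M E f u) u = integral\<^sup>L (scalar_measure M E u) f"
proof -
  obtain S where S: "S \<in> sets M" "E (space M - S) = 0" "\<And>x. x \<in> S \<Longrightarrow> cmod (f x) \<le> C"
    using spectral_AE_measurable_set[OF E bdd] by metis
  have "\<exists>A. A \<in> bounded_operators \<and> (\<forall>u. cmod (cinner (A u) u - integral\<^sup>L (scalar_measure M E u) f)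
    \<le> (1 / real (Suc n)) * (norm u)\<^sup>2)" for n
  proof -
    obtain P where P: "finite P" "P \<subseteq> sets M" "disjoint P" "\<Union>P = S" "{} \<notin> P"
      "\<And>D x y i. D \<in> P \<Longrightarrow> x \<in> D \<Longrightarrow> y \<in> D \<Longrightarrow> i \<in> {()} \<Longrightarrow> cmod (f x - f y) \<le> 1 / real (Suc n)"
      by (rule finite_partition_almost_constant[of "{()}" S M "\<lambda>_. f" C "1 / real (Suc n)"])
        (use S f in auto)
    have pt: "(SOME x. x \<in> D) \<in> D" if "D \<in> P" for D
      using that P(5) by (metis some_in_eq)
    let ?A = "simple_operator E P (\<lambda>D. f (SOME x. x \<in> D))"
    have "cmod (cinner (?A u) u - integral\<^sup>L (scalar_measure M E u) f)
      \<le> (1 / real (Suc n)) * (norm u)\<^sup>2" for u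
      by (rule simple_operator_close[OF E P(1-3) _ f _ bdd]) (use S(2) P(4) P(6) pt in auto)
    then show ?thesis
      using simple_operator_bounded_operators[OF E P(2)] by blast
  qed
  then obtain A where A: "\<And>n. A n \<in> bounded_operators"
    "\<And>n u. cmod (cinner (A n u) u - integral\<^sup>L (scalar_measure M E u) f)
      \<le> (1 / real (Suc n)) * (norm u)\<^sup>2"
    by metis
  have diff: "norm (A m - A n) \<le> 2 * (1 / real (Suc m) + 1 / real (Suc n))" for m n
  proof (rule norm_le_numerical_radius[OF bounded_operators_diff[OF A(1) A(1)]])
    fix u
    have "cinner ((A m - A n) u) u
      = (cinner (A m u) u - integral\<^sup>L (scalar_measure M E u) f)
      - (cinner (A n u) u - integral\<^sup>L (scalar_measure M E u) f)"
      by (simp add: blinfun.diff_left cinner_diff_left)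
    also have "cmod \<dots> \<le> (1 / real (Suc m)) * (norm u)\<^sup>2 + (1 / real (Suc n)) * (norm u)\<^sup>2"
      by (intro order_trans[OF norm_triangle_ineq4] add_mono A(2))
    finally show "cmod (cinner ((A m - A n) u) u)
      \<le> (1 / real (Suc m) + 1 / real (Suc n)) * (norm u)\<^sup>2"
      by (simp only: distrib_right)
  qed simp
  have "convergent A"
    by (rule convergent_of_norm_diff_le[where k = 1]) (simp_all only: power_one_right diff zero_less_one)
  then obtain B where B: "A \<longlonglongrightarrow> B"
    by (auto simp: convergent_def)
  have app: "(\<lambda>n. (A n) u) \<longlonglongrightarrow> B u" for u
    by (intro tendsto_intros B)
  have "B (c *\<^sub>C u) = c *\<^sub>C B u" for c u
  proof (rule LIMSEQ_unique[OF app])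
    show "(\<lambda>n. (A n) (c *\<^sub>C u)) \<longlonglongrightarrow> c *\<^sub>C B u"
      unfolding bounded_operatorsD[OF A(1)]
      by (rule bounded_linear.tendsto[OF bounded_linear_scaleC_right app])
  qed
  then have B': "B \<in> bounded_operators"
    by (simp add: bounded_operators_def)
  have q: "cinner (B u) u = integral\<^sup>L (scalar_measure M E u) f" for u
  proof (rule LIMSEQ_unique)
    show "(\<lambda>n. cinner (A n u) u) \<longlonglongrightarrow> cinner (B u) u"
      by (rule tendsto_cinner_left[OF app])
    have "(\<lambda>n. (1 / real (Suc n)) * (norm u)\<^sup>2) \<longlonglongrightarrow> 0 * (norm u)\<^sup>2"
      by (rule tendsto_mult[OF LIMSEQ_Suc[OF lim_1_over_n] tendsto_const])
    then have "(\<lambda>n. cinner (A n u) u - integral\<^sup>L (scalar_measure M E u) f) \<longlonglongrightarrow> 0"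
      by (intro Lim_null_comparison[OF always_eventually[OF allI[OF A(2)]]]) simp
    then show "(\<lambda>n. cinner (A n u) u) \<longlonglongrightarrow> integral\<^sup>L (scalar_measure M E u) f"
      by (rule LIM_zero_cancel)
  qed
  have "spectral_integral M E f = B"
    by (rule spectral_integral_eqI[OF B' q])
  then show "spectral_integral M E f \<in> bounded_operators"
    and "cinner (spectral_integral M E f u) u = integral\<^sup>L (scalar_measure M E u) f"
    using B' q by auto
qed

subsection \<open>Operator matrices of spectral integrals\<close>

text \<open>A norm bound for a finite section, as a sesquilinear estimate with a real constant. Rows
  and columns have separate index types; with the unit type for one of them, a vector becomes a
  matrix with one row or one column.\<close>

definition matrix_bound :: "'j set \<Rightarrow> 'k set \<Rightarrow> ('j \<Rightarrow> 'k \<Rightarrow> complex) \<Rightarrow> real \<Rightarrow> bool" where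
  "matrix_bound J K b C \<longleftrightarrow> (\<forall>a c. cmod (\<Sum>j\<in>J. \<Sum>k\<in>K. b j k * a k * cnj (c j))
     \<le> C * L2_set (\<lambda>k. cmod (a k)) K * L2_set (\<lambda>j. cmod (c j)) J)"

lemma matrix_boundD:
  "matrix_bound J K b C \<Longrightarrow> cmod (\<Sum>j\<in>J. \<Sum>k\<in>K. b j k * a k * cnj (c j))
     \<le> C * L2_set (\<lambda>k. cmod (a k)) K * L2_set (\<lambda>j. cmod (c j)) J"
  unfolding matrix_bound_def by simp

lemma L2_set_power2: "(L2_set f A)\<^sup>2 = (\<Sum>i\<in>A. (f i)\<^sup>2)"
  by (simp add: L2_set_def sum_nonneg)

lemma L2_set_L2_set_le:
  assumes "\<And>k. k \<in> K \<Longrightarrow> (\<Sum>l\<in>L. (F l k)\<^sup>2) \<le> (G k)\<^sup>2"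
  shows "L2_set (\<lambda>l. L2_set (F l) K) L \<le> L2_set G K"
proof -
  have "(\<Sum>l\<in>L. (L2_set (F l) K)\<^sup>2) = (\<Sum>k\<in>K. \<Sum>l\<in>L. (F l k)\<^sup>2)"
    unfolding L2_set_power2 by (rule sum.swap)
  also have "\<dots> \<le> (\<Sum>k\<in>K. (G k)\<^sup>2)"
    by (intro sum_mono assms)
  finally show ?thesis
    by (simp add: L2_set_def)
qed

text \<open>Cauchy-Schwarz over l and an exchange of summations. The index l runs over the
  coordinates in an orthonormal basis in \<open>matrix_bound_cinner\<close> and over the cells of a
  partition in \<open>spectral_integral_matrix_bound\<close>.\<close>

lemma matrix_bound_sum_le:
  fixes F :: "'l \<Rightarrow> 'k \<Rightarrow> real" and G :: "'l \<Rightarrow> 'j \<Rightarrow> real"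
  assumes z: "\<And>l. l \<in> L \<Longrightarrow> cmod (z l) \<le> C * L2_set (F l) K * L2_set (G l) J" and "0 \<le> C"
    and F: "\<And>k. k \<in> K \<Longrightarrow> (\<Sum>l\<in>L. (F l k)\<^sup>2) \<le> (x k)\<^sup>2"
    and G: "\<And>j. j \<in> J \<Longrightarrow> (\<Sum>l\<in>L. (G l j)\<^sup>2) \<le> (y j)\<^sup>2"
  shows "cmod (\<Sum>l\<in>L. z l) \<le> C * L2_set x K * L2_set y J"
proof -
  have "cmod (\<Sum>l\<in>L. z l) \<le> (\<Sum>l\<in>L. C * (L2_set (F l) K * L2_set (G l) J))"
    by (rule sum_norm_le) (use z in \<open>simp add: mult.assoc\<close>)
  also have "\<dots> = C * (\<Sum>l\<in>L. L2_set (F l) K * L2_set (G l) J)"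
    by (simp add: sum_distrib_left)
  also have "\<dots> \<le> C * (L2_set (\<lambda>l. L2_set (F l) K) L * L2_set (\<lambda>l. L2_set (G l) J) L)"
    using L2_set_mult_ineq[of "\<lambda>l. L2_set (F l) K" "\<lambda>l. L2_set (G l) J" L]
    by (intro mult_left_mono \<open>0 \<le> C\<close>) simp
  also have "\<dots> \<le> C * (L2_set x K * L2_set y J)"
    by (intro mult_left_mono mult_mono L2_set_L2_set_le F G \<open>0 \<le> C\<close>) (auto intro: L2_set_nonneg)
  finally show ?thesis by (simp add: mult.assoc)
qed

text \<open>In an orthonormal basis of the span of the \<open>\<eta> k\<close>, each coordinate is
  an instance of the scalar estimate; Bessel's inequality bounds the coordinates of both
  families.\<close>

lemma matrix_bound_cinner:
  fixes \<eta> :: "'k \<Rightarrow> 'h::complex_hilbert_space" and \<xi> :: "'j \<Rightarrow> 'h"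
  assumes b: "matrix_bound J K b C" and "0 \<le> C" and fin: "finite J" "finite K"
  shows "cmod (\<Sum>j\<in>J. \<Sum>k\<in>K. b j k * cinner (\<eta> k) (\<xi> j))
    \<le> C * L2_set (\<lambda>k. norm (\<eta> k)) K * L2_set (\<lambda>j. norm (\<xi> j)) J"
proof (rule orthonormal_basis[of "\<eta> ` K"])
  show "finite (\<eta> ` K)" using fin by simp
  fix n and g :: "nat \<Rightarrow> 'h"
  assume g: "orthonormal_on {..<n} g"
    and basis: "\<And>x. x \<in> cvec.span (\<eta> ` K) \<Longrightarrow> x = (\<Sum>i<n. cinner x (g i) *\<^sub>C g i)"
  have \<eta>: "\<eta> k = (\<Sum>i<n. cinner (\<eta> k) (g i) *\<^sub>C g i)" if "k \<in> K" for k
    using that by (intro basis cvec.span_base) auto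
  have "(\<Sum>j\<in>J. \<Sum>k\<in>K. b j k * cinner (\<eta> k) (\<xi> j))
    = (\<Sum>j\<in>J. \<Sum>k\<in>K. \<Sum>l<n. b j k * cinner (\<eta> k) (g l) * cnj (cinner (\<xi> j) (g l)))"
  proof (intro sum.cong refl)
    fix j k assume "k \<in> K"
    then have "cinner (\<eta> k) (\<xi> j) = (\<Sum>l<n. cinner (\<eta> k) (g l) * cinner (g l) (\<xi> j))"
      by (subst \<eta>) (simp_all add: cinner_sum_left cinner_scaleC_left)
    then show "b j k * cinner (\<eta> k) (\<xi> j)
      = (\<Sum>l<n. b j k * cinner (\<eta> k) (g l) * cnj (cinner (\<xi> j) (g l)))"
      by (simp add: sum_distrib_left mult.assoc flip: cinner_commute)
  qed
  also have "\<dots> = (\<Sum>l<n. \<Sum>j\<in>J. \<Sum>k\<in>K. b j k * cinner (\<eta> k) (g l) * cnj (cinner (\<xi> j) (g l)))"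
    by (subst (2) sum.swap, subst sum.swap) (rule refl)
  also have "cmod \<dots> \<le> C * L2_set (\<lambda>k. norm (\<eta> k)) K * L2_set (\<lambda>j. norm (\<xi> j)) J"
  proof (rule matrix_bound_sum_le[OF _ \<open>0 \<le> C\<close>])
    fix l
    show "cmod (\<Sum>j\<in>J. \<Sum>k\<in>K. b j k * cinner (\<eta> k) (g l) * cnj (cinner (\<xi> j) (g l)))
      \<le> C * L2_set (\<lambda>k. cmod (cinner (\<eta> k) (g l))) K * L2_set (\<lambda>j. cmod (cinner (\<xi> j) (g l))) J"
      by (rule matrix_boundD[OF b, of "\<lambda>k. cinner (\<eta> k) (g l)" "\<lambda>j. cinner (\<xi> j) (g l)"])
  qed (use Bessel_inequality[OF g] in auto)
  finally show ?thesis .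
qed

lemma matrix_bound_entry:
  assumes "matrix_bound J K b C" "finite J" "finite K" "j0 \<in> J" "k0 \<in> K"
  shows "cmod (b j0 k0) \<le> C"
proof -
  let ?a = "\<lambda>k. if k = k0 then 1 else 0 :: complex" and ?c = "\<lambda>j. if j = j0 then 1 else 0 :: complex"
  have "(\<Sum>j\<in>J. \<Sum>k\<in>K. b j k * ?a k * cnj (?c j)) = (\<Sum>j\<in>J. if j = j0 then b j k0 else 0)"
    using assms by (intro sum.cong refl) (auto simp: if_distrib[of "\<lambda>x. _ * x"] cong: if_cong)
  also have "\<dots> = b j0 k0"
    using assms by simp
  moreover have "L2_set (\<lambda>k. cmod (?a k)) K = 1" "L2_set (\<lambda>j. cmod (?c j)) J = 1"
    using assms by (auto simp: L2_set_def if_distrib[of cmod] if_distrib[of "\<lambda>x. x\<^sup>2"] cong: if_cong)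
  moreover have "cmod (\<Sum>j\<in>J. \<Sum>k\<in>K. b j k * ?a k * cnj (?c j))
    \<le> C * L2_set (\<lambda>k. cmod (?a k)) K * L2_set (\<lambda>j. cmod (?c j)) J"
    by (rule matrix_boundD[OF assms(1), of ?a ?c])
  ultimately show ?thesis by simp
qed

text \<open>All entries are approximated by simple operators over one common partition with one
  sample point per cell. On a cell D a single scalar matrix then acts on the vectors
  \<open>E D (\<eta> k)\<close> and \<open>E D (\<xi> j)\<close>, and
  \<open>sum_norm_spectral_measure_le\<close> adds up the cells.\<close>

lemma spectral_integral_matrix_bound:
  fixes \<eta> :: "'k \<Rightarrow> 'h::complex_hilbert_space" and \<xi> :: "'j \<Rightarrow> 'h"
  assumes E: "spectral_measure M E" and fin: "finite J" "finite K" and "0 \<le> C"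
    and \<beta>: "\<And>j k. j \<in> J \<Longrightarrow> k \<in> K \<Longrightarrow> \<beta> j k \<in> borel_measurable M"
    and bound: "spectral_AE M E (\<lambda>x. matrix_bound J K (\<lambda>j k. \<beta> j k x) C)"
  shows "cmod (\<Sum>j\<in>J. \<Sum>k\<in>K. cinner (spectral_integral M E (\<beta> j k) (\<eta> k)) (\<xi> j))
    \<le> C * L2_set (\<lambda>k. norm (\<eta> k)) K * L2_set (\<lambda>j. norm (\<xi> j)) J"
proof -
  obtain S where S: "S \<in> sets M" "E (space M - S) = 0"
    "\<And>x. x \<in> S \<Longrightarrow> matrix_bound J K (\<lambda>j k. \<beta> j k x) C"
    using spectral_AE_measurable_set[OF E bound] by metis
  have bdd: "spectral_AE M E (\<lambda>x. cmod (\<beta> j k x) \<le> C)" if "j \<in> J" "k \<in> K" for j k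
    using bound by (rule spectral_AE_mono) (use matrix_bound_entry[OF _ fin that] in blast)
  let ?B = "\<lambda>j k. spectral_integral M E (\<beta> j k)"
  \<comment> \<open>Replacing each entry by an operator within \<open>2 * \<epsilon>\<close> in norm
    costs at most \<open>\<epsilon> * Y\<close>.\<close>
  define Y where "Y = (\<Sum>j\<in>J. \<Sum>k\<in>K. 2 * norm (\<eta> k) * norm (\<xi> j))"
  have Y: "0 \<le> Y" unfolding Y_def by (intro sum_nonneg) simp
  have approx: "cmod (\<Sum>j\<in>J. \<Sum>k\<in>K. cinner (?B j k (\<eta> k)) (\<xi> j))
    \<le> C * L2_set (\<lambda>k. norm (\<eta> k)) K * L2_set (\<lambda>j. norm (\<xi> j)) J + \<epsilon> * Y" if \<epsilon>: "0 < \<epsilon>" for \<epsilon>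
  proof -
    obtain P where P: "finite P" "P \<subseteq> sets M" "disjoint P" "\<Union>P = S" "{} \<notin> P"
      "\<And>D x y i. D \<in> P \<Longrightarrow> x \<in> D \<Longrightarrow> y \<in> D \<Longrightarrow> i \<in> J \<times> K \<Longrightarrow>
        cmod ((case i of (j, k) \<Rightarrow> \<beta> j k) x - (case i of (j, k) \<Rightarrow> \<beta> j k) y) \<le> \<epsilon>"
    proof (rule finite_partition_almost_constant[of "J \<times> K" S M "\<lambda>(j, k). \<beta> j k" C \<epsilon>])
      show "cmod ((case i of (j, k) \<Rightarrow> \<beta> j k) x) \<le> C" if "i \<in> J \<times> K" "x \<in> S" for i x
        using matrix_bound_entry[OF S(3)[OF that(2)] fin] that(1) by auto
    qed (use fin S(1) \<beta> \<epsilon> in auto)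
    define p where "p = (\<lambda>D. SOME x::'a. x \<in> D)"
    have p: "p D \<in> D" if "D \<in> P" for D
      unfolding p_def using that P(5) by (metis some_in_eq)
    define A where "A = (\<lambda>j k. simple_operator E P (\<lambda>D. \<beta> j k (p D)))"
    have close: "norm (A j k - ?B j k) \<le> 2 * \<epsilon>" if jk: "j \<in> J" "k \<in> K" for j k
    proof (rule norm_le_numerical_radius)
      show "A j k - ?B j k \<in> bounded_operators"
        unfolding A_def
        by (intro bounded_operators_diff simple_operator_bounded_operators[OF E P(2)]
            spectral_integral_bounded_operators[OF E \<beta>[OF jk] bdd[OF jk]])
      fix u
      have "cmod (cinner (A j k u) u - integral\<^sup>L (scalar_measure M E u) (\<beta> j k))
        \<le> \<epsilon> * (norm u)\<^sup>2"
        unfolding A_def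
      proof (rule simple_operator_close[OF E P(1-3) _ \<beta>[OF jk] _ bdd[OF jk]])
        show "cmod (\<beta> j k (p D) - \<beta> j k x) \<le> \<epsilon>" if "D \<in> P" "x \<in> D" for D x
          using P(6)[OF that(1) p[OF that(1)] that(2), of "(j, k)"] jk by simp
      qed (simp add: P(4) S(2))
      then show "cmod (cinner ((A j k - ?B j k) u) u) \<le> \<epsilon> * (norm u)\<^sup>2"
        by (simp add: blinfun.diff_left cinner_diff_left cinner_spectral_integral[OF E \<beta>[OF jk] bdd[OF jk]])
    qed (use \<epsilon> in simp)
    have simple: "cmod (\<Sum>j\<in>J. \<Sum>k\<in>K. cinner (A j k (\<eta> k)) (\<xi> j))
      \<le> C * L2_set (\<lambda>k. norm (\<eta> k)) K * L2_set (\<lambda>j. norm (\<xi> j)) J"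
    proof -
      have "(\<Sum>j\<in>J. \<Sum>k\<in>K. cinner (A j k (\<eta> k)) (\<xi> j))
        = (\<Sum>j\<in>J. \<Sum>k\<in>K. \<Sum>D\<in>P. \<beta> j k (p D) * cinner (E D (\<eta> k)) (E D (\<xi> j)))"
        unfolding A_def cinner_simple_operator
        using P(2) by (intro sum.cong refl arg_cong2[of _ _ _ _ "(*)"] cinner_spectral_measure[OF E]) auto
      also have "\<dots> = (\<Sum>D\<in>P. \<Sum>j\<in>J. \<Sum>k\<in>K. \<beta> j k (p D) * cinner (E D (\<eta> k)) (E D (\<xi> j)))"
        by (subst (2) sum.swap, subst sum.swap) (rule refl)
      also have "cmod \<dots> \<le> C * L2_set (\<lambda>k. norm (\<eta> k)) K * L2_set (\<lambda>j. norm (\<xi> j)) J"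
      proof (rule matrix_bound_sum_le[OF _ \<open>0 \<le> C\<close>])
        fix D assume D: "D \<in> P"
        then have "p D \<in> S" using p P(4) by auto
        then show "cmod (\<Sum>j\<in>J. \<Sum>k\<in>K. \<beta> j k (p D) * cinner (E D (\<eta> k)) (E D (\<xi> j)))
          \<le> C * L2_set (\<lambda>k. norm (E D (\<eta> k))) K * L2_set (\<lambda>j. norm (E D (\<xi> j))) J"
          by (intro matrix_bound_cinner S(3) \<open>0 \<le> C\<close> fin)
      qed (intro sum_norm_spectral_measure_le[OF E P(1-3)])+
      finally show ?thesis .
    qed
    have "(\<Sum>j\<in>J. \<Sum>k\<in>K. cinner (?B j k (\<eta> k)) (\<xi> j))
      = (\<Sum>j\<in>J. \<Sum>k\<in>K. cinner (A j k (\<eta> k)) (\<xi> j))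
      - (\<Sum>j\<in>J. \<Sum>k\<in>K. cinner ((A j k - ?B j k) (\<eta> k)) (\<xi> j))"
      by (simp add: blinfun.diff_left cinner_diff_left sum_subtractf)
    moreover have "cmod (\<Sum>j\<in>J. \<Sum>k\<in>K. cinner ((A j k - ?B j k) (\<eta> k)) (\<xi> j)) \<le> \<epsilon> * Y"
      unfolding Y_def sum_distrib_left
    proof (intro sum_norm_le)
      fix j k assume jk: "j \<in> J" "k \<in> K"
      have "cmod (cinner ((A j k - ?B j k) (\<eta> k)) (\<xi> j))
        \<le> norm ((A j k - ?B j k) (\<eta> k)) * norm (\<xi> j)"
        by (rule cinner_Cauchy_Schwarz)
      also have "\<dots> \<le> (norm (A j k - ?B j k) * norm (\<eta> k)) * norm (\<xi> j)"
        by (intro mult_right_mono norm_blinfun) simp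
      also have "\<dots> \<le> ((2 * \<epsilon>) * norm (\<eta> k)) * norm (\<xi> j)"
        by (intro mult_right_mono close jk) simp_all
      finally show "cmod (cinner ((A j k - ?B j k) (\<eta> k)) (\<xi> j))
        \<le> \<epsilon> * (2 * norm (\<eta> k) * norm (\<xi> j))"
        by (simp add: mult_ac)
    qed
    ultimately show ?thesis
      using simple norm_triangle_ineq4 by (smt (verit))
  qed
  show ?thesis
  proof (rule field_le_epsilon)
    fix e :: real assume "0 < e"
    have "e / (Y + 1) * Y \<le> e"
      using Y \<open>0 < e\<close> by (simp add: field_simps)
    moreover have "0 < e / (Y + 1)"
      using Y \<open>0 < e\<close> by simp
    ultimately show "cmod (\<Sum>j\<in>J. \<Sum>k\<in>K. cinner (?B j k (\<eta> k)) (\<xi> j))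
      \<le> C * L2_set (\<lambda>k. norm (\<eta> k)) K * L2_set (\<lambda>j. norm (\<xi> j)) J + e"
      using approx[of "e / (Y + 1)"] by linarith
  qed
qed

lemma spectral_AE_bounded_component:
  assumes "spectral_AE M E (\<lambda>x. L2_set (\<lambda>j. cmod (\<alpha> j x)) J \<le> a)" "finite J" "j \<in> J"
  shows "spectral_AE M E (\<lambda>x. cmod (\<alpha> j x) \<le> a)"
  using assms(1)
proof (rule spectral_AE_mono)
  fix x assume "L2_set (\<lambda>j. cmod (\<alpha> j x)) J \<le> a"
  then show "cmod (\<alpha> j x) \<le> a"
    using member_le_L2_set[OF assms(2,3), of "\<lambda>j. cmod (\<alpha> j x)"] by simp
qed

text \<open>A finite family of functions is a matrix with one column or with one row, and
  Cauchy-Schwarz gives \<open>matrix_bound\<close> for both. The column is tested against its own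
  image of u, the row is applied to the adjoint images of u. Either way the square of the left-hand
  side is at most \<open>a * norm u\<close> times the left-hand side, which cancels.\<close>

lemma sum_norm_spectral_integral_le:
  fixes u :: "'h::complex_hilbert_space"
  assumes E: "spectral_measure M E" and fin: "finite J" and "0 \<le> a"
    and \<alpha>: "\<And>j. j \<in> J \<Longrightarrow> \<alpha> j \<in> borel_measurable M"
    and bound: "spectral_AE M E (\<lambda>x. L2_set (\<lambda>j. cmod (\<alpha> j x)) J \<le> a)"
  shows "L2_set (\<lambda>j. norm (spectral_integral M E (\<alpha> j) u)) J \<le> a * norm u" (is "?s \<le> _")
    and "L2_set (\<lambda>j. norm (adjoint_operator (spectral_integral M E (\<alpha> j)) u)) J \<le> a * norm u"
      (is "?t \<le> _")
proof -
  let ?A = "\<lambda>j. spectral_integral M E (\<alpha> j)"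
  have A: "?A j \<in> bounded_operators" if "j \<in> J" for j
    by (rule spectral_integral_bounded_operators[OF E \<alpha>[OF that] spectral_AE_bounded_component[OF bound fin that]])
  have pointwise: "matrix_bound J {()} (\<lambda>j k. \<alpha> j x) a" "matrix_bound {()} J (\<lambda>j k. \<alpha> k x) a"
    if x: "L2_set (\<lambda>j. cmod (\<alpha> j x)) J \<le> a" for x
  proof -
    have cs: "cmod (\<Sum>j\<in>J. \<alpha> j x * b j) \<le> a * L2_set (\<lambda>j. cmod (b j)) J" for b
    proof -
      have "cmod (\<Sum>j\<in>J. \<alpha> j x * b j) \<le> (\<Sum>j\<in>J. \<bar>cmod (\<alpha> j x)\<bar> * \<bar>cmod (b j)\<bar>)"
        by (rule sum_norm_le) (simp add: norm_mult)
      also have "\<dots> \<le> L2_set (\<lambda>j. cmod (\<alpha> j x)) J * L2_set (\<lambda>j. cmod (b j)) J"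
        by (rule L2_set_mult_ineq)
      also have "\<dots> \<le> a * L2_set (\<lambda>j. cmod (b j)) J"
        by (intro mult_right_mono x L2_set_nonneg)
      finally show ?thesis .
    qed
    show "matrix_bound J {()} (\<lambda>j k. \<alpha> j x) a"
      unfolding matrix_bound_def
    proof (intro allI)
      fix c :: "unit \<Rightarrow> complex" and d
      have "cmod (\<Sum>j\<in>J. \<alpha> j x * cnj (d j)) * cmod (c ()) \<le> (a * L2_set (\<lambda>j. cmod (d j)) J) * cmod (c ())"
        using cs[of "\<lambda>j. cnj (d j)"] by (intro mult_right_mono) simp_all
      then show "cmod (\<Sum>j\<in>J. \<Sum>k\<in>{()}. \<alpha> j x * c k * cnj (d j))
        \<le> a * L2_set (\<lambda>k. cmod (c k)) {()} * L2_set (\<lambda>j. cmod (d j)) J"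
        by (simp add: mult_ac sum_distrib_left flip: norm_mult)
    qed
    show "matrix_bound {()} J (\<lambda>j k. \<alpha> k x) a"
      unfolding matrix_bound_def
    proof (intro allI)
      fix c :: "unit \<Rightarrow> complex" and d
      have "cmod (\<Sum>j\<in>J. \<alpha> j x * d j) * cmod (cnj (c ())) \<le> (a * L2_set (\<lambda>j. cmod (d j)) J) * cmod (cnj (c ()))"
        using cs[of d] by (intro mult_right_mono) simp_all
      moreover have "(\<Sum>j\<in>{()}. \<Sum>k\<in>J. \<alpha> k x * d k * cnj (c j)) = (\<Sum>j\<in>J. \<alpha> j x * d j) * cnj (c ())"
        by (simp add: sum_distrib_right)
      ultimately show "cmod (\<Sum>j\<in>{()}. \<Sum>k\<in>J. \<alpha> k x * d k * cnj (c j))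
        \<le> a * L2_set (\<lambda>k. cmod (d k)) J * L2_set (\<lambda>j. cmod (c j)) {()}"
        by (simp add: norm_mult)
    qed
  qed
  have cancel: "s \<le> c" if "s\<^sup>2 \<le> c * s" "0 \<le> s" "0 \<le> c" for s c :: real
    using that by (cases "s = 0") (auto simp: power2_eq_square)
  have self: "cinner v v = of_real ((norm v)\<^sup>2)" for v :: 'h
    by (rule cinner_self)
  have "cmod (\<Sum>j\<in>J. \<Sum>k\<in>{()}. cinner (?A j u) (?A j u))
    \<le> a * L2_set (\<lambda>k. norm u) {()} * ?s"
    by (rule spectral_integral_matrix_bound[OF E fin _ \<open>0 \<le> a\<close> \<alpha>])
      (use spectral_AE_mono[OF bound pointwise(1)] in simp_all)
  moreover have "(\<Sum>j\<in>J. \<Sum>k\<in>{()}. cinner (?A j u) (?A j u)) = of_real (?s\<^sup>2)"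
    by (simp add: L2_set_power2 self del: of_real_power)
  ultimately have "cmod (of_real (?s\<^sup>2)) \<le> a * L2_set (\<lambda>k. norm u) {()} * ?s"
    by (simp only:)
  then have "?s\<^sup>2 \<le> (a * norm u) * ?s"
    unfolding norm_of_real by simp
  then show "?s \<le> a * norm u"
    by (rule cancel) (use \<open>0 \<le> a\<close> in \<open>simp_all add: L2_set_nonneg\<close>)
  let ?\<eta> = "\<lambda>j. (adjoint_operator (?A j)) u"
  have "cmod (\<Sum>k\<in>{()}. \<Sum>j\<in>J. cinner (?A j (?\<eta> j)) u)
    \<le> a * ?t * L2_set (\<lambda>k. norm u) {()}"
    by (rule spectral_integral_matrix_bound[OF E _ fin \<open>0 \<le> a\<close> \<alpha>])
      (use spectral_AE_mono[OF bound pointwise(2)] in simp_all)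
  moreover have "(\<Sum>k\<in>{()}. \<Sum>j\<in>J. cinner (?A j (?\<eta> j)) u) = of_real (?t\<^sup>2)"
    by (simp add: L2_set_power2 self A flip: cinner_adjoint_right del: of_real_power)
  ultimately have "cmod (of_real (?t\<^sup>2)) \<le> a * ?t * L2_set (\<lambda>k. norm u) {()}"
    by (simp only:)
  then have "?t\<^sup>2 \<le> (a * norm u) * ?t"
    unfolding norm_of_real by (simp add: mult_ac)
  then show "?t \<le> a * norm u"
    by (rule cancel) (use \<open>0 \<le> a\<close> in \<open>simp_all add: L2_set_nonneg\<close>)
qed

subsection \<open>Convergence of the double sums\<close>

lemma L2_set_tail:
  fixes x :: "nat \<Rightarrow> real"
  assumes bound: "\<And>K. finite K \<Longrightarrow> L2_set x K \<le> X" and "0 < \<epsilon>"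
  obtains N where "\<And>n. L2_set x {N<..n} \<le> \<epsilon>"
proof -
  have "summable (\<lambda>k. (x k)\<^sup>2)"
  proof (rule summableI_nonneg_bounded[of _ "X\<^sup>2"])
    show "(\<Sum>k<n. (x k)\<^sup>2) \<le> X\<^sup>2" for n
      unfolding L2_set_power2[symmetric] by (intro power_mono bound L2_set_nonneg) simp
  qed simp
  then obtain N where N: "\<And>m n. m \<ge> N \<Longrightarrow> norm (sum (\<lambda>k. (x k)\<^sup>2) {m..<n}) < \<epsilon>\<^sup>2"
    using \<open>0 < \<epsilon>\<close> unfolding summable_Cauchy by (metis zero_less_power)
  show thesis
  proof (rule that[of N])
    fix n
    have "{N<..n} = {Suc N..<Suc n}" by auto
    then have "(\<Sum>k\<in>{N<..n}. (x k)\<^sup>2) < \<epsilon>\<^sup>2"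
      using N[of "Suc N" "Suc n"] by (simp add: sum_nonneg)
    then have "(L2_set x {N<..n})\<^sup>2 \<le> \<epsilon>\<^sup>2"
      by (simp add: L2_set_power2)
    then show "L2_set x {N<..n} \<le> \<epsilon>"
      by (rule power2_le_imp_le) (use \<open>0 < \<epsilon>\<close> in simp)
  qed
qed

text \<open>The terms need not be absolutely summable; only rectangular blocks are controlled. A
  difference of two partial sums consists of two blocks, each with one index beyond N, so one factor
  in its bound is the tail of a square summable sequence.\<close>

lemma double_sum_convergent:
  fixes s :: "nat \<Rightarrow> nat \<Rightarrow> complex" and x y :: "nat \<Rightarrow> real"
  assumes s: "\<And>J K. finite J \<Longrightarrow> finite K \<Longrightarrow> cmod (\<Sum>j\<in>J. \<Sum>k\<in>K. s j k) \<le> b * L2_set x K * L2_set y J"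
    and X: "\<And>K. finite K \<Longrightarrow> L2_set x K \<le> X" and Y: "\<And>J. finite J \<Longrightarrow> L2_set y J \<le> Y" and "0 \<le> b"
  shows "\<exists>L. ((\<lambda>(m, n). \<Sum>j\<le>m. \<Sum>k\<le>n. s j k) \<longlongrightarrow> L) (sequentially \<times>\<^sub>F sequentially)"
proof -
  define S where "S = (\<lambda>m n. \<Sum>j\<le>m. \<Sum>k\<le>n. s j k)"
  have X0: "0 \<le> X" and Y0: "0 \<le> Y"
    using X[of "{}"] Y[of "{}"] by simp_all
  have tail: "\<exists>N. \<forall>m\<ge>N. \<forall>n\<ge>N. cmod (S m n - S N N) \<le> e" if "0 < e" for e
  proof -
    \<comment> \<open>The two blocks below are bounded by \<open>b * \<epsilon> * Y\<close> and
      \<open>b * X * \<epsilon>\<close>; the summand 1 avoids a division by 0.\<close>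
    define \<epsilon> where "\<epsilon> = e / (b * X + b * Y + 1)"
    have pos: "0 < b * X + b * Y + 1"
      using \<open>0 \<le> b\<close> X0 Y0 by (simp add: add_nonneg_pos)
    then have \<epsilon>: "0 < \<epsilon>"
      using that by (simp add: \<epsilon>_def)
    obtain N1 where N1: "\<And>n. L2_set x {N1<..n} \<le> \<epsilon>"
      using L2_set_tail[OF X \<epsilon>] by metis
    obtain N2 where N2: "\<And>n. L2_set y {N2<..n} \<le> \<epsilon>"
      using L2_set_tail[OF Y \<epsilon>] by metis
    define N where "N = max N1 N2"
    have mono: "L2_set f A \<le> L2_set f B" if "finite B" "A \<subseteq> B" for f :: "nat \<Rightarrow> real" and A B
      unfolding L2_set_def by (intro real_sqrt_le_mono sum_mono2 that) simp
    have Nx: "L2_set x {N<..n} \<le> \<epsilon>" and Ny: "L2_set y {N<..n} \<le> \<epsilon>" for n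
      by (rule order_trans[OF mono N1[of n]], simp, force simp: N_def)
        (rule order_trans[OF mono N2[of n]], simp, force simp: N_def)
    have "cmod (S m n - S N N) \<le> e" if "m \<ge> N" "n \<ge> N" for m n
    proof -
      have split: "(\<Sum>i\<le>p. f i) = (\<Sum>i\<le>N. f i) + (\<Sum>i\<in>{N<..p}. f i)" if "p \<ge> N" for p and f :: "nat \<Rightarrow> complex"
      proof -
        have "{..p} = {..N} \<union> {N<..p}" using that by auto
        then show ?thesis
          by (simp only:) (rule sum.union_disjoint, auto)
      qed
      have "S m n - S N N = (\<Sum>j\<le>N. \<Sum>k\<in>{N<..n}. s j k) + (\<Sum>j\<in>{N<..m}. \<Sum>k\<le>n. s j k)"
        unfolding S_def split[OF that(1)] by (simp add: split[OF that(2)] sum.distrib)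
      also have "cmod \<dots> \<le> b * L2_set x {N<..n} * L2_set y {..N} + b * L2_set x {..n} * L2_set y {N<..m}"
        by (intro order_trans[OF norm_triangle_ineq] add_mono s) auto
      also have "\<dots> \<le> b * \<epsilon> * Y + b * X * \<epsilon>"
        by (intro add_mono mult_mono Nx Ny X Y mult_nonneg_nonneg L2_set_nonneg)
          (use \<epsilon> X0 Y0 \<open>0 \<le> b\<close> in auto)
      also have "\<dots> \<le> \<epsilon> * (b * X + b * Y + 1)"
        using \<epsilon> by (simp add: algebra_simps)
      also have "\<dots> = e"
        using pos by (simp add: \<epsilon>_def)
      finally show ?thesis .
    qed
    then show ?thesis by blast
  qed
  \<comment> \<open>The limit is found along the diagonal and then recognized as the double
    limit.\<close>
  have "Cauchy (\<lambda>n. S n n)"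
  proof (rule metric_CauchyI)
    fix e :: real assume "0 < e"
    then obtain N where N: "\<forall>m\<ge>N. \<forall>n\<ge>N. cmod (S m n - S N N) \<le> e / 3"
      using tail[of "e / 3"] by auto
    have "dist (S m m) (S n n) < e" if "m \<ge> N" "n \<ge> N" for m n
    proof -
      have "dist (S m m) (S N N) \<le> e / 3" "dist (S n n) (S N N) \<le> e / 3"
        using N that by (auto simp: dist_norm)
      then show ?thesis
        using dist_triangle2[of "S m m" "S n n" "S N N"] \<open>0 < e\<close> by argo
    qed
    then show "\<exists>N. \<forall>m\<ge>N. \<forall>n\<ge>N. dist (S m m) (S n n) < e" by blast
  qed
  then obtain L where L: "(\<lambda>n. S n n) \<longlonglongrightarrow> L"
    by (auto simp: Cauchy_convergent_iff convergent_def)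
  have "((\<lambda>(m, n). S m n) \<longlongrightarrow> L) (sequentially \<times>\<^sub>F sequentially)"
  proof (rule tendstoI)
    fix e :: real assume "0 < e"
    then obtain N where N: "\<forall>m\<ge>N. \<forall>n\<ge>N. cmod (S m n - S N N) \<le> e / 3"
      using tail[of "e / 3"] by auto
    have "dist L (S N N) \<le> e / 3"
    proof (rule LIMSEQ_le_const2)
      show "(\<lambda>n. dist (S n n) (S N N)) \<longlonglongrightarrow> dist L (S N N)"
        by (intro tendsto_dist L tendsto_const)
      show "\<exists>N'. \<forall>n\<ge>N'. dist (S n n) (S N N) \<le> e / 3"
        using N by (auto simp: dist_norm)
    qed
    have "dist (S m n) L < e" if "m \<ge> N" "n \<ge> N" for m n
    proof -
      have "dist (S m n) (S N N) \<le> e / 3"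
        using N that by (auto simp: dist_norm)
      then show ?thesis
        using dist_triangle2[of "S m n" L "S N N"] \<open>dist L (S N N) \<le> e / 3\<close> \<open>0 < e\<close> by argo
    qed
    then show "\<forall>\<^sub>F x in sequentially \<times>\<^sub>F sequentially. dist (case x of (m, n) \<Rightarrow> S m n) L < e"
      unfolding eventually_prod_filter eventually_sequentially
      by (intro exI[of _ "\<lambda>m. m \<ge> N"]) auto
  qed
  then show ?thesis
    unfolding S_def by blast
qed

lemma filterlim_diagonal: "filterlim (\<lambda>n. (n, n)) (sequentially \<times>\<^sub>F sequentially) sequentially"
  by (intro filterlim_Pair filterlim_ident)


subsection \<open>Triple operator integrals along a representation\<close>

text \<open>Real constants and bounds on finite sections, each off one null set, replace the
  extended norms. That two such families represent the same function enters only in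
  \<open>two_representations\<close>.\<close>

locale bounded_representation =
  fixes M1 :: "'x measure" and E1 :: "'x set \<Rightarrow> 'h::complex_hilbert_space \<Rightarrow>\<^sub>L 'h"
    and M2 :: "'y measure" and E2 :: "'y set \<Rightarrow> 'h \<Rightarrow>\<^sub>L 'h"
    and M3 :: "'z measure" and E3 :: "'z set \<Rightarrow> 'h \<Rightarrow>\<^sub>L 'h"
    and \<alpha> :: "nat \<Rightarrow> 'x \<Rightarrow> complex" and \<beta> :: "nat \<Rightarrow> nat \<Rightarrow> 'y \<Rightarrow> complex" and \<gamma> :: "nat \<Rightarrow> 'z \<Rightarrow> complex"
    and a b c :: real
  assumes E: "spectral_measure M1 E1" "spectral_measure M2 E2" "spectral_measure M3 E3"
    and meas: "\<And>j. \<alpha> j \<in> borel_measurable M1" "\<And>j k. \<beta> j k \<in> borel_measurable M2"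
      "\<And>k. \<gamma> k \<in> borel_measurable M3"
    and nonneg: "0 \<le> a" "0 \<le> b" "0 \<le> c"
    and bound1: "spectral_AE M1 E1 (\<lambda>x. \<forall>J. finite J \<longrightarrow> L2_set (\<lambda>j. cmod (\<alpha> j x)) J \<le> a)"
    and bound2: "spectral_AE M2 E2 (\<lambda>x. \<forall>J K. finite J \<longrightarrow> finite K \<longrightarrow> matrix_bound J K (\<lambda>j k. \<beta> j k x) b)"
    and bound3: "spectral_AE M3 E3 (\<lambda>x. \<forall>K. finite K \<longrightarrow> L2_set (\<lambda>k. cmod (\<gamma> k x)) K \<le> c)"
begin

definition A :: "nat \<Rightarrow> 'h \<Rightarrow>\<^sub>L 'h" where "A j = spectral_integral M1 E1 (\<alpha> j)"
definition B :: "nat \<Rightarrow> nat \<Rightarrow> 'h \<Rightarrow>\<^sub>L 'h" where "B j k = spectral_integral M2 E2 (\<beta> j k)"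
definition C :: "nat \<Rightarrow> 'h \<Rightarrow>\<^sub>L 'h" where "C k = spectral_integral M3 E3 (\<gamma> k)"

lemma entry_bounds:
  shows "spectral_AE M1 E1 (\<lambda>x. cmod (\<alpha> j x) \<le> a)" "spectral_AE M2 E2 (\<lambda>x. cmod (\<beta> i k x) \<le> b)"
    "spectral_AE M3 E3 (\<lambda>x. cmod (\<gamma> l x) \<le> c)"
proof -
  show "spectral_AE M1 E1 (\<lambda>x. cmod (\<alpha> j x) \<le> a)"
    using bound1 by (rule spectral_AE_mono) (auto dest!: spec[of _ "{j}"])
  show "spectral_AE M2 E2 (\<lambda>x. cmod (\<beta> i k x) \<le> b)"
    using bound2
  proof (rule spectral_AE_mono)
    fix x assume "\<forall>J K. finite J \<longrightarrow> finite K \<longrightarrow> matrix_bound J K (\<lambda>j k. \<beta> j k x) b"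
    then have "matrix_bound {i} {k} (\<lambda>j k. \<beta> j k x) b" by simp
    then show "cmod (\<beta> i k x) \<le> b"
      by (rule matrix_bound_entry) simp_all
  qed
  show "spectral_AE M3 E3 (\<lambda>x. cmod (\<gamma> l x) \<le> c)"
    using bound3 by (rule spectral_AE_mono) (auto dest!: spec[of _ "{l}"])
qed

lemma bounded_operators_ABC: "A j \<in> bounded_operators" "B i k \<in> bounded_operators" "C l \<in> bounded_operators"
  unfolding A_def B_def C_def
  by (rule spectral_integral_bounded_operators[OF E(1) meas(1) entry_bounds(1)]
      spectral_integral_bounded_operators[OF E(2) meas(2) entry_bounds(2)]
      spectral_integral_bounded_operators[OF E(3) meas(3) entry_bounds(3)])+

lemma column_bounds:
  assumes "finite J"
  shows "L2_set (\<lambda>j. norm (adjoint_operator (A j) u)) J \<le> a * norm u"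
    and "L2_set (\<lambda>j. norm (A j u)) J \<le> a * norm u"
    and "L2_set (\<lambda>k. norm (C k u)) J \<le> c * norm u"
    and "L2_set (\<lambda>k. norm (adjoint_operator (C k) u)) J \<le> c * norm u"
proof -
  have 1: "spectral_AE M1 E1 (\<lambda>x. L2_set (\<lambda>j. cmod (\<alpha> j x)) J \<le> a)"
    using bound1 by (rule spectral_AE_mono) (use assms in blast)
  have 3: "spectral_AE M3 E3 (\<lambda>x. L2_set (\<lambda>j. cmod (\<gamma> j x)) J \<le> c)"
    using bound3 by (rule spectral_AE_mono) (use assms in blast)
  show "L2_set (\<lambda>j. norm (adjoint_operator (A j) u)) J \<le> a * norm u"
    "L2_set (\<lambda>j. norm (A j u)) J \<le> a * norm u"
    unfolding A_def using sum_norm_spectral_integral_le[OF E(1) assms nonneg(1) meas(1) 1] by auto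
  show "L2_set (\<lambda>k. norm (C k u)) J \<le> c * norm u"
    "L2_set (\<lambda>k. norm (adjoint_operator (C k) u)) J \<le> c * norm u"
    unfolding C_def using sum_norm_spectral_integral_le[OF E(3) assms nonneg(3) meas(3) 3] by auto
qed

lemma matrix_bound_B:
  assumes "finite J" "finite K"
  shows "cmod (\<Sum>j\<in>J. \<Sum>k\<in>K. cinner (B j k (\<eta> k)) (\<xi> j))
    \<le> b * L2_set (\<lambda>k. norm (\<eta> k)) K * L2_set (\<lambda>j. norm (\<xi> j)) J"
  unfolding B_def
  by (rule spectral_integral_matrix_bound[OF E(2) assms nonneg(2) meas(2) spectral_AE_mono[OF bound2]])
    (use assms in blast)

section \<open>The weak limit of the partial sums\<close>

definition \<xi> :: "('h \<Rightarrow>\<^sub>L 'h) \<Rightarrow> 'h \<Rightarrow> nat \<Rightarrow> 'h" where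
  "\<xi> T v j = (adjoint_operator T) (adjoint_operator (A j) v)"

definition \<eta> :: "('h \<Rightarrow>\<^sub>L 'h) \<Rightarrow> 'h \<Rightarrow> nat \<Rightarrow> 'h" where
  "\<eta> R u k = R (C k u)"

lemma cinner_term:
  assumes "T \<in> bounded_operators"
  shows "cinner ((A j o\<^sub>L T o\<^sub>L B j k o\<^sub>L R o\<^sub>L C k) u) v = cinner (B j k (\<eta> R u k)) (\<xi> T v j)"
  by (simp add: \<xi>_def \<eta>_def cinner_adjoint_right assms bounded_operators_ABC)

lemma L2_set_blinfun_le:
  fixes T :: "'h \<Rightarrow>\<^sub>L 'h"
  shows "L2_set (\<lambda>j. norm (T (x j))) J \<le> norm T * L2_set (\<lambda>j. norm (x j)) J"
proof -
  have "L2_set (\<lambda>j. norm (T (x j))) J \<le> L2_set (\<lambda>j. norm T * norm (x j)) J"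
    by (intro L2_set_mono norm_blinfun) simp
  also have "\<dots> = norm T * L2_set (\<lambda>j. norm (x j)) J"
    by (simp add: L2_set_right_distrib)
  finally show ?thesis .
qed

lemma L2_set_\<eta>_le: "finite K \<Longrightarrow> L2_set (\<lambda>k. norm (\<eta> R u k)) K \<le> norm R * (c * norm u)"
  unfolding \<eta>_def by (rule order_trans[OF L2_set_blinfun_le]) (intro mult_left_mono column_bounds, auto)

lemma L2_set_\<xi>_le: "finite J \<Longrightarrow> L2_set (\<lambda>j. norm (\<xi> T v j)) J \<le> norm (adjoint_operator T) * (a * norm v)"
  unfolding \<xi>_def by (rule order_trans[OF L2_set_blinfun_le]) (intro mult_left_mono column_bounds, auto)

definition partial_sum :: "('h \<Rightarrow>\<^sub>L 'h) \<Rightarrow> ('h \<Rightarrow>\<^sub>L 'h) \<Rightarrow> nat \<Rightarrow> nat \<Rightarrow> 'h \<Rightarrow>\<^sub>L 'h" where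
  "partial_sum T R m n = (\<Sum>j\<le>m. \<Sum>k\<le>n. A j o\<^sub>L T o\<^sub>L B j k o\<^sub>L R o\<^sub>L C k)"

lemma cinner_partial_sum:
  "T \<in> bounded_operators \<Longrightarrow> cinner (partial_sum T R m n u) v
    = (\<Sum>j\<le>m. \<Sum>k\<le>n. cinner (B j k (\<eta> R u k)) (\<xi> T v j))"
  by (simp add: partial_sum_def blinfun.sum_left cinner_sum_left cinner_term del: blinfun_apply_blinfun_compose)

lemma cinner_partial_sum_le:
  "T \<in> bounded_operators \<Longrightarrow> cmod (cinner (partial_sum T R m n u) v)
    \<le> b * L2_set (\<lambda>k. norm (\<eta> R u k)) {..n} * L2_set (\<lambda>j. norm (\<xi> T v j)) {..m}"
  unfolding cinner_partial_sum by (rule matrix_bound_B) simp_all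

text \<open>For fixed u and v the families \<open>\<eta> R u\<close> and \<open>\<xi> T v\<close>
  have bounded square sums, so \<open>double_sum_convergent\<close> applies. The limits form a
  bounded sesquilinear form, which an operator represents.\<close>

lemma triple_operator_integral_exists:
  assumes T: "T \<in> bounded_operators" and R: "R \<in> bounded_operators"
  obtains W where "W \<in> bounded_operators"
    "wot_double_sum (\<lambda>j k. A j o\<^sub>L T o\<^sub>L B j k o\<^sub>L R o\<^sub>L C k) W"
proof -
  have "\<exists>L. ((\<lambda>(m, n). cinner (partial_sum T R m n u) v) \<longlongrightarrow> L) (sequentially \<times>\<^sub>F sequentially)" for u v
    unfolding cinner_partial_sum[OF T]
    by (rule double_sum_convergent[OF matrix_bound_B L2_set_\<eta>_le L2_set_\<xi>_le nonneg(2)])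
  then obtain F where F: "\<And>u v. ((\<lambda>(m, n). cinner (partial_sum T R m n u) v) \<longlongrightarrow> F u v)
    (sequentially \<times>\<^sub>F sequentially)"
    by metis
  have nontrivial: "sequentially \<times>\<^sub>F sequentially \<noteq> bot"
    by (simp add: prod_filter_eq_bot)
  have PS: "partial_sum T R m n \<in> bounded_operators" for m n
    unfolding partial_sum_def
    by (intro bounded_operators_sum bounded_operators_compose bounded_operators_ABC T R)
  have sesq: "sesquilinear F"
    by (rule sesquilinear_tendsto[where F = "\<lambda>p u v. case p of (m, n) \<Rightarrow> cinner (partial_sum T R m n u) v"
        and l = "sequentially \<times>\<^sub>F sequentially"])
      (use F nontrivial in \<open>auto intro: sesquilinear_cinner[OF PS]\<close>)
  define K where "K = b * (norm R * c) * (norm (adjoint_operator T) * a)"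
  have K0: "0 \<le> K" using nonneg by (simp add: K_def)
  have bound: "cmod (F u v) \<le> K * norm u * norm v" for u v
  proof (rule tendsto_upperbound[OF tendsto_norm[OF F] _ nontrivial])
    have "cmod (cinner (partial_sum T R m n u) v) \<le> K * norm u * norm v" for m n
    proof -
      have "b * L2_set (\<lambda>k. norm (\<eta> R u k)) {..n} * L2_set (\<lambda>j. norm (\<xi> T v j)) {..m}
        \<le> b * (norm R * (c * norm u)) * (norm (adjoint_operator T) * (a * norm v))"
        by (intro mult_mono L2_set_\<eta>_le L2_set_\<xi>_le mult_nonneg_nonneg L2_set_nonneg) (use nonneg in auto)
      then show ?thesis
        using cinner_partial_sum_le[OF T, of R m n u v] by (simp add: K_def mult_ac)
    qed
    then show "\<forall>\<^sub>F p in sequentially \<times>\<^sub>F sequentially.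
      cmod (case p of (m, n) \<Rightarrow> cinner (partial_sum T R m n u) v) \<le> K * norm u * norm v"
      by (intro always_eventually) auto
  qed
  obtain W where W: "W \<in> bounded_operators" "\<And>u v. cinner (W u) v = F u v"
    using bounded_sesquilinear_operator[OF sesq K0 bound] by metis
  show thesis
    by (rule that[OF W(1)]) (use F in \<open>simp add: wot_double_sum_def W(2) partial_sum_def\<close>)
qed

text \<open>Telescoping: passing from the pair (h, x) to (P h, P x) costs the pair (h - P h, x) plus
  the pair (P h, x - P x). The differences vanish up to index N and are dominated by the tails
  beyond it. Apart from \<epsilon>, X and Y the bound does not involve n, so P can be fixed before n
  tends to infinity.\<close>

lemma projection_approximation:
  fixes h x :: "nat \<Rightarrow> 'h" and P :: "'h \<Rightarrow> 'h"
  assumes P: "\<And>x. norm (x - P x) \<le> norm x" "\<And>x. norm (P x) \<le> norm x"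
    and \<eta>0: "\<And>k. k \<le> N \<Longrightarrow> P (h k) = h k" and \<xi>0: "\<And>j. j \<le> N \<Longrightarrow> P (x j) = x j"
    and \<eta>\<epsilon>: "L2_set (\<lambda>k. norm (h k)) {N<..n} \<le> \<epsilon>" and \<xi>\<epsilon>: "L2_set (\<lambda>j. norm (x j)) {N<..n} \<le> \<epsilon>"
    and X: "L2_set (\<lambda>k. norm (h k)) {..n} \<le> X" and Y: "L2_set (\<lambda>j. norm (x j)) {..n} \<le> Y"
  shows "cmod ((\<Sum>j\<le>n. \<Sum>k\<le>n. cinner (B j k (h k)) (x j))
    - (\<Sum>j\<le>n. \<Sum>k\<le>n. cinner (B j k (P (h k))) (P (x j)))) \<le> b * \<epsilon> * (X + Y)"
proof -
  have small: "L2_set (\<lambda>k. norm (f k - P (f k))) {..n} \<le> \<epsilon>"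
    if f: "\<And>k. k \<le> N \<Longrightarrow> P (f k) = f k" "L2_set (\<lambda>k. norm (f k)) {N<..n} \<le> \<epsilon>" for f
  proof -
    have "(\<Sum>k\<le>n. (norm (f k - P (f k)))\<^sup>2) = (\<Sum>k\<in>{N<..n}. (norm (f k - P (f k)))\<^sup>2)"
      by (rule sum.mono_neutral_right) (use f(1) in \<open>auto simp: not_less\<close>)
    also have "\<dots> \<le> (\<Sum>k\<in>{N<..n}. (norm (f k))\<^sup>2)"
      by (intro sum_mono power_mono P(1)) simp
    finally show ?thesis
      using f(2) unfolding L2_set_def by (meson order_trans real_sqrt_le_mono)
  qed
  have \<epsilon>: "0 \<le> \<epsilon>" using \<eta>\<epsilon> L2_set_nonneg order_trans by blast
  have "(\<Sum>j\<le>n. \<Sum>k\<le>n. cinner (B j k (h k)) (x j))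
    - (\<Sum>j\<le>n. \<Sum>k\<le>n. cinner (B j k (P (h k))) (P (x j)))
    = (\<Sum>j\<le>n. \<Sum>k\<le>n. cinner (B j k (h k - P (h k))) (x j))
    + (\<Sum>j\<le>n. \<Sum>k\<le>n. cinner (B j k (P (h k))) (x j - P (x j)))"
    unfolding sum.distrib[symmetric] sum_subtractf[symmetric]
    by (intro sum.cong refl) (simp add: blinfun.diff_right cinner_diff_left cinner_diff_right)
  also have "cmod \<dots> \<le> b * L2_set (\<lambda>k. norm (h k - P (h k))) {..n} * L2_set (\<lambda>j. norm (x j)) {..n}
    + b * L2_set (\<lambda>k. norm (P (h k))) {..n} * L2_set (\<lambda>j. norm (x j - P (x j))) {..n}"
    by (intro order_trans[OF norm_triangle_ineq] add_mono matrix_bound_B) simp_all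
  also have "\<dots> \<le> b * \<epsilon> * Y + b * X * \<epsilon>"
  proof (intro add_mono mult_mono small Y mult_nonneg_nonneg L2_set_nonneg)
    show "L2_set (\<lambda>k. norm (P (h k))) {..n} \<le> X"
      by (rule order_trans[OF L2_set_mono X]) (simp_all add: P(2))
    then show "0 \<le> X" using L2_set_nonneg order_trans by blast
  qed (use nonneg \<epsilon> \<eta>0 \<xi>0 \<eta>\<epsilon> \<xi>\<epsilon> in auto)
  also have "\<dots> = b * \<epsilon> * (X + Y)"
    by (simp add: algebra_simps)
  finally show ?thesis .
qed

end

subsection \<open>Independence of the representation\<close>

lemma (in finite_measure) integral_tendsto_0:
  fixes D :: "nat \<Rightarrow> 'a \<Rightarrow> complex"
  assumes "\<And>n. D n \<in> borel_measurable M" "AE x in M. \<forall>n. cmod (D n x) \<le> K"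
    and "AE x in M. (\<lambda>n. D n x) \<longlonglongrightarrow> 0"
  shows "(\<lambda>n. integral\<^sup>L M (D n)) \<longlonglongrightarrow> 0"
proof -
  have "(\<lambda>n. integral\<^sup>L M (D n)) \<longlonglongrightarrow> integral\<^sup>L M (\<lambda>x. 0)"
    by (rule integral_dominated_convergence[where w = "\<lambda>_. K"]) (use assms in auto)
  then show ?thesis by simp
qed

context bounded_representation
begin

text \<open>The sum is the form of the matrix \<open>\<beta> j k x2\<close> at \<gamma> and the
  conjugate of \<alpha>. The bound supplies the dominating constants in
  \<open>diagonal_forms_tendsto_0\<close>.\<close>

lemma trilinear_sum_le:
  assumes "L2_set (\<lambda>j. cmod (\<alpha> j x1)) J \<le> a" "matrix_bound J K (\<lambda>j k. \<beta> j k x2) b"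
    "L2_set (\<lambda>k. cmod (\<gamma> k x3)) K \<le> c"
  shows "cmod (\<Sum>j\<in>J. \<Sum>k\<in>K. \<alpha> j x1 * \<beta> j k x2 * \<gamma> k x3) \<le> b * c * a"
proof -
  have "(\<Sum>j\<in>J. \<Sum>k\<in>K. \<alpha> j x1 * \<beta> j k x2 * \<gamma> k x3)
    = (\<Sum>j\<in>J. \<Sum>k\<in>K. \<beta> j k x2 * \<gamma> k x3 * cnj (cnj (\<alpha> j x1)))"
    by (intro sum.cong refl) (simp add: mult_ac)
  also have "cmod \<dots> \<le> b * L2_set (\<lambda>k. cmod (\<gamma> k x3)) K * L2_set (\<lambda>j. cmod (cnj (\<alpha> j x1))) J"
    by (rule matrix_boundD[OF assms(2)])
  also have "\<dots> \<le> b * c * a"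
    using assms nonneg by (intro mult_mono) (auto intro: L2_set_nonneg)
  finally show ?thesis .
qed

lemma integrable_entries:
  "integrable (scalar_measure M1 E1 x) (\<alpha> j)" "integrable (scalar_measure M2 E2 y) (\<beta> i k)"
  "integrable (scalar_measure M3 E3 z) (\<gamma> l)"
  by (rule finite_measure.integrable_AE_bounded[OF finite_measure_scalar_measure[OF E(1)] _ spectral_AE_imp_AE[OF E(1) entry_bounds(1)]]
      finite_measure.integrable_AE_bounded[OF finite_measure_scalar_measure[OF E(2)] _ spectral_AE_imp_AE[OF E(2) entry_bounds(2)]]
      finite_measure.integrable_AE_bounded[OF finite_measure_scalar_measure[OF E(3)] _ spectral_AE_imp_AE[OF E(3) entry_bounds(3)]];
      simp add: borel_measurable_scalar_measure meas)+

lemma cinner_ABC_self: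
  "cinner (A j x) x = integral\<^sup>L (scalar_measure M1 E1 x) (\<alpha> j)"
  "cinner (B i k x) x = integral\<^sup>L (scalar_measure M2 E2 x) (\<beta> i k)"
  "cinner (C l x) x = integral\<^sup>L (scalar_measure M3 E3 x) (\<gamma> l)"
  unfolding A_def B_def C_def
  by (rule cinner_spectral_integral[OF E(1) meas(1) entry_bounds(1)]
      cinner_spectral_integral[OF E(2) meas(2) entry_bounds(2)]
      cinner_spectral_integral[OF E(3) meas(3) entry_bounds(3)])+

end

text \<open>With six independent vectors the expression is sesquilinear in each of the pairs (p, q),
  (s, t) and (u, v), so that polarization can treat one pair after another.\<close>

definition (in bounded_representation) trilinear_form :: "nat \<Rightarrow> 'h \<Rightarrow> 'h \<Rightarrow> 'h \<Rightarrow> 'h \<Rightarrow> 'h \<Rightarrow> 'h \<Rightarrow> complex" where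
  "trilinear_form n p q s t u v = (\<Sum>j\<le>n. \<Sum>k\<le>n. cinner (A j p) q
    * cinner (B j k s) t * cinner (C k u) v)"

text \<open>
  The two representations of the same function are compared through their difference, so that the
  limit in each application of dominated convergence is \<open>0\<close> and its measurability is trivial.
\<close>

locale two_representations =
  r: bounded_representation M1 E1 M2 E2 M3 E3 \<alpha> \<beta> \<gamma> a b c +
  r': bounded_representation M1 E1 M2 E2 M3 E3 \<alpha>' \<beta>' \<gamma>' a' b' c'
  for M1 :: "'x measure" and E1 :: "'x set \<Rightarrow> 'h::complex_hilbert_space \<Rightarrow>\<^sub>L 'h"
    and M2 :: "'y measure" and E2 :: "'y set \<Rightarrow> 'h \<Rightarrow>\<^sub>L 'h"
    and M3 :: "'z measure" and E3 :: "'z set \<Rightarrow> 'h \<Rightarrow>\<^sub>L 'h"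
    and \<alpha> \<beta> \<gamma> a b c \<alpha>' \<beta>' \<gamma>' a' b' c' +
  assumes same: "\<And>x1 x2 x3. x1 \<in> space M1 \<Longrightarrow> x2 \<in> space M2 \<Longrightarrow> x3 \<in> space M3 \<Longrightarrow>
    (\<lambda>n. (\<Sum>j\<le>n. \<Sum>k\<le>n. \<alpha> j x1 * \<beta> j k x2 * \<gamma> k x3)
      - (\<Sum>j\<le>n. \<Sum>k\<le>n. \<alpha>' j x1 * \<beta>' j k x2 * \<gamma>' k x3)) \<longlonglongrightarrow> 0"
begin

text \<open>No product measure is formed: the variables are integrated one at a time, beginning with
  the third. \<open>h\<close> is the integral of \<open>D\<close> over x3, and \<open>g\<close> that
  of \<open>h\<close> over x2. At good points the functions of each stage are bounded and tend to 0,
  so dominated convergence carries the limit to the next stage.\<close>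

lemma diagonal_forms_tendsto_0:
  "(\<lambda>n. r.trilinear_form n x x y y z z - r'.trilinear_form n x x y y z z) \<longlonglongrightarrow> 0"
proof -
  let ?\<mu>1 = "scalar_measure M1 E1 x" and ?\<mu>2 = "scalar_measure M2 E2 y" and ?\<mu>3 = "scalar_measure M3 E3 z"
  interpret m1: finite_measure "scalar_measure M1 E1 x" by (rule finite_measure_scalar_measure[OF r.E(1)])
  interpret m2: finite_measure "scalar_measure M2 E2 y" by (rule finite_measure_scalar_measure[OF r.E(2)])
  interpret m3: finite_measure "scalar_measure M3 E3 z" by (rule finite_measure_scalar_measure[OF r.E(3)])
  define qb where "qb = (\<lambda>j k. integral\<^sup>L ?\<mu>2 (\<beta> j k))"
  define qb' where "qb' = (\<lambda>j k. integral\<^sup>L ?\<mu>2 (\<beta>' j k))"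
  define qc where "qc = (\<lambda>k. integral\<^sup>L ?\<mu>3 (\<gamma> k))"
  define qc' where "qc' = (\<lambda>k. integral\<^sup>L ?\<mu>3 (\<gamma>' k))"
  define D where "D = (\<lambda>n x1 x2 x3. (\<Sum>j\<le>n. \<Sum>k\<le>n. \<alpha> j x1 * \<beta> j k x2 * \<gamma> k x3)
      - (\<Sum>j\<le>n. \<Sum>k\<le>n. \<alpha>' j x1 * \<beta>' j k x2 * \<gamma>' k x3))"
  define h where "h = (\<lambda>n x1 x2. (\<Sum>j\<le>n. \<Sum>k\<le>n. \<alpha> j x1 * \<beta> j k x2 * qc k)
      - (\<Sum>j\<le>n. \<Sum>k\<le>n. \<alpha>' j x1 * \<beta>' j k x2 * qc' k))"
  define g where "g = (\<lambda>n x1. (\<Sum>j\<le>n. \<Sum>k\<le>n. \<alpha> j x1 * qb j k * qc k)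
      - (\<Sum>j\<le>n. \<Sum>k\<le>n. \<alpha>' j x1 * qb' j k * qc' k))"
  define K where "K = b * c * a + b' * c' * a'"
  \<comment> \<open>Points at which the bounds of both representations hold. The exceptional sets of
    the three variables are separate, so the good triples form a product.\<close>
  define G1 where "G1 = (\<lambda>x1. x1 \<in> space M1 \<and> (\<forall>J. finite J \<longrightarrow> L2_set (\<lambda>j. cmod (\<alpha> j x1)) J \<le> a)
    \<and> (\<forall>J. finite J \<longrightarrow> L2_set (\<lambda>j. cmod (\<alpha>' j x1)) J \<le> a'))"
  define G2 where "G2 = (\<lambda>x2. x2 \<in> space M2 \<and> (\<forall>J K. finite J \<longrightarrow> finite K \<longrightarrow> matrix_bound J K (\<lambda>j k. \<beta> j k x2) b)
    \<and> (\<forall>J K. finite J \<longrightarrow> finite K \<longrightarrow> matrix_bound J K (\<lambda>j k. \<beta>' j k x2) b'))"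
  define G3 where "G3 = (\<lambda>x3. x3 \<in> space M3 \<and> (\<forall>J. finite J \<longrightarrow> L2_set (\<lambda>j. cmod (\<gamma> j x3)) J \<le> c)
    \<and> (\<forall>J. finite J \<longrightarrow> L2_set (\<lambda>j. cmod (\<gamma>' j x3)) J \<le> c'))"
  have AE1: "AE x1 in ?\<mu>1. G1 x1"
    using spectral_AE_imp_AE[OF r.E(1) r.bound1, of x] spectral_AE_imp_AE[OF r.E(1) r'.bound1, of x] AE_space
    by eventually_elim (simp add: G1_def)
  have AE2: "AE x2 in ?\<mu>2. G2 x2"
    using spectral_AE_imp_AE[OF r.E(2) r.bound2, of y] spectral_AE_imp_AE[OF r.E(2) r'.bound2, of y] AE_space
    by eventually_elim (simp add: G2_def)
  have AE3: "AE x3 in ?\<mu>3. G3 x3"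
    using spectral_AE_imp_AE[OF r.E(3) r.bound3, of z] spectral_AE_imp_AE[OF r.E(3) r'.bound3, of z] AE_space
    by eventually_elim (simp add: G3_def)
  have D_le: "cmod (D n x1 x2 x3) \<le> K" if "G1 x1" "G2 x2" "G3 x3" for n x1 x2 x3
    unfolding D_def K_def
    by (intro order_trans[OF norm_triangle_ineq4] add_mono r.trilinear_sum_le r'.trilinear_sum_le)
      (use that in \<open>auto simp: G1_def G2_def G3_def\<close>)
  have D_lim: "(\<lambda>n. D n x1 x2 x3) \<longlonglongrightarrow> 0" if "G1 x1" "G2 x2" "G3 x3" for x1 x2 x3
    unfolding D_def by (rule same) (use that in \<open>auto simp: G1_def G2_def G3_def\<close>)
  have D_int: "integrable ?\<mu>3 (D n x1 x2)" for n x1 x2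
    unfolding D_def
    by (intro Bochner_Integration.integrable_diff Bochner_Integration.integrable_sum
        integrable_mult_right r.integrable_entries r'.integrable_entries)
  have D_eq: "integral\<^sup>L ?\<mu>3 (D n x1 x2) = h n x1 x2" for n x1 x2
    unfolding D_def h_def qc_def qc'_def
    by (simp add: Bochner_Integration.integral_sum r.integrable_entries r'.integrable_entries)
  have h_le: "cmod (h n x1 x2) \<le> K * measure ?\<mu>3 (space ?\<mu>3)" if "G1 x1" "G2 x2" for n x1 x2
    unfolding D_eq[symmetric]
    by (rule m3.norm_integral_le_AE[OF borel_measurable_integrable[OF D_int]])
      (use AE3 in \<open>rule AE_mp, use D_le that in simp\<close>)
  have h_lim: "(\<lambda>n. h n x1 x2) \<longlonglongrightarrow> 0" if "G1 x1" "G2 x2" for x1 x2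
    unfolding D_eq[symmetric]
    by (rule m3.integral_tendsto_0[where K = K, OF borel_measurable_integrable[OF D_int]];
        use AE3 in \<open>rule AE_mp, use D_le D_lim that in simp\<close>)
  have h_int: "integrable ?\<mu>2 (h n x1)" for n x1
    unfolding h_def
    by (intro Bochner_Integration.integrable_diff Bochner_Integration.integrable_sum
        integrable_mult_right integrable_mult_left r.integrable_entries r'.integrable_entries)
  have h_eq: "integral\<^sup>L ?\<mu>2 (h n x1) = g n x1" for n x1
    unfolding h_def g_def qb_def qb'_def
    by (simp add: Bochner_Integration.integral_sum r.integrable_entries r'.integrable_entries)
  have g_le: "cmod (g n x1) \<le> K * measure ?\<mu>3 (space ?\<mu>3) * measure ?\<mu>2 (space ?\<mu>2)" if "G1 x1" for n x1
    unfolding h_eq[symmetric]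
    by (rule m2.norm_integral_le_AE[OF borel_measurable_integrable[OF h_int]])
      (use AE2 in \<open>rule AE_mp, use h_le that in simp\<close>)
  have g_lim: "(\<lambda>n. g n x1) \<longlonglongrightarrow> 0" if "G1 x1" for x1
    unfolding h_eq[symmetric]
    by (rule m2.integral_tendsto_0[where K = "K * measure ?\<mu>3 (space ?\<mu>3)", OF borel_measurable_integrable[OF h_int]];
        use AE2 in \<open>rule AE_mp, use h_le h_lim that in simp\<close>)
  have g_int: "integrable ?\<mu>1 (g n)" for n
    unfolding g_def
    by (intro Bochner_Integration.integrable_diff Bochner_Integration.integrable_sum
        integrable_mult_left r.integrable_entries r'.integrable_entries)
  have g_eq: "integral\<^sup>L ?\<mu>1 (g n)
    = (\<Sum>j\<le>n. \<Sum>k\<le>n. integral\<^sup>L ?\<mu>1 (\<alpha> j) * qb j k * qc k)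
      - (\<Sum>j\<le>n. \<Sum>k\<le>n. integral\<^sup>L ?\<mu>1 (\<alpha>' j) * qb' j k * qc' k)" for n
    unfolding g_def
    by (simp add: Bochner_Integration.integral_sum r.integrable_entries r'.integrable_entries)
  have "(\<lambda>n. integral\<^sup>L ?\<mu>1 (g n)) \<longlonglongrightarrow> 0"
    by (rule m1.integral_tendsto_0[where K = "K * measure ?\<mu>3 (space ?\<mu>3) * measure ?\<mu>2 (space ?\<mu>2)",
        OF borel_measurable_integrable[OF g_int]];
        use AE1 in \<open>rule AE_mp, use g_le g_lim in simp\<close>)
  then show ?thesis
    unfolding g_eq qb_def qb'_def qc_def qc'_def r.trilinear_form_def r'.trilinear_form_def
      r.cinner_ABC_self r'.cinner_ABC_self .
qed

lemma forms_tendsto_0: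
  "(\<lambda>n. r.trilinear_form n p q s t u v - r'.trilinear_form n p q s t u v) \<longlonglongrightarrow> 0"
proof -
  note sesq = sesquilinear_diff sesquilinear_sum sesquilinear_mult_right sesquilinear_cmult sesquilinear_cinner
    r.bounded_operators_ABC r'.bounded_operators_ABC
  have 1: "(\<lambda>n. r.trilinear_form n p q y y z z - r'.trilinear_form n p q y y z z) \<longlonglongrightarrow> 0" for y z
    by (rule sesquilinear_tendsto_0I[OF _ diagonal_forms_tendsto_0],
        unfold r.trilinear_form_def r'.trilinear_form_def) (intro sesq)
  have 2: "(\<lambda>n. r.trilinear_form n p q s t z z - r'.trilinear_form n p q s t z z) \<longlonglongrightarrow> 0" for z
    by (rule sesquilinear_tendsto_0I[OF _ 1], unfold r.trilinear_form_def r'.trilinear_form_def) (intro sesq)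
  show ?thesis
    by (rule sesquilinear_tendsto_0I[OF _ 2], unfold r.trilinear_form_def r'.trilinear_form_def) (intro sesq)
qed

end

context bounded_representation
begin

text \<open>For an orthogonal projection P of finite rank this is the form of the partial sum with T
  P and P R in place of T and R.\<close>

definition compressed_sum :: "('h \<Rightarrow> 'h) \<Rightarrow> ('h \<Rightarrow>\<^sub>L 'h) \<Rightarrow> ('h \<Rightarrow>\<^sub>L 'h) \<Rightarrow> nat \<Rightarrow> 'h \<Rightarrow> 'h \<Rightarrow> complex" where
  "compressed_sum P T R n u v = (\<Sum>j\<le>n. \<Sum>k\<le>n. cinner (B j k (P (\<eta> R u k))) (P (\<xi> T v j)))"

text \<open>Expanding P leaves \<open>d * d\<close> trilinear forms, a number independent of n, so
  \<open>forms_tendsto_0\<close> can be applied term by term.\<close>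

lemma compressed_sum_eq:
  fixes g :: "nat \<Rightarrow> 'h"
  assumes T: "T \<in> bounded_operators" and R: "R \<in> bounded_operators"
    and P: "P = (\<lambda>x. \<Sum>i<d. cinner x (g i) *\<^sub>C g i)"
  shows "compressed_sum P T R n u v
    = (\<Sum>l<d. \<Sum>m<d. trilinear_form n (T (g m)) v (g l) (g m) u (adjoint_operator R (g l)))"
proof -
  have "cinner (B j k (P (\<eta> R u k))) (P (\<xi> T v j))
    = (\<Sum>l<d. \<Sum>m<d. cinner (A j (T (g m))) v
      * cinner (B j k (g l)) (g m)
      * cinner (C k u) (adjoint_operator R (g l)))" for j k
  proof -
    have \<eta>: "cinner (\<eta> R u k) (g l) = cinner (C k u) (adjoint_operator R (g l))" for l
      by (simp add: \<eta>_def cinner_adjoint_right[OF R])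
    have \<xi>: "cnj (cinner (\<xi> T v j) (g m)) = cinner (A j (T (g m))) v" for m
      by (simp add: \<xi>_def cinner_adjoint_right T bounded_operators_ABC flip: cinner_commute)
    show ?thesis
      unfolding P blinfun.sum_right cinner_sum_left cinner_sum_right bounded_operatorsD[OF bounded_operators_ABC(2)]
        cinner_scaleC_left cinner_scaleC_right \<xi> \<eta>
      by (subst sum.swap) (simp add: sum_distrib_left mult_ac)
  qed
  then show ?thesis
    unfolding trilinear_form_def compressed_sum_def
    by (simp only: sum.swap[of _ "{..<d}" "{..n}"])
qed

text \<open>The order of the quantifiers is the point: N is chosen first, and the bound then holds
  for all P and n. A single projection can be adapted to two representations, and n may tend to
  infinity afterwards.\<close>

lemma compression_error:
  fixes u v :: 'h
  assumes T: "T \<in> bounded_operators" and "0 < e"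
  shows "\<exists>N. \<forall>P n. (\<forall>x. norm (x - P x) \<le> norm x) \<longrightarrow> (\<forall>x. norm (P x) \<le> norm x) \<longrightarrow>
    (\<forall>k\<le>N. P (\<eta> R u k) = \<eta> R u k \<and> P (\<xi> T v k) = \<xi> T v k) \<longrightarrow>
    cmod (cinner (partial_sum T R n n u) v - compressed_sum P T R n u v) \<le> e"
proof -
  define X where "X = norm R * (c * norm u)"
  define Y where "Y = norm (adjoint_operator T) * (a * norm v)"
  have pos: "0 < b * (X + Y) + 1"
    using nonneg by (auto simp: X_def Y_def intro!: add_nonneg_pos)
  define \<epsilon> where "\<epsilon> = e / (b * (X + Y) + 1)"
  have \<epsilon>: "0 < \<epsilon>" using \<open>0 < e\<close> pos by (simp add: \<epsilon>_def)
  obtain N1 where N1: "\<And>n. L2_set (\<lambda>k. norm (\<eta> R u k)) {N1<..n} \<le> \<epsilon>"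
    using L2_set_tail[OF L2_set_\<eta>_le \<epsilon>] by blast
  obtain N2 where N2: "\<And>n. L2_set (\<lambda>k. norm (\<xi> T v k)) {N2<..n} \<le> \<epsilon>"
    using L2_set_tail[OF L2_set_\<xi>_le \<epsilon>] by blast
  have mono: "L2_set f {max N1 N2<..n} \<le> \<epsilon>" if "L2_set f {M<..n} \<le> \<epsilon>" "M \<le> max N1 N2"
    for f :: "nat \<Rightarrow> real" and M n
    by (rule order_trans[OF _ that(1)], unfold L2_set_def, intro real_sqrt_le_mono sum_mono2)
      (use that(2) in auto)
  show ?thesis
  proof (intro exI[of _ "max N1 N2"] allI impI)
    fix P :: "'h \<Rightarrow> 'h" and n
    assume P: "\<forall>x. norm (x - P x) \<le> norm x" "\<forall>x. norm (P x) \<le> norm x"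
      "\<forall>k\<le>max N1 N2. P (\<eta> R u k) = \<eta> R u k \<and> P (\<xi> T v k) = \<xi> T v k"
    have "cmod (cinner (partial_sum T R n n u) v - compressed_sum P T R n u v)
      \<le> b * \<epsilon> * (X + Y)"
      unfolding cinner_partial_sum[OF T] compressed_sum_def X_def Y_def
    proof (rule projection_approximation[of P "max N1 N2"])
      show "L2_set (\<lambda>k. norm (\<eta> R u k)) {max N1 N2<..n} \<le> \<epsilon>"
        by (rule mono[OF N1]) simp
      show "L2_set (\<lambda>k. norm (\<xi> T v k)) {max N1 N2<..n} \<le> \<epsilon>"
        by (rule mono[OF N2]) simp
    qed (use P in \<open>simp_all add: L2_set_\<eta>_le L2_set_\<xi>_le\<close>)
    also have "\<dots> \<le> \<epsilon> * (b * (X + Y) + 1)"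
      using \<epsilon> by (simp add: algebra_simps)
    also have "\<dots> = e"
      using pos by (simp add: \<epsilon>_def)
    finally show "cmod (cinner (partial_sum T R n n u) v - compressed_sum P T R n u v) \<le> e" .
  qed
qed

end

context two_representations
begin

text \<open>Both partial sums are replaced, up to e / 2 each, by compressed sums for one projection
  that fixes the initial vectors of both representations (the set \<open>V\<close>). The difference
  of the compressed sums tends to 0 by \<open>forms_tendsto_0\<close>, which leaves at most
  e.\<close>

lemma triple_operator_integral_unique:
  assumes T: "T \<in> bounded_operators" and R: "R \<in> bounded_operators"
    and W: "wot_double_sum (\<lambda>j k. r.A j o\<^sub>L T o\<^sub>L r.B j k o\<^sub>L R o\<^sub>L r.C k) W"
    and W': "wot_double_sum (\<lambda>j k. r'.A j o\<^sub>L T o\<^sub>L r'.B j k o\<^sub>L R o\<^sub>L r'.C k) W'"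
  shows "W = W'"
proof (rule blinfun_eqI, rule cinner_eqI)
  fix u v
  have diag: "(\<lambda>n. cinner (r.partial_sum T R n n u) v) \<longlonglongrightarrow> cinner (W u) v"
    using filterlim_compose[OF W[unfolded wot_double_sum_def, rule_format] filterlim_diagonal]
    by (simp add: r.partial_sum_def)
  have diag': "(\<lambda>n. cinner (r'.partial_sum T R n n u) v) \<longlonglongrightarrow> cinner (W' u) v"
    using filterlim_compose[OF W'[unfolded wot_double_sum_def, rule_format] filterlim_diagonal]
    by (simp add: r'.partial_sum_def)
  define d where "d = cinner (W u) v - cinner (W' u) v"
  have small: "cmod d \<le> e" if e: "0 < e" for e
  proof -
    have "0 < e / 2" using e by simp
    note errors = r.compression_error[OF T this, of R u v] r'.compression_error[OF T this, of R u v]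
    from errors(1) obtain N1 where N1: "\<forall>P n. (\<forall>x. norm (x - P x) \<le> norm x) \<longrightarrow> (\<forall>x. norm (P x) \<le> norm x) \<longrightarrow>
      (\<forall>k\<le>N1. P (r.\<eta> R u k) = r.\<eta> R u k \<and> P (r.\<xi> T v k) = r.\<xi> T v k) \<longrightarrow>
      cmod (cinner (r.partial_sum T R n n u) v - r.compressed_sum P T R n u v) \<le> e / 2" ..
    from errors(2) obtain N2 where N2: "\<forall>P n. (\<forall>x. norm (x - P x) \<le> norm x) \<longrightarrow> (\<forall>x. norm (P x) \<le> norm x) \<longrightarrow>
      (\<forall>k\<le>N2. P (r'.\<eta> R u k) = r'.\<eta> R u k \<and> P (r'.\<xi> T v k) = r'.\<xi> T v k) \<longrightarrow>
      cmod (cinner (r'.partial_sum T R n n u) v - r'.compressed_sum P T R n u v) \<le> e / 2" ..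
    define V where "V = r.\<eta> R u ` {..N1} \<union> r.\<xi> T v ` {..N1} \<union> r'.\<eta> R u ` {..N2} \<union> r'.\<xi> T v ` {..N2}"
    have "finite V" by (simp add: V_def)
    show ?thesis
    proof (rule orthonormal_basis[OF \<open>finite V\<close>])
      fix m and g :: "nat \<Rightarrow> 'h"
      assume g: "orthonormal_on {..<m} g"
        and basis: "\<And>x. x \<in> cvec.span V \<Longrightarrow> x = (\<Sum>i<m. cinner x (g i) *\<^sub>C g i)"
      define P where "P = (\<lambda>x. \<Sum>i<m. cinner x (g i) *\<^sub>C g i)"
      have pythagoras: "(norm x)\<^sup>2 = (norm (P x))\<^sup>2 + (norm (x - P x))\<^sup>2" for x
        using orthonormal_projection_norm[OF g finite_lessThan, of x]
          norm_orthonormal_sum[OF g finite_lessThan, of "\<lambda>i. cinner x (g i)"] by (simp add: P_def)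
      have P_le: "norm (x - P x) \<le> norm x" for x
        by (rule power2_le_imp_le) (use pythagoras[of x] in simp_all)
      have P_le': "norm (P x) \<le> norm x" for x
        by (rule power2_le_imp_le) (use pythagoras[of x] in simp_all)
      have fix_P: "P x = x" if "x \<in> V" for x
        unfolding P_def by (rule basis[symmetric]) (rule cvec.span_base[OF that])
      let ?S = "\<lambda>n. r.compressed_sum P T R n u v" and ?S' = "\<lambda>n. r'.compressed_sum P T R n u v"
      have S: "cmod (cinner (r.partial_sum T R n n u) v - ?S n) \<le> e / 2" for n
        by (rule N1[rule_format]) (auto simp: P_le P_le' V_def intro!: fix_P)
      have S': "cmod (cinner (r'.partial_sum T R n n u) v - ?S' n) \<le> e / 2" for n
        by (rule N2[rule_format]) (auto simp: P_le P_le' V_def intro!: fix_P)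
      have "(\<lambda>n. ?S n - ?S' n) \<longlonglongrightarrow> 0"
        unfolding r.compressed_sum_eq[OF T R P_def] r'.compressed_sum_eq[OF T R P_def]
          sum_subtractf[where A = "{..<m}", symmetric]
        by (intro tendsto_null_sum forms_tendsto_0)
      then have lim: "(\<lambda>n. cmod ((cinner (r.partial_sum T R n n u) v
          - cinner (r'.partial_sum T R n n u) v) - (?S n - ?S' n))) \<longlonglongrightarrow> cmod (d - 0)"
        unfolding d_def by (intro tendsto_norm tendsto_diff diag diag')
      have "cmod ((cinner (r.partial_sum T R n n u) v
          - cinner (r'.partial_sum T R n n u) v) - (?S n - ?S' n)) \<le> e" for n
      proof -
        have "(cinner (r.partial_sum T R n n u) v
          - cinner (r'.partial_sum T R n n u) v) - (?S n - ?S' n)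
          = (cinner (r.partial_sum T R n n u) v - ?S n)
          - (cinner (r'.partial_sum T R n n u) v - ?S' n)"
          by simp
        also have "cmod \<dots> \<le> e / 2 + e / 2"
          by (intro order_trans[OF norm_triangle_ineq4] add_mono S S')
        finally show ?thesis by simp
      qed
      then show "cmod d \<le> e"
        using LIMSEQ_le_const2[OF lim, of e] by simp
    qed
  qed
  have "cmod d \<le> 0"
    by (rule field_le_epsilon) (use small in simp)
  then show "cinner (W u) v = cinner (W' u) v"
    by (simp add: d_def)
qed

end

subsection \<open>Schatten estimates\<close>

text \<open>A bound for the norm of a finite family in l^p, with powers in place of roots and with
  the maximum for \<open>p = \<infinity>\<close>, so that one notion covers all exponents.\<close>

definition lp_bound :: "ennreal \<Rightarrow> 'i set \<Rightarrow> ('i \<Rightarrow> real) \<Rightarrow> real \<Rightarrow> bool" where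
  "lp_bound p I x X \<longleftrightarrow> (if p = \<infinity> then \<forall>i\<in>I. x i \<le> X
     else (\<Sum>i\<in>I. x i powr enn2real p) \<le> X powr enn2real p)"

lemma ge_2_enn2real: "2 \<le> p \<Longrightarrow> p \<noteq> \<infinity> \<Longrightarrow> 2 \<le> enn2real p"
  by (cases p) (auto simp: ennreal_le_iff2 simp flip: ennreal_numeral)

lemma lp_bound_mono:
  assumes "lp_bound p I x X" "\<And>i. i \<in> I \<Longrightarrow> 0 \<le> y i" "\<And>i. i \<in> I \<Longrightarrow> y i \<le> x i"
  shows "lp_bound p I y X"
proof (cases "p = \<infinity>")
  case False
  have "(\<Sum>i\<in>I. y i powr enn2real p) \<le> (\<Sum>i\<in>I. x i powr enn2real p)"
    by (intro sum_mono powr_mono2 assms) simp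
  then show ?thesis
    using assms(1) False by (simp add: lp_bound_def)
qed (use assms in \<open>force simp: lp_bound_def\<close>)

lemma lp_bound_weaken: "lp_bound p I x X \<Longrightarrow> 0 \<le> X \<Longrightarrow> X \<le> Y \<Longrightarrow> lp_bound p I x Y"
  unfolding lp_bound_def using powr_mono2[of "enn2real p" X Y] by (force split: if_splits)

lemma lp_bound_cmult:
  assumes "lp_bound p I x X" "0 \<le> b" "0 \<le> X" "\<And>i. i \<in> I \<Longrightarrow> 0 \<le> x i"
  shows "lp_bound p I (\<lambda>i. b * x i) (b * X)"
proof (cases "p = \<infinity>")
  case True
  then show ?thesis
    using assms by (auto simp: lp_bound_def intro: mult_left_mono)
next
  case False
  have "(\<Sum>i\<in>I. (b * x i) powr enn2real p) = b powr enn2real p * (\<Sum>i\<in>I. x i powr enn2real p)"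
    unfolding sum_distrib_left using assms by (intro sum.cong refl) (simp add: powr_mult)
  also have "\<dots> \<le> b powr enn2real p * X powr enn2real p"
    using assms(1) False by (intro mult_left_mono) (auto simp: lp_bound_def)
  finally show ?thesis
    using False assms by (simp add: lp_bound_def powr_mult)
qed

section \<open>Hoelder's inequality with extended exponents\<close>

lemma ge_2_of_inverse_le:
  fixes p :: ennreal
  assumes "1 / p \<le> 1 / 2"
  shows "2 \<le> p"
proof (cases p)
  case (real t)
  have half: "(1 :: ennreal) / 2 = ennreal (1 / 2)"
    using divide_ennreal[of 1 2] by simp
  have "t \<noteq> 0"
  proof
    assume "t = 0"
    then have "1 / p = top"
      using real by (simp add: divide_ennreal_def)
    then show False
      using assms unfolding half by (simp only: top_unique ennreal_neq_top)
  qed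
  then have t: "t > 0" using real by simp
  have "ennreal (1 / t) \<le> ennreal (1 / 2)"
    using assms t real divide_ennreal[of 1 t] divide_ennreal[of 1 2] by simp
  then have "1 / t \<le> 1 / 2"
    by (subst (asm) ennreal_le_iff) auto
  then have "2 \<le> t" using t by (simp add: field_simps)
  then have "ennreal 2 \<le> ennreal t" by (rule ennreal_leI)
  then show ?thesis using real by simp
qed simp

lemma inverse_ennreal_eq_iff:
  fixes p q :: ennreal
  shows "1 / p = 1 / q \<longleftrightarrow> p = q"
proof -
  have "inverse (inverse x) = x" for x :: ennreal
  proof (cases x)
    case (real t)
    then show ?thesis
      by (cases "t = 0") (simp_all add: inverse_ennreal)
  qed simp
  then have "p = q" if "inverse p = inverse q"
    using that by metis
  then show ?thesis
    by (auto simp: divide_ennreal_def)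
qed

text \<open>Young's inequality with the weights r / q and r / p, which add up to 1, is applied to
  the normalized values \<open>x i / X\<close> and \<open>y i / Y\<close>. If X or Y is 0, all
  products vanish. An infinite exponent reduces the claim to multiplication by a constant.\<close>

lemma Hoelder_lp_bound:
  fixes p q r :: ennreal
  assumes p: "2 \<le> p" and q: "2 \<le> q" and r: "1 / r = 1 / p + 1 / q" and "finite I"
    and x: "lp_bound q I x X" and y: "lp_bound p I y Y" and "0 \<le> X" "0 \<le> Y"
    and nonneg: "\<And>i. i \<in> I \<Longrightarrow> 0 \<le> x i" "\<And>i. i \<in> I \<Longrightarrow> 0 \<le> y i"
  shows "lp_bound r I (\<lambda>i. x i * y i) (X * Y)"
proof (cases "p = \<infinity>")
  case True
  then have "r = q" using r by (simp add: inverse_ennreal_eq_iff)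
  have "lp_bound q I (\<lambda>i. Y * x i) (Y * X)"
    by (rule lp_bound_cmult[OF x]) (use assms in auto)
  then show ?thesis
    unfolding \<open>r = q\<close> mult.commute[of Y X]
  proof (rule lp_bound_mono)
    show "x i * y i \<le> Y * x i" if "i \<in> I" for i
      using y True that nonneg mult_right_mono[of "y i" Y "x i"] by (simp add: lp_bound_def mult.commute)
  qed (use nonneg in \<open>auto simp: mult.commute\<close>)
next
  case p_fin: False
  show ?thesis
  proof (cases "q = \<infinity>")
    case True
    then have "r = p" using r by (simp add: inverse_ennreal_eq_iff)
    have "lp_bound p I (\<lambda>i. X * y i) (X * Y)"
      by (rule lp_bound_cmult[OF y]) (use assms in auto)
    then show ?thesis
      unfolding \<open>r = p\<close>
    proof (rule lp_bound_mono)
      show "x i * y i \<le> X * y i" if "i \<in> I" for i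
        using x True that nonneg by (auto simp: lp_bound_def intro: mult_right_mono)
    qed (use nonneg in auto)
  next
    case q_fin: False
    obtain p' where p': "p = ennreal p'" "2 \<le> p'"
      using p p_fin by (cases p) (auto simp: ennreal_le_iff2 simp flip: ennreal_numeral)
    obtain q' where q': "q = ennreal q'" "2 \<le> q'"
      using q q_fin by (cases q) (auto simp: ennreal_le_iff2 simp flip: ennreal_numeral)
    have r1: "1 / r = ennreal (1 / p' + 1 / q')"
      using r p' q' divide_ennreal[of 1 p'] divide_ennreal[of 1 q'] by simp
    have pos: "0 < 1 / p' + 1 / q'" using p' q' by (simp add: add_pos_pos)
    define r' where "r' = 1 / (1 / p' + 1 / q')"
    have r'_pos: "0 < r'" using pos by (simp add: r'_def)
    have "1 / ennreal r' = ennreal (1 / p' + 1 / q')"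
      using divide_ennreal[of 1 r'] r'_pos by (simp add: r'_def)
    then have r': "r = ennreal r'"
      using r1 by (metis inverse_ennreal_eq_iff)
    have sum1: "r' / p' + r' / q' = 1"
      using pos by (simp add: r'_def divide_simps) (use p' q' in \<open>auto simp: field_simps\<close>)
    have sx: "(\<Sum>i\<in>I. x i powr q') \<le> X powr q'" and sy: "(\<Sum>i\<in>I. y i powr p') \<le> Y powr p'"
      using x y p' q' by (auto simp: lp_bound_def)
    have "(\<Sum>i\<in>I. (x i * y i) powr r') \<le> (X * Y) powr r'"
    proof (cases "X = 0 \<or> Y = 0")
      case True
      have prod_0: "x i * y i = 0" if "i \<in> I" for i
      proof -
        have zero: "z i = 0" if "(\<Sum>i\<in>I. z i powr s) \<le> 0 powr s" for z :: "'a \<Rightarrow> real" and s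
        proof -
          have "(\<Sum>i\<in>I. z i powr s) = 0"
            using that by (intro antisym sum_nonneg) auto
          then have "\<forall>i\<in>I. z i powr s = 0"
            by (subst (asm) sum_nonneg_eq_0_iff) (use \<open>finite I\<close> in auto)
          then show ?thesis using \<open>i \<in> I\<close> by simp
        qed
        show ?thesis
          using True zero[of x q'] zero[of y p'] sx sy by auto
      qed
      have "(\<Sum>i\<in>I. (x i * y i) powr r') = 0"
        by (intro sum.neutral ballI) (simp add: prod_0 del: mult_eq_0_iff)
      then show ?thesis by simp
    next
      case False
      then have XY: "0 < X" "0 < Y" using \<open>0 \<le> X\<close> \<open>0 \<le> Y\<close> by auto
      have "(x i * y i) powr r' \<le> (X * Y) powr r' * (r' / q' * (x i powr q' / X powr q') + r' / p' * (y i powr p' / Y powr p'))"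
        if i: "i \<in> I" for i
      proof (cases "x i = 0 \<or> y i = 0")
        case True
        have "0 \<le> (X * Y) powr r' * (r' / q' * (x i powr q' / X powr q') + r' / p' * (y i powr p' / Y powr p'))"
          using r'_pos p' q' by (intro mult_nonneg_nonneg add_nonneg_nonneg) auto
        then show ?thesis using True by auto
      next
        case False
        then have xy: "0 < x i" "0 < y i" using nonneg[OF i] by auto
        have "((x i / X) powr q') powr (r' / q') * ((y i / Y) powr p') powr (r' / p')
          \<le> r' / q' * (x i / X) powr q' + r' / p' * (y i / Y) powr p'"
          by (rule Youngs_inequality_0) (use xy XY r'_pos p' q' sum1 in auto)
        then have "(x i / X) powr r' * (y i / Y) powr r'
          \<le> r' / q' * (x i powr q' / X powr q') + r' / p' * (y i powr p' / Y powr p')"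
          using p' q' xy XY by (simp add: powr_powr powr_divide)
        then have "(X * Y) powr r' * ((x i / X) powr r' * (y i / Y) powr r')
          \<le> (X * Y) powr r' * (r' / q' * (x i powr q' / X powr q') + r' / p' * (y i powr p' / Y powr p'))"
          by (rule mult_left_mono) simp
        moreover have "(X * Y) powr r' * ((x i / X) powr r' * (y i / Y) powr r') = (x i * y i) powr r'"
          using xy XY by (simp add: powr_mult powr_divide)
        ultimately show ?thesis by simp
      qed
      then have "(\<Sum>i\<in>I. (x i * y i) powr r')
        \<le> (\<Sum>i\<in>I. (X * Y) powr r' * (r' / q' * (x i powr q' / X powr q') + r' / p' * (y i powr p' / Y powr p')))"
        by (rule sum_mono)
      also have "\<dots> = (X * Y) powr r' * (r' / q' * ((\<Sum>i\<in>I. x i powr q') / X powr q')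
        + r' / p' * ((\<Sum>i\<in>I. y i powr p') / Y powr p'))"
        by (simp only: sum.distrib flip: sum_distrib_left sum_divide_distrib)
      also have "\<dots> \<le> (X * Y) powr r' * (r' / q' * 1 + r' / p' * 1)"
        using sx sy XY r'_pos p' q' by (intro mult_left_mono add_mono) auto
      also have "\<dots> = (X * Y) powr r'"
        using sum1 by simp
      finally show ?thesis .
    qed
    then show ?thesis
      using r' r'_pos by (simp add: lp_bound_def)
  qed
qed

text \<open>For \<open>r = \<infinity>\<close> systems of one vector already give the operator norm.
  For finite r, \<open>singular_value_power_sum_le\<close> bounds all partial sums of the series in
  the Schatten norm.\<close>

lemma schatten_norm_le_lp_bound:
  fixes W :: "'h::complex_hilbert_space \<Rightarrow>\<^sub>L 'h"
  assumes W: "W \<in> bounded_operators" and r: "2 \<le> r" and "0 \<le> K"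
    and bound: "\<And>(I::nat set) e f. finite I \<Longrightarrow> orthonormal_on I e \<Longrightarrow> orthonormal_on I f \<Longrightarrow>
      lp_bound r I (\<lambda>i. cmod (cinner (W (e i)) (f i))) K"
  shows "schatten_norm r W \<le> ennreal K"
proof (cases "r = \<infinity>")
  case True
  have "norm W \<le> K"
  proof (rule norm_blinfun_le_cinner[OF \<open>0 \<le> K\<close>])
    fix u v :: 'h
    show "cmod (cinner (W u) v) \<le> K * norm u * norm v"
    proof (cases "u = 0 \<or> v = 0")
      case False
      let ?e = "\<lambda>_::nat. (1 / norm u) *\<^sub>R u" and ?f = "\<lambda>_::nat. (1 / norm v) *\<^sub>R v"
      have "orthonormal_on {0} ?e" "orthonormal_on {0} ?f"
        using False by (auto simp: orthonormal_on_def cinner_scaleR_left cinner_scaleR_right cinner_self power2_eq_square)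
      then have "cmod (cinner (W (?e 0)) (?f 0)) \<le> K"
        using bound[of "{0}" ?e ?f] True by (simp add: lp_bound_def)
      then have "cmod (cinner (W u) v) / (norm u * norm v) \<le> K"
        by (simp add: blinfun.scaleR_right cinner_scaleR_left cinner_scaleR_right norm_mult norm_divide mult.commute)
      then show ?thesis
        using False by (simp add: pos_divide_le_eq mult_ac)
    qed (auto simp: blinfun.zero_right)
  qed
  then show ?thesis
    using True by (simp add: schatten_norm_def ennreal_leI)
next
  case False
  define s where "s = enn2real r"
  have s: "2 \<le> s"
    unfolding s_def by (rule ge_2_enn2real[OF r False])
  have partial: "(\<Sum>i<n. singular_value i W powr s) \<le> K powr s" for n
    by (rule singular_value_power_sum_le[OF W s]) (use bound False in \<open>simp add: lp_bound_def s_def\<close>)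
  have summable: "summable (\<lambda>n. singular_value n W powr s)"
    by (rule summableI_nonneg_bounded[OF _ partial]) simp
  have "(\<Sum>n. singular_value n W powr s) \<le> K powr s"
    by (rule suminf_le_const[OF summable partial])
  then have "(\<Sum>n. singular_value n W powr s) powr (1 / s) \<le> (K powr s) powr (1 / s)"
    using s by (intro powr_mono2 suminf_nonneg summable) auto
  also have "\<dots> = K"
    using s \<open>0 \<le> K\<close> by (simp add: powr_powr)
  finally show ?thesis
    using False summable by (simp add: schatten_norm_def ennreal_leI flip: s_def)
qed

section \<open>Schatten estimates for columns of operators\<close>

lemma adjoint_adjoint:
  fixes T :: "'h::complex_hilbert_space \<Rightarrow>\<^sub>L 'h"
  assumes "T \<in> bounded_operators"
  shows "adjoint_operator (adjoint_operator T) = T"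
  by (rule blinfun_eqI, rule cinner_eqI)
    (simp add: cinner_adjoint_left adjoint_bounded_operators cinner_adjoint_right assms)

lemma schatten_class_adjoint:
  fixes T :: "'h::complex_hilbert_space \<Rightarrow>\<^sub>L 'h"
  assumes T: "T \<in> bounded_operators" and p: "2 \<le> p"
  shows "schatten_norm p (adjoint_operator T) \<le> schatten_norm p T"
proof (cases "p = \<infinity>")
  case True
  have "norm (adjoint_operator T - adjoint_operator 0) \<le> norm (T - 0)"
    by (rule norm_adjoint_diff_le[OF T bounded_operators_0])
  moreover have "adjoint_operator 0 = (0 :: 'h \<Rightarrow>\<^sub>L 'h)"
    by (rule blinfun_eqI, rule cinner_eqI) (simp add: cinner_adjoint_left bounded_operators_0)
  ultimately show ?thesis
    using True by (simp add: schatten_norm_def ennreal_leI)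
next
  case False
  define s where "s = enn2real p"
  have s: "2 \<le> s"
    unfolding s_def by (rule ge_2_enn2real[OF p False])
  have le: "singular_value n (adjoint_operator T) powr s \<le> singular_value n T powr s" for n
    using s by (intro powr_mono2 singular_value_adjoint_le T singular_value_nonneg) simp
  show ?thesis
  proof (cases "summable (\<lambda>n. singular_value n T powr s)")
    case True
    have summable: "summable (\<lambda>n. singular_value n (adjoint_operator T) powr s)"
      by (rule summable_comparison_test'[OF True, of 0]) (simp add: le)
    have "(\<Sum>n. singular_value n (adjoint_operator T) powr s) powr (1 / s)
      \<le> (\<Sum>n. singular_value n T powr s) powr (1 / s)"
      using s by (intro powr_mono2 suminf_le le summable True suminf_nonneg) auto
    then show ?thesis
      using True summable False by (simp add: schatten_norm_def ennreal_leI flip: s_def)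
  qed (use False in \<open>simp add: schatten_norm_def flip: s_def\<close>)
qed

text \<open>\<open>schatten_power_sum_le\<close> is applied to the vectors \<open>C k (e i)\<close>.
  The bound for the column of the \<open>C k\<close> gives the sum over k for each i. The bound for
  the adjoints, after Bessel's inequality over i, gives the sum over i and k against a unit vector
  g.\<close>

lemma lp_bound_column:
  fixes R :: "'h::complex_hilbert_space \<Rightarrow>\<^sub>L 'h" and C :: "'k \<Rightarrow> 'h \<Rightarrow>\<^sub>L 'h"
  assumes R: "R \<in> bounded_operators" and C: "\<And>k. C k \<in> bounded_operators" and "finite I" "finite K"
    and "0 \<le> c" and q: "2 \<le> q" and fin: "schatten_norm q R < \<infinity>"
    and col: "\<And>u. L2_set (\<lambda>k. norm (C k u)) K \<le> c * norm u"
    and row: "\<And>u. L2_set (\<lambda>k. norm (adjoint_operator (C k) u)) K \<le> c * norm u"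
    and e: "orthonormal_on I e"
  shows "lp_bound q I (\<lambda>i. L2_set (\<lambda>k. norm (R (C k (e i)))) K)
    (c * enn2real (schatten_norm q R))"
proof (cases "q = \<infinity>")
  case True
  have "L2_set (\<lambda>k. norm (R (C k (e i)))) K \<le> c * norm R" if "i \<in> I" for i
  proof -
    have "L2_set (\<lambda>k. norm (R (C k (e i)))) K
      \<le> L2_set (\<lambda>k. norm R * norm (C k (e i))) K"
      by (intro L2_set_mono norm_blinfun) simp
    also have "\<dots> = norm R * L2_set (\<lambda>k. norm (C k (e i))) K"
      by (simp add: L2_set_right_distrib)
    also have "\<dots> \<le> norm R * (c * norm (e i))"
      by (intro mult_left_mono col) simp
    finally show ?thesis
      using orthonormal_on_norm[OF e that] by (simp add: mult.commute)
  qed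
  then show ?thesis
    using True by (simp add: lp_bound_def schatten_norm_def)
next
  case False
  define s where "s = enn2real q"
  have s: "2 \<le> s"
    unfolding s_def by (rule ge_2_enn2real[OF q False])
  have summable: "summable (\<lambda>n. singular_value n R powr s)"
    using fin False by (auto simp: schatten_norm_def s_def split: if_splits)
  define \<Sigma> where "\<Sigma> = (\<Sum>n. singular_value n R powr s)"
  have "0 \<le> \<Sigma>" unfolding \<Sigma>_def by (rule suminf_nonneg[OF summable]) simp
  have norm_R: "enn2real (schatten_norm q R) = \<Sigma> powr (1 / s)"
    using summable False by (simp add: schatten_norm_def \<Sigma>_def flip: s_def)
  have sq: "(L2_set f A)\<^sup>2 \<le> c\<^sup>2" if "L2_set f A \<le> c * norm u" "norm u = 1" for f and A :: "'k set" and u :: 'h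
    using that by (intro power_mono) (auto intro: L2_set_nonneg)
  show ?thesis
  proof (rule schatten_power_sum_le[OF R \<open>finite I\<close> \<open>finite K\<close> \<open>0 \<le> c\<close> s, of "\<lambda>i k. (C k) (e i)"])
    show "(\<Sum>k\<in>K. (norm (C k (e i)))\<^sup>2) \<le> c\<^sup>2" if "i \<in> I" for i
      unfolding L2_set_power2[symmetric] by (rule sq[OF col orthonormal_on_norm[OF e that]])
    fix g :: 'h assume g: "norm g = 1"
    have "(\<Sum>i\<in>I. \<Sum>k\<in>K. (cmod (cinner (C k (e i)) g))\<^sup>2)
      = (\<Sum>k\<in>K. \<Sum>i\<in>I. (cmod (cinner (adjoint_operator (C k) g) (e i)))\<^sup>2)"
      by (subst sum.swap) (simp add: cinner_adjoint_left C cmod_cinner_commute[of g])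
    also have "\<dots> \<le> (\<Sum>k\<in>K. (norm (adjoint_operator (C k) g))\<^sup>2)"
      by (intro sum_mono Bessel_inequality[OF e \<open>finite I\<close>])
    also have "\<dots> \<le> c\<^sup>2"
      unfolding L2_set_power2[symmetric] by (rule sq[OF row g])
    finally show "(\<Sum>i\<in>I. \<Sum>k\<in>K. (cmod (cinner (C k (e i)) g))\<^sup>2) \<le> c\<^sup>2" .
  next
    fix d and g :: "nat \<Rightarrow> 'h"
    assume sv: "\<And>m. m < d \<Longrightarrow> norm (R (g m)) \<le> singular_value m R"
      and le: "(\<Sum>i\<in>I. (\<Sum>k\<in>K. (norm (R (C k (e i))))\<^sup>2) powr (s / 2))
        \<le> c powr s * (\<Sum>m<d. norm (R (g m)) powr s)"
    have pow: "L2_set f K powr s = (\<Sum>k\<in>K. (f k)\<^sup>2) powr (s / 2)" for f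
      by (simp add: L2_set_nonneg power2_powr_half flip: L2_set_power2)
    have "(\<Sum>m<d. norm (R (g m)) powr s) \<le> (\<Sum>m<d. singular_value m R powr s)"
      using s sv by (intro sum_mono powr_mono2) auto
    also have "\<dots> \<le> \<Sigma>"
      unfolding \<Sigma>_def by (rule sum_le_suminf[OF summable]) auto
    finally have "c powr s * (\<Sum>m<d. norm (R (g m)) powr s) \<le> c powr s * \<Sigma>"
      by (rule mult_left_mono) simp
    also have "\<dots> = (c * \<Sigma> powr (1 / s)) powr s"
      using s \<open>0 \<le> c\<close> \<open>0 \<le> \<Sigma>\<close> by (simp add: powr_mult powr_powr)
    finally show ?thesis
      using le False by (simp add: lp_bound_def norm_R pow flip: s_def)
  qed
qed

lemma lp_bound_tendsto:
  assumes lim: "\<And>i. i \<in> I \<Longrightarrow> ((\<lambda>p. x p i) \<longlongrightarrow> z i) F" and "F \<noteq> bot"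
    and bound: "\<And>p. lp_bound r I (x p) K" and r: "2 \<le> r"
    and nonneg: "\<And>p i. 0 \<le> x p i"
  shows "lp_bound r I z K"
proof (cases "r = \<infinity>")
  case True
  then show ?thesis
    using bound by (auto simp: lp_bound_def intro!: tendsto_upperbound[OF lim _ \<open>F \<noteq> bot\<close>] always_eventually)
next
  case False
  define s where "s = enn2real r"
  have s: "2 \<le> s"
    unfolding s_def by (rule ge_2_enn2real[OF r False])
  have "((\<lambda>p. \<Sum>i\<in>I. x p i powr s) \<longlongrightarrow> (\<Sum>i\<in>I. z i powr s)) F"
    using s by (intro tendsto_sum tendsto_powr2 lim tendsto_const always_eventually allI nonneg) auto
  then have "(\<Sum>i\<in>I. z i powr s) \<le> K powr s"
    by (rule tendsto_upperbound[OF _ _ \<open>F \<noteq> bot\<close>])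
      (use bound False in \<open>auto simp: lp_bound_def s_def intro!: always_eventually\<close>)
  then show ?thesis
    using False by (simp add: lp_bound_def s_def)
qed

text \<open>All rectangular partial sums satisfy the estimate with the same constant, and for
  finitely many indices the weak limit preserves it. For each index the matrix bound separates a
  factor coming from R and \<open>C\<close> from one coming from T and \<open>A\<close>, and
  Hoelder's inequality joins them.\<close>

lemma (in bounded_representation) schatten_norm_triple_operator_integral_le:
  assumes T: "T \<in> bounded_operators" and R: "R \<in> bounded_operators" and W: "W \<in> bounded_operators"
    and wot: "wot_double_sum (\<lambda>j k. A j o\<^sub>L T o\<^sub>L B j k o\<^sub>L R o\<^sub>L C k) W"
    and p: "2 \<le> p" and q: "2 \<le> q" and r: "2 \<le> r" "1 / r = 1 / p + 1 / q"
    and fin: "schatten_norm p T < \<infinity>" "schatten_norm q R < \<infinity>"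
  shows "schatten_norm r W \<le> ennreal (a * b * c * enn2real (schatten_norm p T) * enn2real (schatten_norm q R))"
proof (rule schatten_norm_le_lp_bound[OF W r(1)])
  let ?t = "enn2real (schatten_norm p T)" and ?s = "enn2real (schatten_norm q R)"
  show "0 \<le> a * b * c * ?t * ?s"
    using nonneg by simp
  fix I :: "nat set" and e f :: "nat \<Rightarrow> 'h"
  assume I: "finite I" and e: "orthonormal_on I e" and f: "orthonormal_on I f"
  define z where "z = (\<lambda>pr i. cmod (cinner ((partial_sum T R (fst pr) (snd pr)) (e i)) (f i)))"
  show "lp_bound r I (\<lambda>i. cmod (cinner (W (e i)) (f i))) (a * b * c * ?t * ?s)"
  proof (rule lp_bound_tendsto[where x = z and F = "sequentially \<times>\<^sub>F sequentially"])
    show "((\<lambda>p. z p i) \<longlongrightarrow> cmod (cinner (W (e i)) (f i))) (sequentially \<times>\<^sub>F sequentially)" for i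
      using wot unfolding z_def wot_double_sum_def partial_sum_def
      by (intro tendsto_norm) (simp add: case_prod_unfold)
    show "lp_bound r I (z pr) (a * b * c * ?t * ?s)" for pr
    proof -
      obtain m n where pr: "pr = (m, n)" by (cases pr)
      let ?x = "\<lambda>i. L2_set (\<lambda>k. norm (\<eta> R (e i) k)) {..n}"
      let ?y = "\<lambda>i. L2_set (\<lambda>j. norm (\<xi> T (f i) j)) {..m}"
      have "lp_bound q I ?x (c * ?s)"
        unfolding \<eta>_def
        by (rule lp_bound_column[OF R bounded_operators_ABC(3) I _ nonneg(3) q fin(2) _ _ e])
          (simp_all add: column_bounds)
      moreover have "lp_bound p I ?y (a * ?t)"
      proof -
        have le: "schatten_norm p (adjoint_operator T) \<le> schatten_norm p T"
          by (rule schatten_class_adjoint[OF T p])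
        \<comment> \<open>Here the adjoints of T and \<open>A j\<close> play the roles of R and
          \<open>C k\<close>; the second adjoint returns \<open>A j\<close>, so
          \<open>column_bounds\<close> supplies both square-sum hypotheses.\<close>
        have y: "lp_bound p I ?y (a * enn2real (schatten_norm p (adjoint_operator T)))"
          unfolding \<xi>_def
          by (rule lp_bound_column[OF adjoint_bounded_operators[OF T] adjoint_bounded_operators[OF bounded_operators_ABC(1)] I _ nonneg(1) p _ _ _ f])
            (use le fin(1) in \<open>simp_all add: column_bounds adjoint_adjoint bounded_operators_ABC\<close>)
        have "enn2real (schatten_norm p (adjoint_operator T)) \<le> ?t"
          using le fin(1) by (intro enn2real_mono) auto
        then have "a * enn2real (schatten_norm p (adjoint_operator T)) \<le> a * ?t"
          by (intro mult_left_mono nonneg)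
        then show ?thesis
          using y nonneg by (intro lp_bound_weaken[OF y]) auto
      qed
      ultimately have "lp_bound r I (\<lambda>i. ?x i * ?y i) (c * ?s * (a * ?t))"
        by (intro Hoelder_lp_bound[OF p q r(2) I]) (use nonneg in \<open>auto intro: L2_set_nonneg\<close>)
      then have "lp_bound r I (\<lambda>i. b * (?x i * ?y i)) (b * (c * ?s * (a * ?t)))"
        by (rule lp_bound_cmult) (use nonneg in \<open>auto intro: L2_set_nonneg\<close>)
      then have "lp_bound r I (z pr) (b * (c * ?s * (a * ?t)))"
        by (rule lp_bound_mono) (use cinner_partial_sum_le[OF T] in \<open>auto simp: z_def pr mult.assoc\<close>)
      then show ?thesis
        by (simp add: mult_ac)
    qed
  qed (use r(1) in \<open>auto simp: z_def prod_filter_eq_bot\<close>)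
qed

subsection \<open>Haagerup representations\<close>

lemma L2_set_le_l2_norm:
  assumes "l2_norm x \<le> ennreal a" "0 \<le> a" "finite J"
  shows "L2_set (\<lambda>j. cmod (x j)) J \<le> a"
proof -
  have summable: "summable (\<lambda>j. (cmod (x j))\<^sup>2)" and le: "sqrt (\<Sum>j. (cmod (x j))\<^sup>2) \<le> a"
    using assms(1,2) by (auto simp: l2_norm_def top_unique split: if_splits)
  have "L2_set (\<lambda>j. cmod (x j)) J \<le> sqrt (\<Sum>j. (cmod (x j))\<^sup>2)"
    unfolding L2_set_def using assms(3) by (intro real_sqrt_le_mono sum_le_suminf summable) auto
  then show ?thesis using le by simp
qed

lemma l2_norm_finite_support:
  assumes "finite K"
  shows "l2_norm (\<lambda>k. if k \<in> K then x k else 0) = ennreal (L2_set (\<lambda>k. cmod (x k)) K)"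
proof -
  have eq: "(\<lambda>k. (cmod (if k \<in> K then x k else 0))\<^sup>2) = (\<lambda>k. if k \<in> K then (cmod (x k))\<^sup>2 else 0)"
    by auto
  have "(\<lambda>k. if k \<in> K then (cmod (x k))\<^sup>2 else 0) sums (\<Sum>k\<in>K. (cmod (x k))\<^sup>2)"
    by (rule sums_If_finite_set[OF assms])
  then show ?thesis
    unfolding l2_norm_def eq by (simp add: sums_iff L2_set_def)
qed

text \<open>Vectors supported on K reduce the infinite matrix to its section. The infimum in
  \<open>matrix_norm\<close> is approached from above, hence the detour through
  \<open>C + \<epsilon>\<close>.\<close>

lemma matrix_bound_of_matrix_norm:
  assumes "matrix_norm b \<le> ennreal C" "0 \<le> C" and fin: "finite J" "finite K"
  shows "matrix_bound J K b C"
  unfolding matrix_bound_def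
proof (intro allI)
  fix x y :: "nat \<Rightarrow> complex"
  let ?X = "L2_set (\<lambda>k. cmod (x k)) K" and ?Y = "L2_set (\<lambda>j. cmod (y j)) J"
  let ?s = "cmod (\<Sum>j\<in>J. \<Sum>k\<in>K. b j k * x k * cnj (y j))"
  have XY: "0 \<le> ?X" "0 \<le> ?Y" by (simp_all add: L2_set_nonneg)
  have approx: "?s \<le> (C + \<epsilon>) * ?X * ?Y" if "0 < \<epsilon>" for \<epsilon>
  proof -
    have "ennreal C < ennreal (C + \<epsilon>)"
      using that \<open>0 \<le> C\<close> by (simp add: ennreal_less_iff)
    then have "matrix_norm b < ennreal (C + \<epsilon>)"
      using assms(1) by (rule le_less_trans[rotated])
    then obtain D where D: "D < ennreal (C + \<epsilon>)"
      "\<forall>a. l2_norm a < \<infinity> \<longrightarrow> (\<forall>j. summable (\<lambda>k. b j k * a k)) \<and> l2_norm (\<lambda>j. \<Sum>k. b j k * a k) \<le> D * l2_norm a"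
      unfolding matrix_norm_def Inf_less_iff by auto
    let ?x = "\<lambda>k. if k \<in> K then x k else 0"
    let ?z = "\<lambda>j. \<Sum>k. b j k * ?x k"
    have z: "?z j = (\<Sum>k\<in>K. b j k * x k)" for j
    proof -
      have "?z j = (\<Sum>k\<in>K. b j k * ?x k)"
        by (rule suminf_finite) (use fin in auto)
      then show ?thesis by simp
    qed
    have "l2_norm ?z \<le> D * ennreal ?X"
      using D(2)[rule_format, of ?x] l2_norm_finite_support[OF fin(2), of x] by simp
    also have "\<dots> \<le> ennreal (C + \<epsilon>) * ennreal ?X"
      using D(1) by (intro mult_right_mono) auto
    also have "\<dots> = ennreal ((C + \<epsilon>) * ?X)"
      using that \<open>0 \<le> C\<close> by (simp add: ennreal_mult XY)
    finally have Z: "L2_set (\<lambda>j. cmod (?z j)) J \<le> (C + \<epsilon>) * ?X"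
      by (rule L2_set_le_l2_norm) (use that \<open>0 \<le> C\<close> XY fin in auto)
    have "(\<Sum>j\<in>J. \<Sum>k\<in>K. b j k * x k * cnj (y j)) = (\<Sum>j\<in>J. ?z j * cnj (y j))"
      unfolding z by (simp add: sum_distrib_right)
    also have "cmod \<dots> \<le> (\<Sum>j\<in>J. \<bar>cmod (?z j)\<bar> * \<bar>cmod (y j)\<bar>)"
      by (rule sum_norm_le) (simp add: norm_mult)
    also have "\<dots> \<le> L2_set (\<lambda>j. cmod (?z j)) J * ?Y"
      by (rule L2_set_mult_ineq)
    also have "\<dots> \<le> (C + \<epsilon>) * ?X * ?Y"
      by (intro mult_right_mono Z XY)
    finally show ?thesis .
  qed
  show "?s \<le> C * ?X * ?Y"
  proof (rule field_le_epsilon)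
    fix e :: real assume "0 < e"
    have pos: "0 < ?X * ?Y + 1" using XY by (simp add: add_nonneg_pos)
    have "e / (?X * ?Y + 1) * (?X * ?Y) \<le> e"
      using pos \<open>0 < e\<close> by (simp add: field_simps)
    moreover have "?s \<le> C * ?X * ?Y + e / (?X * ?Y + 1) * (?X * ?Y)"
      using approx[of "e / (?X * ?Y + 1)"] pos \<open>0 < e\<close> by (simp add: algebra_simps)
    ultimately show "?s \<le> C * ?X * ?Y + e" by simp
  qed
qed

lemma Linf_l2_AE:
  assumes E: "spectral_measure M E" and \<alpha>: "\<alpha> \<in> Linf_l2 M E"
  shows "spectral_AE M E (\<lambda>x. \<forall>J. finite J \<longrightarrow>
    L2_set (\<lambda>j. cmod (\<alpha> j x)) J \<le> enn2real (Linf_l2_norm M E \<alpha>))"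
proof -
  have fin: "Linf_l2_norm M E \<alpha> < \<infinity>" using \<alpha> by (simp add: Linf_l2_def)
  from spectral_AE_le_ess_sup[OF E fin[unfolded Linf_l2_norm_def]] show ?thesis
    unfolding Linf_l2_norm_def[symmetric]
    by (rule spectral_AE_mono) (use fin in \<open>auto intro!: L2_set_le_l2_norm\<close>)
qed

lemma Linf_matrix_AE:
  assumes E: "spectral_measure M E" and \<beta>: "\<beta> \<in> Linf_matrix M E"
  shows "spectral_AE M E (\<lambda>x. \<forall>J K. finite J \<longrightarrow> finite K \<longrightarrow>
    matrix_bound J K (\<lambda>j k. \<beta> j k x) (enn2real (Linf_matrix_norm M E \<beta>)))"
proof -
  have fin: "Linf_matrix_norm M E \<beta> < \<infinity>" using \<beta> by (simp add: Linf_matrix_def)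
  from spectral_AE_le_ess_sup[OF E fin[unfolded Linf_matrix_norm_def]] show ?thesis
    unfolding Linf_matrix_norm_def[symmetric]
    by (rule spectral_AE_mono) (use fin in \<open>auto intro!: matrix_bound_of_matrix_norm\<close>)
qed

lemma bounded_representation_haagerup:
  assumes E: "spectral_measure M1 E1" "spectral_measure M2 E2" "spectral_measure M3 E3"
    and rep: "haagerup_representation M1 E1 M2 E2 M3 E3 \<Psi> \<alpha> \<beta> \<gamma>"
  shows "bounded_representation M1 E1 M2 E2 M3 E3 \<alpha> \<beta> \<gamma> (enn2real (Linf_l2_norm M1 E1 \<alpha>))
    (enn2real (Linf_matrix_norm M2 E2 \<beta>)) (enn2real (Linf_l2_norm M3 E3 \<gamma>))"
proof
  have mem: "\<alpha> \<in> Linf_l2 M1 E1" "\<beta> \<in> Linf_matrix M2 E2" "\<gamma> \<in> Linf_l2 M3 E3"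
    using rep by (auto simp: haagerup_representation_def)
  show "\<alpha> j \<in> borel_measurable M1" "\<beta> j k \<in> borel_measurable M2" "\<gamma> k \<in> borel_measurable M3" for j k
    using mem by (auto simp: Linf_l2_def Linf_matrix_def)
  show "spectral_AE M1 E1 (\<lambda>x. \<forall>J. finite J \<longrightarrow>
      L2_set (\<lambda>j. cmod (\<alpha> j x)) J \<le> enn2real (Linf_l2_norm M1 E1 \<alpha>))"
    by (rule Linf_l2_AE[OF E(1) mem(1)])
  show "spectral_AE M2 E2 (\<lambda>x. \<forall>J K. finite J \<longrightarrow> finite K \<longrightarrow>
      matrix_bound J K (\<lambda>j k. \<beta> j k x) (enn2real (Linf_matrix_norm M2 E2 \<beta>)))"
    by (rule Linf_matrix_AE[OF E(2) mem(2)])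
  show "spectral_AE M3 E3 (\<lambda>x. \<forall>J. finite J \<longrightarrow>
      L2_set (\<lambda>k. cmod (\<gamma> k x)) J \<le> enn2real (Linf_l2_norm M3 E3 \<gamma>))"
    by (rule Linf_l2_AE[OF E(3) mem(3)])
qed (use E in simp_all)

lemma haagerup_representation_diagonal:
  assumes "haagerup_representation M1 E1 M2 E2 M3 E3 \<Psi> \<alpha> \<beta> \<gamma>"
    and "x1 \<in> space M1" "x2 \<in> space M2" "x3 \<in> space M3"
  shows "(\<lambda>n. \<Sum>j\<le>n. \<Sum>k\<le>n. \<alpha> j x1 * \<beta> j k x2 * \<gamma> k x3) \<longlonglongrightarrow> \<Psi> x1 x2 x3"
proof -
  have "((\<lambda>(m, n). \<Sum>j\<le>m. \<Sum>k\<le>n. \<alpha> j x1 * \<beta> j k x2 * \<gamma> k x3) \<longlongrightarrow> \<Psi> x1 x2 x3)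
    (sequentially \<times>\<^sub>F sequentially)"
    using assms by (auto simp: haagerup_representation_def)
  from filterlim_compose[OF this filterlim_diagonal] show ?thesis
    by simp
qed

text \<open>Existence gives a limit for the representation at hand, and uniqueness across
  representations shows that the description picks it. The same operator is thus available for every
  representation, as the infimum in \<open>haagerup_norm\<close> requires.\<close>

lemma triple_operator_integral_representation:
  assumes E: "spectral_measure M1 E1" "spectral_measure M2 E2" "spectral_measure M3 E3"
    and T: "T \<in> bounded_operators" and R: "R \<in> bounded_operators"
    and rep: "haagerup_representation M1 E1 M2 E2 M3 E3 \<Psi> \<alpha> \<beta> \<gamma>"
  shows "triple_operator_integral M1 E1 M2 E2 M3 E3 \<Psi> T R \<in> bounded_operators \<and>
    wot_double_sum (\<lambda>j k. spectral_integral M1 E1 (\<alpha> j) o\<^sub>L T o\<^sub>L spectral_integral M2 E2 (\<beta> j k)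
      o\<^sub>L R o\<^sub>L spectral_integral M3 E3 (\<gamma> k)) (triple_operator_integral M1 E1 M2 E2 M3 E3 \<Psi> T R)"
proof -
  interpret r: bounded_representation M1 E1 M2 E2 M3 E3 \<alpha> \<beta> \<gamma> "enn2real (Linf_l2_norm M1 E1 \<alpha>)"
    "enn2real (Linf_matrix_norm M2 E2 \<beta>)" "enn2real (Linf_l2_norm M3 E3 \<gamma>)"
    by (rule bounded_representation_haagerup[OF E rep])
  obtain W where W: "W \<in> bounded_operators"
    "wot_double_sum (\<lambda>j k. r.A j o\<^sub>L T o\<^sub>L r.B j k o\<^sub>L R o\<^sub>L r.C k) W"
    by (rule r.triple_operator_integral_exists[OF T R])
  have "triple_operator_integral M1 E1 M2 E2 M3 E3 \<Psi> T R = W"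
    unfolding triple_operator_integral_def
  proof (rule the_equality)
    show "W \<in> bounded_operators \<and> (\<exists>\<alpha> \<beta> \<gamma>. haagerup_representation M1 E1 M2 E2 M3 E3 \<Psi> \<alpha> \<beta> \<gamma> \<and>
      wot_double_sum (\<lambda>j k. spectral_integral M1 E1 (\<alpha> j) o\<^sub>L T o\<^sub>L spectral_integral M2 E2 (\<beta> j k)
        o\<^sub>L R o\<^sub>L spectral_integral M3 E3 (\<gamma> k)) W)"
      using W rep unfolding r.A_def r.B_def r.C_def by (intro conjI exI)
    fix W'
    assume "W' \<in> bounded_operators \<and> (\<exists>\<alpha> \<beta> \<gamma>. haagerup_representation M1 E1 M2 E2 M3 E3 \<Psi> \<alpha> \<beta> \<gamma> \<and>
      wot_double_sum (\<lambda>j k. spectral_integral M1 E1 (\<alpha> j) o\<^sub>L T o\<^sub>L spectral_integral M2 E2 (\<beta> j k)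
        o\<^sub>L R o\<^sub>L spectral_integral M3 E3 (\<gamma> k)) W')"
    then obtain \<alpha>' \<beta>' \<gamma>' where rep': "haagerup_representation M1 E1 M2 E2 M3 E3 \<Psi> \<alpha>' \<beta>' \<gamma>'"
      and wot': "wot_double_sum (\<lambda>j k. spectral_integral M1 E1 (\<alpha>' j) o\<^sub>L T o\<^sub>L spectral_integral M2 E2 (\<beta>' j k)
        o\<^sub>L R o\<^sub>L spectral_integral M3 E3 (\<gamma>' k)) W'"
      by blast
    interpret r': bounded_representation M1 E1 M2 E2 M3 E3 \<alpha>' \<beta>' \<gamma>' "enn2real (Linf_l2_norm M1 E1 \<alpha>')"
      "enn2real (Linf_matrix_norm M2 E2 \<beta>')" "enn2real (Linf_l2_norm M3 E3 \<gamma>')"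
      by (rule bounded_representation_haagerup[OF E rep'])
    interpret two_representations M1 E1 M2 E2 M3 E3 \<alpha>' \<beta>' \<gamma>' "enn2real (Linf_l2_norm M1 E1 \<alpha>')"
      "enn2real (Linf_matrix_norm M2 E2 \<beta>')" "enn2real (Linf_l2_norm M3 E3 \<gamma>')"
      \<alpha> \<beta> \<gamma> "enn2real (Linf_l2_norm M1 E1 \<alpha>)"
      "enn2real (Linf_matrix_norm M2 E2 \<beta>)" "enn2real (Linf_l2_norm M3 E3 \<gamma>)"
    proof
      fix x1 x2 x3 assume x: "x1 \<in> space M1" "x2 \<in> space M2" "x3 \<in> space M3"
      show "(\<lambda>n. (\<Sum>j\<le>n. \<Sum>k\<le>n. \<alpha>' j x1 * \<beta>' j k x2 * \<gamma>' k x3)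
        - (\<Sum>j\<le>n. \<Sum>k\<le>n. \<alpha> j x1 * \<beta> j k x2 * \<gamma> k x3)) \<longlonglongrightarrow> 0"
        using tendsto_diff[OF haagerup_representation_diagonal[OF rep' x] haagerup_representation_diagonal[OF rep x]]
        by simp
    qed
    show "W' = W"
      by (rule triple_operator_integral_unique[OF T R _ W(2)])
        (use wot' in \<open>simp only: r'.A_def r'.B_def r'.C_def\<close>)
  qed
  then show ?thesis
    using W by (simp only: r.A_def r.B_def r.C_def simp_thms)
qed

section \<open>The infimum over all representations\<close>

lemma inverse_le_of_ge_2:
  fixes p :: ennreal
  assumes "2 \<le> p"
  shows "1 / p \<le> 1 / 2"
proof (cases p)
  case (real t)
  then have t: "2 \<le> t"
    using assms by (simp add: ennreal_le_iff2 flip: ennreal_numeral)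
  then have "1 / p = ennreal (1 / t)" "(1 :: ennreal) / 2 = ennreal (1 / 2)"
    using real divide_ennreal[of 1 t] divide_ennreal[of 1 2] by simp_all
  moreover have "ennreal (1 / t) \<le> ennreal (1 / 2)"
    using t by (intro ennreal_leI) (simp add: field_simps)
  ultimately show ?thesis by (simp only:)
qed (simp add: divide_ennreal_def)

text \<open>Division by K reduces this to the greatest lower bound property; for
  \<open>K = 0\<close> any element of X shows that S is 0.\<close>

lemma le_Inf_mult_ennreal:
  fixes S K :: ennreal
  assumes "\<And>x. x \<in> X \<Longrightarrow> S \<le> x * K" "K < \<infinity>" "X \<noteq> {}"
  shows "S \<le> Inf X * K"
proof (cases "K = 0")
  case True
  then show ?thesis using assms by auto
next
  case False
  then have K: "0 < K" by (simp add: zero_less_iff_neq_zero)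
  have "S / K \<le> Inf X"
    by (rule Inf_greatest) (use assms(1) K in \<open>auto intro!: divide_le_posI_ennreal simp: mult.commute\<close>)
  then have "S / K * K \<le> Inf X * K"
    by (rule mult_right_mono) simp
  then show ?thesis
    using K assms(2) by (simp add: ennreal_divide_times)
qed

text \<open>W is the same operator for all representations of \<Psi>, so each of them bounds its
  norm; the infimum is then taken with the finite factor from T and R kept outside.\<close>

lemma triple_operator_integral_schatten:
  fixes E1 :: "'x set \<Rightarrow> 'h::complex_hilbert_space \<Rightarrow>\<^sub>L 'h"
  assumes E: "spectral_measure M1 E1" "spectral_measure M2 E2" "spectral_measure M3 E3"
    and \<Psi>: "\<Psi> \<in> haagerup_tensor M1 E1 M2 E2 M3 E3"
    and pq: "1 / p + 1 / q \<le> 1 / 2" and r: "1 / r = 1 / p + 1 / q"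
    and T: "T \<in> schatten_class p" and R: "R \<in> schatten_class q"
    and W: "W = triple_operator_integral M1 E1 M2 E2 M3 E3 \<Psi> T R"
  shows "W \<in> schatten_class r \<and> schatten_norm r W
    \<le> haagerup_norm M1 E1 M2 E2 M3 E3 \<Psi> * schatten_norm p T * schatten_norm q R"
proof -
  have T': "T \<in> bounded_operators" "schatten_norm p T < \<infinity>"
    and R': "R \<in> bounded_operators" "schatten_norm q R < \<infinity>"
    using T R by (auto simp: schatten_class_def)
  have ge2: "2 \<le> p" "2 \<le> q" "2 \<le> r"
    using pq r by (auto intro!: ge_2_of_inverse_le elim: order_trans[rotated])
  have bound: "schatten_norm r W \<le> Linf_l2_norm M1 E1 \<alpha> * Linf_matrix_norm M2 E2 \<beta> * Linf_l2_norm M3 E3 \<gamma>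
      * (schatten_norm p T * schatten_norm q R)"
    and norms_fin: "Linf_l2_norm M1 E1 \<alpha> * Linf_matrix_norm M2 E2 \<beta> * Linf_l2_norm M3 E3 \<gamma> < \<infinity>"
    and W_bounded: "W \<in> bounded_operators"
    if rep: "haagerup_representation M1 E1 M2 E2 M3 E3 \<Psi> \<alpha> \<beta> \<gamma>" for \<alpha> \<beta> \<gamma>
  proof -
    interpret r: bounded_representation M1 E1 M2 E2 M3 E3 \<alpha> \<beta> \<gamma> "enn2real (Linf_l2_norm M1 E1 \<alpha>)"
      "enn2real (Linf_matrix_norm M2 E2 \<beta>)" "enn2real (Linf_l2_norm M3 E3 \<gamma>)"
      by (rule bounded_representation_haagerup[OF E rep])
    note Wrep = triple_operator_integral_representation[OF E T'(1) R'(1) rep, folded W]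
    show "W \<in> bounded_operators" using Wrep by blast
    have fin: "Linf_l2_norm M1 E1 \<alpha> < top" "Linf_matrix_norm M2 E2 \<beta> < top" "Linf_l2_norm M3 E3 \<gamma> < top"
      using rep by (auto simp: haagerup_representation_def Linf_l2_def Linf_matrix_def)
    then show "Linf_l2_norm M1 E1 \<alpha> * Linf_matrix_norm M2 E2 \<beta> * Linf_l2_norm M3 E3 \<gamma> < \<infinity>"
      by (simp add: ennreal_mult_less_top)
    have "schatten_norm r W \<le> ennreal (enn2real (Linf_l2_norm M1 E1 \<alpha>) * enn2real (Linf_matrix_norm M2 E2 \<beta>)
      * enn2real (Linf_l2_norm M3 E3 \<gamma>) * enn2real (schatten_norm p T) * enn2real (schatten_norm q R))"
      by (rule r.schatten_norm_triple_operator_integral_le[OF T'(1) R'(1) _ _ ge2 r T'(2) R'(2)])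
        (use Wrep in \<open>simp_all only: r.A_def r.B_def r.C_def\<close>)
    also have "\<dots> = Linf_l2_norm M1 E1 \<alpha> * Linf_matrix_norm M2 E2 \<beta> * Linf_l2_norm M3 E3 \<gamma>
      * (schatten_norm p T * schatten_norm q R)"
      using fin T'(2) R'(2) by (simp add: ennreal_mult mult.assoc)
    finally show "schatten_norm r W \<le> Linf_l2_norm M1 E1 \<alpha> * Linf_matrix_norm M2 E2 \<beta> * Linf_l2_norm M3 E3 \<gamma>
      * (schatten_norm p T * schatten_norm q R)" .
  qed
  obtain \<alpha> \<beta> \<gamma> where rep: "haagerup_representation M1 E1 M2 E2 M3 E3 \<Psi> \<alpha> \<beta> \<gamma>"
    using \<Psi> by (auto simp: haagerup_tensor_def)
  have K: "schatten_norm p T * schatten_norm q R < \<infinity>"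
    using T'(2) R'(2) by (simp add: ennreal_mult_less_top)
  have "schatten_norm r W < \<infinity>"
    using bound[OF rep] norms_fin[OF rep] K by (auto simp: ennreal_mult_less_top elim!: le_less_trans)
  moreover have "schatten_norm r W \<le> haagerup_norm M1 E1 M2 E2 M3 E3 \<Psi> * (schatten_norm p T * schatten_norm q R)"
    unfolding haagerup_norm_def
    by (rule le_Inf_mult_ennreal) (use bound K rep in auto)
  ultimately show ?thesis
    using W_bounded[OF rep] by (simp add: schatten_class_def mult.assoc)
qed

theorem theorem2p1:
  fixes M1 :: "'x measure" and M2 :: "'y measure" and M3 :: "'z measure"
    and E1 :: "'x set \<Rightarrow> 'h::complex_hilbert_space \<Rightarrow>\<^sub>L 'h"
    and E2 :: "'y set \<Rightarrow> 'h \<Rightarrow>\<^sub>L 'h"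
    and E3 :: "'z set \<Rightarrow> 'h \<Rightarrow>\<^sub>L 'h"
    and \<Psi> :: "'x \<Rightarrow> 'y \<Rightarrow> 'z \<Rightarrow> complex"
    and T R W :: "'h \<Rightarrow>\<^sub>L 'h"
  assumes "spectral_measure M1 E1" and "spectral_measure M2 E2" and "spectral_measure M3 E3"
    and "\<Psi> \<in> haagerup_tensor M1 E1 M2 E2 M3 E3"
    and "T \<in> bounded_operators" and "R \<in> bounded_operators"
    and "W = triple_operator_integral M1 E1 M2 E2 M3 E3 \<Psi> T R"
  shows "(\<forall>p::ennreal. 2 \<le> p \<and> R \<in> schatten_class p \<longrightarrow>
            W \<in> schatten_class p \<and>
            schatten_norm p W
              \<le> haagerup_norm M1 E1 M2 E2 M3 E3 \<Psi> * ennreal (norm T) * schatten_norm p R)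
       \<and> (\<forall>p::ennreal. 2 \<le> p \<and> T \<in> schatten_class p \<longrightarrow>
            W \<in> schatten_class p \<and>
            schatten_norm p W
              \<le> haagerup_norm M1 E1 M2 E2 M3 E3 \<Psi> * schatten_norm p T * ennreal (norm R))
       \<and> (\<forall>p q r::ennreal. 1 / p + 1 / q \<le> 1 / 2 \<and> 1 / r = 1 / p + 1 / q
            \<and> T \<in> schatten_class p \<and> R \<in> schatten_class q \<longrightarrow>
            W \<in> schatten_class r \<and>
            schatten_norm r W
              \<le> haagerup_norm M1 E1 M2 E2 M3 E3 \<Psi> * schatten_norm p T * schatten_norm q R)"
proof -
  note main = triple_operator_integral_schatten[OF assms(1-4) _ _ _ _ assms(7)]
  have norm_top: "schatten_norm top S = ennreal (norm S)" for S :: "'h \<Rightarrow>\<^sub>L 'h"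
    by (simp add: schatten_norm_def)
  have class_top: "S \<in> schatten_class top" if "S \<in> bounded_operators" for S :: "'h \<Rightarrow>\<^sub>L 'h"
    using that by (simp add: schatten_class_def norm_top)
  have i: "W \<in> schatten_class p \<and> schatten_norm p W
      \<le> haagerup_norm M1 E1 M2 E2 M3 E3 \<Psi> * ennreal (norm T) * schatten_norm p R"
    if "2 \<le> p" "R \<in> schatten_class p" for p
    using main[of top p p] that class_top[OF assms(5)] inverse_le_of_ge_2[of p] by (simp add: norm_top)
  have ii: "W \<in> schatten_class p \<and> schatten_norm p W
      \<le> haagerup_norm M1 E1 M2 E2 M3 E3 \<Psi> * schatten_norm p T * ennreal (norm R)"
    if "2 \<le> p" "T \<in> schatten_class p" for p
    using main[of p top p] that class_top[OF assms(6)] inverse_le_of_ge_2[of p] by (simp add: norm_top)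
  show ?thesis
    by (intro conjI[OF _ conjI] allI impI; elim conjE) (rule i ii main; assumption)+
qed

end
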